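(* Let $p\in(0,1)$. For any $n\ge 1$ and any (unlabeled) graph $H$ with $n$ vertices, $$\mathbb E\big[\mathrm{dens}(H,\boldsymbol{W}^{\mathrm{rec}}_p)\big]=\mathbb P\big[G^{(n),p}=H\big]=\frac{N_{inc}(H)}{(n-1)!}\,p^{Z(H)}\,(1-p)^{\,n-1-Z(H)},$$ where $N_{inc}(H)$ is the number of increasing binary cotrees $T$ encoding $H$, and $Z(H)$ is the number of decorations $0$ in any binary cotree encoding $H$ (if $H$ is not a cograph, $N_{inc}(H)=0$ and the right-hand side is $0$).
   Context: Graphs are considered up to isomorphism, so that $G^{(n),p}=H$ means that the two graphs are isomorphic. Random recursive cographs: $G^{(1),p}$ is the graph with one vertex. Given $G^{(n),p}$ with $n$ vertices, $G^{(n+1),p}$ is obtained as follows, with randomness independent of the past: let $v$ be a uniform random vertex of $G^{(n),p}$; add a new vertex $v'$ with the same set of neighbours as $v$; with probability $1-p$ connect $v$ and $v'$ by an edge (with probability $p$ leave them unconnected). A graphon is a measurable symmetric function $[0,1]^2\to[0,1]$, up to weak isomorphism. For a graph $H$ with $n$ vertices and a graphon $W$, $\mathrm{dens}(H,W)$ is the induced density: the probability that the random graph on $\{1,\dots,n\}$ obtained by taking $x_1,\dots,x_n$ i.i.d. uniform in $[0,1]$ and connecting $i,j$ independently with probability $W(x_i,x_j)$ is isomorphic to $H$. Recursive cographon $\boldsymbol{W}^{\mathrm{rec}}_p$: let $(U_j)_{j\ge1}$ be i.i.d. uniform in $[0,1]$ and $(S_j)_{j\ge1}$ be i.i.d. signs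 in $\{\oplus,\ominus\}$ with $\mathbb P(S_j=\oplus)=p$, the two sequences being independent. For $x<y$ in $[0,1]$ let $j$ be the minimal index $j\ge 1$ such that $U_j\in(x,y]$; set $x\prec y$ if $S_j=\oplus$ and $y\prec x$ if $S_j=\ominus$ (almost surely $\prec$ is a total order). A representative of $\boldsymbol{W}^{\mathrm{rec}}_p$ is given, for $x<y$, by $\boldsymbol{W}^{\mathrm{rec}}_p(x,y)=\boldsymbol{W}^{\mathrm{rec}}_p(y,x)=0$ if $x\prec y$ and $=1$ if $y\prec x$. Binary cotrees: a binary cotree is a rooted tree in which every internal node has exactly two ordered children and carries a decoration in $\{0,1\}$. It encodes the graph whose vertices are its leaves, two leaves being adjacent if and only if their lowest common ancestor has decoration $1$. A graph is a cograph if it is encoded by some cotree. The number of decorations $0$ is the same in all binary cotrees encoding a given cograph. An increasing binary cotree is one whose $k$ internal nodes are moreover labeled bijectively by $1,\dots,k$, with labels increasing along any path from the root to a leaf; leaves are unlabeled. *)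

theory Defs
  imports "HOL-Probability.Probability" "HOL-Library.Tree" "HOL-Library.Sublist"
begin

section \<open>Finite simple graphs\<close>

datatype 'a graph = Graph (verts: "'a set") (edges: "'a set set")

definition simple_graph :: "'a graph \<Rightarrow> bool" where
  "simple_graph G \<longleftrightarrow> finite (verts G) \<and> (\<forall>e\<in>edges G. e \<subseteq> verts G \<and> card e = 2)"

text \<open>Unlabeled graphs are represented by labeled ones; equality becomes \<open>graph_iso\<close>.\<close>

definition graph_iso :: "'a graph \<Rightarrow> 'b graph \<Rightarrow> bool" where
  "graph_iso G H \<longleftrightarrow> (\<exists>f. bij_betw f (verts G) (verts H) \<and>
     (\<forall>u\<in>verts G. \<forall>v\<in>verts G. {u, v} \<in> edges G \<longleftrightarrow> {f u, f v} \<in> edges H))"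


section \<open>Random recursive cographs\<close>

text \<open>The vertices of the \<open>n\<close>-th graph are \<open>1, \<dots>, n\<close>, in order of appearance.\<close>

definition add_twin :: "'a \<Rightarrow> 'a \<Rightarrow> bool \<Rightarrow> 'a graph \<Rightarrow> 'a graph" where
  "add_twin v v' joined G = Graph (insert v' (verts G))
     (edges G \<union> {{u, v'} | u. {u, v} \<in> edges G} \<union> (if joined then {{v, v'}} else {}))"

text \<open>The process starts at index 1; the value at 0 is a dummy.\<close>

fun rec_cograph :: "real \<Rightarrow> nat \<Rightarrow> nat graph pmf" where
  "rec_cograph p 0 = return_pmf (Graph {} {})"
| "rec_cograph p (Suc 0) = return_pmf (Graph {1} {})"
| "rec_cograph p (Suc (Suc n)) =
     do { G \<leftarrow> rec_cograph p (Suc n);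
          v \<leftarrow> pmf_of_set (verts G);
          joined \<leftarrow> bernoulli_pmf (1 - p);
          return_pmf (add_twin v (Suc (Suc n)) joined G) }"


section \<open>Graphons and induced densities\<close>

abbreviation unit_lborel :: "real measure" where
  "unit_lborel \<equiv> restrict_space lborel {0..1}"

definition graphon :: "(real \<Rightarrow> real \<Rightarrow> real) \<Rightarrow> bool" where
  "graphon W \<longleftrightarrow> (\<lambda>(x, y). W x y) \<in> borel_measurable (unit_lborel \<Otimes>\<^sub>M unit_lborel) \<and>
     (\<forall>x\<in>{0..1}. \<forall>y\<in>{0..1}. W x y = W y x \<and> W x y \<in> {0..1})"

definition index_pairs :: "nat \<Rightarrow> (nat \<times> nat) set" where
  "index_pairs n = {(i, j). 1 \<le> i \<and> i < j \<and> j \<le> n}"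

definition graph_of_points :: "nat \<Rightarrow> (real \<Rightarrow> real \<Rightarrow> real) \<Rightarrow> (nat \<Rightarrow> real) \<Rightarrow> nat graph pmf" where
  "graph_of_points n W x =
     map_pmf (\<lambda>c. Graph {1..n} {{i, j} | i j. (i, j) \<in> index_pairs n \<and> c (i, j)})
       (Pi_pmf (index_pairs n) False (\<lambda>(i, j). bernoulli_pmf (W (x i) (x j))))"

definition W_random_graph :: "nat \<Rightarrow> (real \<Rightarrow> real \<Rightarrow> real) \<Rightarrow> nat graph measure" where
  "W_random_graph n W =
     (\<Pi>\<^sub>M i\<in>{1..n}. unit_lborel) \<bind> (\<lambda>x. measure_pmf (graph_of_points n W x))"

definition dens :: "'a graph \<Rightarrow> (real \<Rightarrow> real \<Rightarrow> real) \<Rightarrow> real" where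
  "dens H W = measure (W_random_graph (card (verts H)) W) {G. graph_iso G H}"


section \<open>The recursive cographon\<close>

datatype sign = Oplus | Ominus

definition minimal_index :: "(nat \<Rightarrow> real) \<Rightarrow> real \<Rightarrow> real \<Rightarrow> nat \<Rightarrow> bool" where
  "minimal_index U x y j \<longleftrightarrow> U j \<in> {x<..y} \<and> (\<forall>i<j. U i \<notin> {x<..y})"

definition rec_prec :: "(nat \<Rightarrow> real) \<Rightarrow> (nat \<Rightarrow> sign) \<Rightarrow> real \<Rightarrow> real \<Rightarrow> bool" where
  "rec_prec U S a b \<longleftrightarrow>
     (a < b \<and> (\<exists>j. minimal_index U a b j \<and> S j = Oplus)) \<or>
     (b < a \<and> (\<exists>j. minimal_index U b a j \<and> S j = Ominus))"

text \<open>
  The sequences are indexed from 0.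
  The value is 0 on the diagonal and at pairs not separated by any \<open>U j\<close>; almost surely there
  are no such pairs off the diagonal.
\<close>

definition rec_cographon :: "(nat \<Rightarrow> real) \<Rightarrow> (nat \<Rightarrow> sign) \<Rightarrow> real \<Rightarrow> real \<Rightarrow> real" where
  "rec_cographon U S x y =
     (if (x < y \<and> rec_prec U S y x) \<or> (y < x \<and> rec_prec U S x y) then 1 else 0)"


section \<open>Binary cotrees\<close>

text \<open>
  A binary cotree is a \<open>bool tree\<close>, whose \<open>Node\<close>s are the internal nodes; the decorations
  0 and 1 are \<open>False\<close> and \<open>True\<close>. A position in the tree is the path leading to it from the
  root (\<open>False\<close> for left, \<open>True\<close> for right), so that the lowest common ancestor of two
  positions is their longest common prefix.
\<close>

fun leaf_paths :: "'a tree \<Rightarrow> bool list set" where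
  "leaf_paths Leaf = {[]}"
| "leaf_paths (Node l a r) = (#) False ` leaf_paths l \<union> (#) True ` leaf_paths r"

fun node_at :: "'a tree \<Rightarrow> bool list \<Rightarrow> 'a option" where
  "node_at Leaf _ = None"
| "node_at (Node l a r) [] = Some a"
| "node_at (Node l a r) (b # bs) = node_at (if b then r else l) bs"

definition cotree_graph :: "bool tree \<Rightarrow> bool list graph" where
  "cotree_graph T = Graph (leaf_paths T)
     {{u, v} | u v. u \<in> leaf_paths T \<and> v \<in> leaf_paths T \<and> u \<noteq> v \<and>
        node_at T (longest_common_prefix u v) = Some True}"

definition encodes :: "bool tree \<Rightarrow> 'a graph \<Rightarrow> bool" where
  "encodes T H \<longleftrightarrow> graph_iso (cotree_graph T) H"

definition num_zeros :: "bool tree \<Rightarrow> nat" where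
  "num_zeros T = count_list (inorder T) False"

text \<open>
  All binary cotrees encoding a given cograph have the same number of decorations 0; if \<open>H\<close>
  is not a cograph, the value is unspecified.
\<close>

definition Z :: "'a graph \<Rightarrow> nat" where
  "Z H = (THE z. \<exists>T. encodes T H \<and> num_zeros T = z)"

text \<open>
  In an increasing binary cotree a node carries its label and its decoration. The predicate
  \<open>heap\<close> allows equal labels along a path, which \<open>distinct\<close> rules out.
\<close>

definition increasing :: "(nat \<times> bool) tree \<Rightarrow> bool" where
  "increasing T \<longleftrightarrow> (let L = map_tree fst T in
     heap L \<and> distinct (inorder L) \<and> set_tree L = {1..size T})"

definition N_inc :: "'a graph \<Rightarrow> nat" where
  "N_inc H = card {T. increasing T \<and> encodes (map_tree snd T) H}"


section \<open>Well-definedness of the random graph of a graphon\<close>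

lemma graphon_rec_cographon: "graphon (rec_cographon U S)"
proof -
  have [measurable]: "Measurable.pred (borel \<Otimes>\<^sub>M borel) (\<lambda>(x,y). rec_prec U S x y)"
    unfolding rec_prec_def minimal_index_def by (simp add: split_beta) measurable
  have m: "(\<lambda>(x,y). rec_cographon U S x y) \<in> borel_measurable (borel \<Otimes>\<^sub>M borel)"
    unfolding rec_cographon_def rec_prec_def minimal_index_def by (simp add: split_beta) measurable
  have id: "(\<lambda>z. z) \<in> unit_lborel \<Otimes>\<^sub>M unit_lborel \<rightarrow>\<^sub>M borel \<Otimes>\<^sub>M borel"
    by (intro measurable_pair) (auto simp: comp_def intro!: measurable_compose[OF measurable_fst] measurable_compose[OF measurable_snd] measurable_restrict_space1)
  have "(\<lambda>(x,y). rec_cographon U S x y) \<in> borel_measurable (unit_lborel \<Otimes>\<^sub>M unit_lborel)"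
    using measurable_compose[OF id m] .
  moreover have "rec_cographon U S x y = rec_cographon U S y x \<and> rec_cographon U S x y \<in> {0..1}" for x y
    by (auto simp: rec_cographon_def)
  ultimately show ?thesis unfolding graphon_def by blast
qed

lemma finite_index_pairs: "finite (index_pairs n)"
  by (rule finite_subset[of _ "{1..n}\<times>{1..n}"]) (auto simp: index_pairs_def)

lemma measurable_graph_of_points:
  assumes W: "graphon W"
  shows "(\<lambda>x. measure_pmf (graph_of_points n W x)) \<in>
    (\<Pi>\<^sub>M i\<in>{1..n}. unit_lborel) \<rightarrow>\<^sub>M subprob_algebra (count_space UNIV)"
proof (rule measurable_subprob_algebra)
  let ?I = "index_pairs n"
  let ?D = "PiE_dflt ?I False (\<lambda>_. UNIV)"
  let ?g = "\<lambda>c. Graph {1..n} {{i, j} | i j. (i, j) \<in> index_pairs n \<and> c (i, j)}"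
  let ?P = "\<lambda>x. Pi_pmf ?I False (\<lambda>(i, j). bernoulli_pmf (W (x i) (x j)))"
  let ?M = "\<Pi>\<^sub>M i\<in>{1..n}. unit_lborel"
  fix A :: "nat graph set"
  have finD: "finite ?D" by (rule finite_PiE_dflt) (auto simp: finite_index_pairs)
  have eq: "emeasure (measure_pmf (graph_of_points n W x)) A =
     ennreal (\<Sum>c\<in>?D \<inter> ?g -` A. \<Prod>z\<in>?I. if c z then W (x (fst z)) (x (snd z)) else 1 - W (x (fst z)) (x (snd z)))"
    if x: "x \<in> space ?M" for x
  proof -
    have r: "0 \<le> W (x i) (x j)" "W (x i) (x j) \<le> 1" if "(i,j) \<in> ?I" for i j
      using that W x by (auto simp: graphon_def index_pairs_def space_PiM PiE_iff space_restrict_space)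
    have "emeasure (measure_pmf (graph_of_points n W x)) A = emeasure (measure_pmf (?P x)) (?g -` A)"
      by (simp add: graph_of_points_def)
    also have "\<dots> = emeasure (measure_pmf (?P x)) (?D \<inter> ?g -` A)"
    proof (rule emeasure_eq_AE)
      have "set_pmf (?P x) \<subseteq> ?D"
        using set_Pi_pmf_subset'[OF finite_index_pairs, of n False] unfolding PiE_dflt_def by blast
      then show "AE c in ?P x. (c \<in> ?g -` A) = (c \<in> ?D \<inter> ?g -` A)"
        by (intro AE_pmfI) auto
    qed auto
    also have "\<dots> = ennreal (\<Sum>c\<in>?D \<inter> ?g -` A. pmf (?P x) c)"
      using finD by (simp add: measure_pmf.emeasure_eq_measure measure_measure_pmf_finite)
    also have "(\<Sum>c\<in>?D \<inter> ?g -` A. pmf (?P x) c) = (\<Sum>c\<in>?D \<inter> ?g -` A. \<Prod>z\<in>?I. if c z then W (x (fst z)) (x (snd z)) else 1 - W (x (fst z)) (x (snd z)))"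
      using r by (intro sum.cong refl) (auto simp: pmf_Pi finite_index_pairs PiE_dflt_def intro!: prod.cong)
    finally show ?thesis .
  qed
  have Wm: "(\<lambda>x. W (x (fst z)) (x (snd z))) \<in> borel_measurable ?M" if "z \<in> ?I" for z
  proof -
    have "(\<lambda>x. (x (fst z), x (snd z))) \<in> ?M \<rightarrow>\<^sub>M unit_lborel \<Otimes>\<^sub>M unit_lborel"
      using that by (intro measurable_Pair measurable_component_singleton) (auto simp: index_pairs_def)
    from measurable_compose[OF this, of "\<lambda>(x, y). W x y" borel] W show ?thesis
      unfolding graphon_def by simp
  qed
  have Wm': "(\<lambda>x. if b then W (x (fst z)) (x (snd z)) else 1 - W (x (fst z)) (x (snd z))) \<in> borel_measurable ?M"
    if "z \<in> ?I" for z b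
    using Wm[OF that] by (cases b) auto
  have "(\<lambda>x. ennreal (\<Sum>c\<in>?D \<inter> ?g -` A. \<Prod>z\<in>?I. if c z then W (x (fst z)) (x (snd z)) else 1 - W (x (fst z)) (x (snd z)))) \<in> borel_measurable ?M"
    by (intro measurable_compose[OF _ measurable_ennreal] borel_measurable_sum borel_measurable_prod Wm')
  then show "(\<lambda>x. emeasure (measure_pmf (graph_of_points n W x)) A) \<in> borel_measurable ?M"
    using eq by (subst measurable_cong) auto
qed (auto intro: measure_pmf.subprob_space_axioms)

lemma prob_space_PiM_unit: "prob_space (\<Pi>\<^sub>M i\<in>{1..n::nat}. unit_lborel)"
  by (intro prob_space_PiM prob_space_restrict_space) auto

lemma prob_space_W_random_graph:
  assumes "graphon W"
  shows "prob_space (W_random_graph n W)"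
  unfolding W_random_graph_def
  using measurable_graph_of_points[OF assms]
  by (intro prob_space.prob_space_bind[OF prob_space_PiM_unit]) (auto simp: measure_pmf.prob_space_axioms)
end

theory Submission
  imports Defs
begin

text \<open>
  All three quantities are read off one random object: a list of \<open>m = n - 1\<close> pairs (label, decoration),
  whose labels form a uniform random permutation of \<open>1, \<dots>, m\<close> and whose decorations are independent,
  \<open>0\<close> with probability \<open>p\<close>. Such a list \<open>L\<close> encodes a graph on the positions \<open>0, \<dots>, m\<close>
  between and around its entries: \<open>i < j\<close> are adjacent iff the entry of smallest label between them
  carries decoration \<open>1\<close> (\<open>list_graph\<close>).

  \<^item> Reading the internal nodes of an increasing binary cotree in inorder gives such a list,
    and each list comes from exactly one tree; the leaves become the positions, and the lowest common ancestor of
    two leaves is the entry of smallest label between them. Hence \<open>N_inc H\<close> counts the lists that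
    encode \<open>H\<close> (\<open>N_inc_eq\<close>). All of them have the same probability
    \<open>p ^ Z H * (1 - p) ^ (m - Z H) / fact m\<close>, since the number of decorations \<open>0\<close> depends on \<open>H\<close> only
    (\<open>cotree_count_unique\<close>).

  \<^item> Duplicating the vertex at position \<open>i\<close> amounts to inserting a new entry of largest label at
    position \<open>i\<close>. Uniform insertion produces a uniform permutation, which gives the law of the recursive
    cograph (\<open>prob_rec_cograph\<close>).

  \<^item> For the recursive cographon, sort the sample points \<open>x\<^sub>1, \<dots>, x\<^sub>n\<close>. The \<open>m\<close> gaps between consecutive points
    play the role of the entries: the label of a gap is the first time some \<open>U j\<close> falls into it and its
    decoration is the sign at that time. The first \<open>U j\<close> that separates two sample points is the
    first one to hit a gap between them, so the sampled graph is the graph of this list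
    (\<open>point_graph_iso\<close>). The signs are independent of everything else. It remains to see that the
    order in which the gaps are hit is uniform (\<open>average_over_orders\<close>). For
    fixed sample points the law of this order depends on the lengths of the gaps only, and two adjacent
    lengths can be exchanged by reflecting the sample point between them, a transformation which
    preserves Lebesgue measure. So the probability of an order is invariant under adjacent transpositions of
    the gaps, hence is the same for all \<open>fact m\<close> orders.
\<close>

section \<open>The number of zeros of a cotree\<close>

lemma graph_iso_sym: "graph_iso G H \<Longrightarrow> graph_iso H G"
proof -
  assume "graph_iso G H"
  then obtain f where f: "bij_betw f (verts G) (verts H)"
    and e: "\<And>u v. u \<in> verts G \<Longrightarrow> v \<in> verts G \<Longrightarrow> {u, v} \<in> edges G \<longleftrightarrow> {f u, f v} \<in> edges H"
    unfolding graph_iso_def by blast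
  let ?g = "inv_into (verts G) f"
  have "bij_betw ?g (verts H) (verts G)" using f by (rule bij_betw_inv_into)
  moreover have "{u, v} \<in> edges H \<longleftrightarrow> {?g u, ?g v} \<in> edges G" if "u \<in> verts H" "v \<in> verts H" for u v
  proof -
    have "?g u \<in> verts G" "?g v \<in> verts G"
      using f that by (auto simp: bij_betw_def intro: inv_into_into)
    moreover have "f (?g u) = u" "f (?g v) = v"
      using f that by (auto simp: bij_betw_inv_into_right)
    ultimately show ?thesis using e[of "?g u" "?g v"] by simp
  qed
  ultimately show ?thesis unfolding graph_iso_def by blast
qed

lemma graph_iso_trans: "graph_iso G H \<Longrightarrow> graph_iso H K \<Longrightarrow> graph_iso G K"
proof -
  assume "graph_iso G H" "graph_iso H K"
  then obtain f g where f: "bij_betw f (verts G) (verts H)"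
    and e: "\<And>u v. u \<in> verts G \<Longrightarrow> v \<in> verts G \<Longrightarrow> {u, v} \<in> edges G \<longleftrightarrow> {f u, f v} \<in> edges H"
    and g: "bij_betw g (verts H) (verts K)"
    and e': "\<And>u v. u \<in> verts H \<Longrightarrow> v \<in> verts H \<Longrightarrow> {u, v} \<in> edges H \<longleftrightarrow> {g u, g v} \<in> edges K"
    unfolding graph_iso_def by blast
  have "bij_betw (g \<circ> f) (verts G) (verts K)" using f g by (rule bij_betw_trans)
  moreover have "{u, v} \<in> edges G \<longleftrightarrow> {(g \<circ> f) u, (g \<circ> f) v} \<in> edges K" if "u \<in> verts G" "v \<in> verts G" for u v
    using e[OF that] e'[of "f u" "f v"] that f by (auto simp: bij_betw_def)
  ultimately show ?thesis unfolding graph_iso_def by blast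
qed

lemma graph_iso_cong: "graph_iso G K \<Longrightarrow> graph_iso G H \<longleftrightarrow> graph_iso K H"
  by (rule iffI) (erule graph_iso_trans[OF graph_iso_sym], assumption, erule graph_iso_trans, assumption)

lemma graph_iso_card: "graph_iso G H \<Longrightarrow> card (verts G) = card (verts H)"
  unfolding graph_iso_def using bij_betw_same_card by blast

text \<open>
  A cotree whose leaves are the vertices in \<open>V\<close> and which is compatible with the edge set \<open>E\<close>, seen only
  through its vertex set and its number of decorations \<open>0\<close>. Forgetting the tree makes it possible
  to intersect two decompositions of the same vertex set.
\<close>

inductive cotree_count :: "'a set set \<Rightarrow> 'a set \<Rightarrow> nat \<Rightarrow> bool" for E where
  single: "cotree_count E {v} 0"
| split: "cotree_count E A k \<Longrightarrow> cotree_count E B l \<Longrightarrow> A \<inter> B = {} \<Longrightarrow>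
    \<forall>a\<in>A. \<forall>b\<in>B. ({a, b} \<in> E) = c \<Longrightarrow>
    cotree_count E (A \<union> B) (k + l + of_bool (\<not> c))"

lemma cotree_count_finite_nonempty: "cotree_count E V k \<Longrightarrow> finite V \<and> V \<noteq> {}"
  by (induction rule: cotree_count.induct) auto

text \<open>
  Deleting leaves from a cotree and contracting the nodes left with one child gives
  a cotree of the induced subgraph.
\<close>

lemma cotree_count_subset:
  assumes "cotree_count E V k" "X \<subseteq> V" "X \<noteq> {}"
  shows "\<exists>l. cotree_count E X l"
  using assms
proof (induction arbitrary: X rule: cotree_count.induct)
  case (single v)
  then have "X = {v}" by auto
  then show ?case by (auto intro: exI[of _ 0] cotree_count.single)
next
  case (split A k B l c)
  have X: "X = (X \<inter> A) \<union> (X \<inter> B)" using split.prems by auto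
  consider "X \<inter> A = {}" | "X \<inter> B = {}" | "X \<inter> A \<noteq> {}" "X \<inter> B \<noteq> {}" by blast
  then show ?case
  proof cases
    case 1
    then show ?thesis using split.IH(2)[of X] split.prems by blast
  next
    case 2
    then show ?thesis using split.IH(1)[of X] split.prems by blast
  next
    case 3
    obtain i j where "cotree_count E (X \<inter> A) i" "cotree_count E (X \<inter> B) j"
      using split.IH(1)[of "X \<inter> A"] split.IH(2)[of "X \<inter> B"] 3 by auto
    then have "cotree_count E ((X \<inter> A) \<union> (X \<inter> B)) (i + j + of_bool (\<not> c))"
      by (rule cotree_count.split) (use split.hyps in auto)
    then show ?thesis using X by metis
  qed
qed

text \<open>
  Suppose that the root splits \<open>V\<close> into \<open>A, B\<close> in one cotree and into \<open>C, D\<close> in the other. The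
  decorations of the two roots agree, because otherwise a pair of vertices separated by both splittings would be
  adjacent and non-adjacent. By induction the four sets \<open>A \<inter> C\<close>, \<open>A \<inter> D\<close>, \<open>B \<inter> C\<close>,
  \<open>B \<inter> D\<close> have well-defined counts, and both counts of \<open>V\<close> are the sum over these four sets, up to a
  correction for empty intersections that is absorbed in the weight \<open>w\<close>.
\<close>

lemma cotree_count_unique:
  assumes "cotree_count E V k" "cotree_count E V l"
  shows "k = l"
  using assms
proof (induction "card V" arbitrary: V k l rule: less_induct)
  case less
  have finV: "finite V" using less.prems cotree_count_finite_nonempty by blast
  show ?case
  proof (cases "\<exists>v. V = {v}")
    case True
    then obtain v where v: "V = {v}" by blast
    have "i = 0" if "cotree_count E V i" for i
      using that
    proof cases
      case (split A a B b c)
      then have "A \<noteq> {}" "B \<noteq> {}" using cotree_count_finite_nonempty by blast+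
      moreover have "A \<subseteq> {v}" "B \<subseteq> {v}" using split(1) v by auto
      ultimately have "A = {v}" "B = {v}" by auto
      then show ?thesis using split by auto
    qed auto
    then show ?thesis using less.prems by metis
  next
    case False
    obtain A B k1 k2 c where AB: "V = A \<union> B" "k = k1 + k2 + of_bool (\<not> c)"
      "cotree_count E A k1" "cotree_count E B k2" "A \<inter> B = {}" "\<forall>a\<in>A. \<forall>b\<in>B. ({a, b} \<in> E) = c"
      using less.prems(1) False by (cases rule: cotree_count.cases) blast+
    obtain C D l1 l2 c' where CD: "V = C \<union> D" "l = l1 + l2 + of_bool (\<not> c')"
      "cotree_count E C l1" "cotree_count E D l2" "C \<inter> D = {}" "\<forall>a\<in>C. \<forall>b\<in>D. ({a, b} \<in> E) = c'"
      using less.prems(2) False by (cases rule: cotree_count.cases) blast+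
    have ne: "A \<noteq> {}" "B \<noteq> {}" "C \<noteq> {}" "D \<noteq> {}"
      using AB CD cotree_count_finite_nonempty by blast+
    have ABsym: "({a, b} \<in> E) = c" if "a \<in> A \<and> b \<in> B \<or> a \<in> B \<and> b \<in> A" for a b
      using that AB(6) by (metis insert_commute)
    have CDsym: "({a, b} \<in> E) = c'" if "a \<in> C \<and> b \<in> D \<or> a \<in> D \<and> b \<in> C" for a b
      using that CD(6) by (metis insert_commute)
    have cc: "c = c'"
    proof (rule ccontr)
      assume cn: "c \<noteq> c'"
      have no: "\<not> ((a \<in> A \<and> b \<in> B \<or> a \<in> B \<and> b \<in> A) \<and> (a \<in> C \<and> b \<in> D \<or> a \<in> D \<and> b \<in> C))" for a b
        using ABsym[of a b] CDsym[of a b] cn by blast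
      obtain a b d e where "a \<in> A" "b \<in> B" "d \<in> C" "e \<in> D" using ne by blast
      then show False using no[of a b] no[of a d] no[of a e] no[of b d] no[of b e] no[of d e] AB(1) CD(1) by blast
    qed
    let ?o = "of_bool (\<not> c) :: nat"
    \<comment> \<open>The offset \<open>?o\<close> is the contribution of a node with decoration \<open>c\<close>; adding it once per nonempty set makes the count additive.\<close>
    define w where "w X = (if X = {} then 0 else (THE i. cotree_count E X i) + ?o)" for X
    have w: "w X = i + ?o" if "cotree_count E X i" "X \<subset> V" for X i
    proof -
      have "(THE i. cotree_count E X i) = i"
        using that less.hyps[OF psubset_card_mono[OF finV that(2)]] by (intro the_equality) auto
      then show ?thesis using that cotree_count_finite_nonempty[OF that(1)] by (auto simp: w_def)
    qed
    have add: "w X = w Y + w Y'" if "X = Y \<union> Y'" "Y \<inter> Y' = {}" "X \<subset> V"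
      "\<forall>a\<in>Y. \<forall>b\<in>Y'. ({a, b} \<in> E) = c" for X Y Y'
    proof (cases "Y = {} \<or> Y' = {}")
      case True
      then show ?thesis using that by (auto simp: w_def)
    next
      case False
      have "Y \<subseteq> V" "Y' \<subseteq> V" using that by auto
      then obtain i j where ij: "cotree_count E Y i" "cotree_count E Y' j"
        using cotree_count_subset[OF less.prems(1), of Y] cotree_count_subset[OF less.prems(1), of Y'] False by blast
      have "cotree_count E X (i + j + ?o)" unfolding that(1) using ij that by (intro cotree_count.split) auto
      moreover have "Y \<subset> V" "Y' \<subset> V" using that by auto
      ultimately show ?thesis using w[of X] w[OF ij(1)] w[OF ij(2)] that(3) by simp
    qed
    have psub: "A \<subset> V" "B \<subset> V" "C \<subset> V" "D \<subset> V" using ne AB CD by blast+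
    have 1: "w A = w (A \<inter> C) + w (A \<inter> D)" by (rule add) (use AB CD psub cc in auto)
    have 2: "w B = w (B \<inter> C) + w (B \<inter> D)" by (rule add) (use AB CD psub cc in auto)
    have 3: "w C = w (A \<inter> C) + w (B \<inter> C)" by (rule add) (use AB CD psub cc in auto)
    have 4: "w D = w (A \<inter> D) + w (B \<inter> D)" by (rule add) (use AB CD psub cc in auto)
    have "k1 + k2 + 2 * ?o = l1 + l2 + 2 * ?o"
      using 1 2 3 4 w[OF AB(3) psub(1)] w[OF AB(4) psub(2)] w[OF CD(3) psub(3)] w[OF CD(4) psub(4)] by simp
    then show ?thesis using AB(2) CD(2) cc by simp
  qed
qed

lemma cotree_count_tree:
  assumes "inj_on f (leaf_paths T)"
    and "\<And>u v. u \<in> leaf_paths T \<Longrightarrow> v \<in> leaf_paths T \<Longrightarrow> u \<noteq> v \<Longrightarrow>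
      ({f u, f v} \<in> E) = (node_at T (longest_common_prefix u v) = Some True)"
  shows "cotree_count E (f ` leaf_paths T) (num_zeros T)"
  using assms
proof (induction T arbitrary: f)
  case Leaf
  then show ?case by (simp add: num_zeros_def cotree_count.single)
next
  case (Node l a r)
  let ?f = "\<lambda>b. f \<circ> (#) b"
  have l: "cotree_count E (?f False ` leaf_paths l) (num_zeros l)"
  proof (rule Node.IH(1))
    show "inj_on (?f False) (leaf_paths l)"
      by (intro comp_inj_on inj_on_subset[OF Node.prems(1)]) auto
    show "({?f False u, ?f False v} \<in> E) = (node_at l (longest_common_prefix u v) = Some True)"
      if "u \<in> leaf_paths l" "v \<in> leaf_paths l" "u \<noteq> v" for u v
      using Node.prems(2)[of "False # u" "False # v"] that by auto
  qed
  have r: "cotree_count E (?f True ` leaf_paths r) (num_zeros r)"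
  proof (rule Node.IH(2))
    show "inj_on (?f True) (leaf_paths r)"
      by (intro comp_inj_on inj_on_subset[OF Node.prems(1)]) auto
    show "({?f True u, ?f True v} \<in> E) = (node_at r (longest_common_prefix u v) = Some True)"
      if "u \<in> leaf_paths r" "v \<in> leaf_paths r" "u \<noteq> v" for u v
      using Node.prems(2)[of "True # u" "True # v"] that by auto
  qed
  have "cotree_count E (?f False ` leaf_paths l \<union> ?f True ` leaf_paths r) (num_zeros l + num_zeros r + of_bool (\<not> a))"
  proof (rule cotree_count.split[OF l r])
    show "?f False ` leaf_paths l \<inter> ?f True ` leaf_paths r = {}"
    proof (rule ccontr)
      assume "?f False ` leaf_paths l \<inter> ?f True ` leaf_paths r \<noteq> {}"
      then obtain u v where "u \<in> leaf_paths l" "v \<in> leaf_paths r" "f (False # u) = f (True # v)" by auto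
      then show False using inj_onD[OF Node.prems(1), of "False # u" "True # v"] by auto
    qed
    have "({f (False # u), f (True # v)} \<in> E) = a" if "u \<in> leaf_paths l" "v \<in> leaf_paths r" for u v
      using Node.prems(2)[of "False # u" "True # v"] that by auto
    then show "\<forall>x\<in>?f False ` leaf_paths l. \<forall>y\<in>?f True ` leaf_paths r. ({x, y} \<in> E) = a" by simp
  qed
  moreover have "f ` leaf_paths (Node l a r) = ?f False ` leaf_paths l \<union> ?f True ` leaf_paths r"
    by (auto simp: image_Un image_comp)
  moreover have "num_zeros (Node l a r) = num_zeros l + num_zeros r + of_bool (\<not> a)"
    by (simp add: num_zeros_def)
  ultimately show ?case by metis
qed

lemma edges_cotree_graph:
  "u \<in> leaf_paths T \<Longrightarrow> v \<in> leaf_paths T \<Longrightarrow>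
   {u, v} \<in> edges (cotree_graph T) \<longleftrightarrow> u \<noteq> v \<and> node_at T (longest_common_prefix u v) = Some True"
proof -
  have "longest_common_prefix u v = longest_common_prefix v u" for u v :: "bool list"
    by (induction u v rule: longest_common_prefix.induct) auto
  then show "u \<in> leaf_paths T \<Longrightarrow> v \<in> leaf_paths T \<Longrightarrow> ?thesis"
    by (auto simp: cotree_graph_def doubleton_eq_iff)
qed

lemma num_zeros_unique:
  assumes "encodes T H" "encodes T' H"
  shows "num_zeros T = num_zeros T'"
proof -
  have *: "cotree_count (edges H) (verts H) (num_zeros T)" if T: "encodes T H" for T
  proof -
    obtain f where f: "bij_betw f (leaf_paths T) (verts H)" and
      e: "\<And>u v. u \<in> leaf_paths T \<Longrightarrow> v \<in> leaf_paths T \<Longrightarrow> ({u, v} \<in> edges (cotree_graph T)) = ({f u, f v} \<in> edges H)"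
      using T unfolding encodes_def graph_iso_def by (auto simp: cotree_graph_def)
    have "cotree_count (edges H) (f ` leaf_paths T) (num_zeros T)"
      using f e edges_cotree_graph[of _ T] by (intro cotree_count_tree) (auto simp: bij_betw_def)
    then show ?thesis using f by (simp add: bij_betw_def)
  qed
  show ?thesis using cotree_count_unique[OF *[OF assms(1)] *[OF assms(2)]] .
qed

lemma Z_eq: "encodes T H \<Longrightarrow> Z H = num_zeros T"
  unfolding Z_def by (rule the_equality) (auto intro: num_zeros_unique)

section \<open>Graphs of labelled lists\<close>

text \<open>
  With pairwise different labels this is the decoration of the entry of minimal label among the entries with indices
  \<open>i, \<dots>, j - 1\<close>. The labels range over any linear order, because the lists coming from the cographon
  are labelled by hitting times instead of ranks.
\<close>

definition dec_between :: "('k::linorder \<times> bool) list \<Rightarrow> nat \<Rightarrow> nat \<Rightarrow> bool" where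
  "dec_between L i j \<longleftrightarrow> (\<exists>k\<in>{i..<j}. snd (L ! k) \<and> (\<forall>l\<in>{i..<j}. fst (L ! k) \<le> fst (L ! l)))"

definition list_graph :: "('k::linorder \<times> bool) list \<Rightarrow> nat graph" where
  "list_graph L = Graph {..length L} {{i, j} | i j. i < j \<and> j \<le> length L \<and> dec_between L i j}"

lemma verts_list_graph [simp]: "verts (list_graph L) = {..length L}"
  by (simp add: list_graph_def)

lemma edges_list_graph:
  "i < j \<Longrightarrow> j \<le> length L \<Longrightarrow> {i, j} \<in> edges (list_graph L) \<longleftrightarrow> dec_between L i j"
  by (auto simp: list_graph_def doubleton_eq_iff)

lemma loop_list_graph: "{i} \<notin> edges (list_graph L)"
  by (auto simp: list_graph_def)

text \<open>
  It suffices to compare pairs \<open>i < j\<close>, since neither graph has loops.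
\<close>

lemma graph_iso_list_graphI:
  assumes f: "bij_betw f {..length L} (verts G)"
    and e: "\<And>i j. i < j \<Longrightarrow> j \<le> length L \<Longrightarrow> dec_between L i j \<longleftrightarrow> {f i, f j} \<in> edges G"
    and l: "\<And>v. v \<in> verts G \<Longrightarrow> {v} \<notin> edges G"
  shows "graph_iso (list_graph L) G"
  unfolding graph_iso_def
proof (intro exI conjI ballI)
  show "bij_betw f (verts (list_graph L)) (verts G)" using f by simp
  fix u v assume uv: "u \<in> verts (list_graph L)" "v \<in> verts (list_graph L)"
  consider "u < v" | "v < u" | "u = v" by linarith
  then show "({u, v} \<in> edges (list_graph L)) = ({f u, f v} \<in> edges G)"
  proof cases
    case 1
    then show ?thesis using e[of u v] edges_list_graph[of u v L] uv by simp
  next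
    case 2
    then show ?thesis using e[of v u] edges_list_graph[of v u L] uv by (simp add: insert_commute)
  next
    case 3
    then show ?thesis using l[of "f u"] uv f by (auto simp: loop_list_graph bij_betw_def)
  qed
qed

definition labelings :: "nat \<Rightarrow> (nat \<times> bool) list set" where
  "labelings m = {L. distinct (map fst L) \<and> set (map fst L) = {1..m}}"

lemma length_labelings: "L \<in> labelings m \<Longrightarrow> length L = m"
  unfolding labelings_def using distinct_card[of "map fst L"] by (simp del: distinct_map set_map)

lemma finite_labelings: "finite (labelings m)"
proof (rule finite_subset)
  show "labelings m \<subseteq> {L. set L \<subseteq> {1..m} \<times> UNIV \<and> length L = m}"
  proof
    fix L assume L: "L \<in> labelings m"
    then have "fst ` set L = {1..m}" by (simp add: labelings_def)
    have "set L \<subseteq> {1..m} \<times> UNIV"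
    proof
      fix x assume "x \<in> set L"
      then have "fst x \<in> fst ` set L" by (rule imageI)
      with \<open>fst ` set L = {1..m}\<close> show "x \<in> {1..m} \<times> UNIV" by (cases x) simp
    qed
    then show "L \<in> {L. set L \<subseteq> {1..m} \<times> UNIV \<and> length L = m}" using length_labelings[OF L] by simp
  qed
  show "finite {L :: (nat \<times> bool) list. set L \<subseteq> {1..m} \<times> UNIV \<and> length L = m}"
    by (rule finite_lists_length_eq) simp
qed

text \<open>
  The probability of a list of decorations, the decoration \<open>1\<close> being \<open>True\<close>.
\<close>

definition weight :: "real \<Rightarrow> bool list \<Rightarrow> real" where
  "weight p ds = (\<Prod>d\<leftarrow>ds. if d then 1 - p else p)"

lemma weight_Nil [simp]: "weight p [] = 1" 
  and weight_Cons [simp]: "weight p (d # ds) = (if d then 1 - p else p) * weight p ds"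
  and weight_append [simp]: "weight p (ds @ ds') = weight p ds * weight p ds'"
  by (simp_all add: weight_def)

lemma weight_count: "weight p ds = p ^ count_list ds False * (1 - p) ^ (length ds - count_list ds False)"
proof (induction ds)
  case (Cons d ds)
  have "count_list ds False \<le> length ds" by (rule count_le_length)
  with Cons show ?case by (cases d) (simp_all add: Suc_diff_le)
qed simp

section \<open>Increasing cotrees as labelled lists\<close>

text \<open>
  The leaves from left to right, so that leaf number \<open>k\<close> sits just before entry number \<open>k\<close> of the inorder
  traversal and just after entry number \<open>k - 1\<close>.
\<close>

fun leaf_list :: "'a tree \<Rightarrow> bool list list" where
  "leaf_list Leaf = [[]]"
| "leaf_list (Node l a r) = map ((#) False) (leaf_list l) @ map ((#) True) (leaf_list r)"

lemma set_leaf_list: "set (leaf_list T) = leaf_paths T"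
  by (induction T) auto

lemma distinct_leaf_list: "distinct (leaf_list T)"
  by (induction T) (auto simp: distinct_map)

lemma length_leaf_list: "length (leaf_list T) = Suc (size T)"
  by (induction T) auto

lemma leaf_paths_map_tree [simp]: "leaf_paths (map_tree f T) = leaf_paths T"
  by (induction T) auto

lemma inorder_map_tree: "inorder (map_tree f T) = map f (inorder T)"
  by (induction T) auto

text \<open>
  The condition \<open>increasing\<close> without the requirement that the labels be \<open>1, 2, \<dots>\<close>, which is not inherited by
  subtrees.
\<close>

definition heap_ordered :: "('k::linorder \<times> bool) tree \<Rightarrow> bool" where
  "heap_ordered T \<longleftrightarrow> heap (map_tree fst T) \<and> distinct (map fst (inorder T))"

lemma heap_ordered_Leaf [simp]: "heap_ordered Leaf"
  by (simp add: heap_ordered_def)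

lemma heap_ordered_Node:
  "heap_ordered (Node l a r) \<longleftrightarrow> heap_ordered l \<and> heap_ordered r \<and>
     (\<forall>x \<in> set (inorder l) \<union> set (inorder r). fst a < fst x) \<and>
     fst ` set (inorder l) \<inter> fst ` set (inorder r) = {}"
proof -
  have h: "heap (map_tree fst (Node l a r)) \<longleftrightarrow> heap (map_tree fst l) \<and> heap (map_tree fst r) \<and>
      (\<forall>x \<in> set (inorder l) \<union> set (inorder r). fst a \<le> fst x)"
    by (simp add: tree.set_map ball_Un) blast
  have d: "distinct (map fst (inorder (Node l a r))) \<longleftrightarrow>
      distinct (map fst (inorder l)) \<and> distinct (map fst (inorder r)) \<and>
      (\<forall>x \<in> set (inorder l) \<union> set (inorder r). fst a \<noteq> fst x) \<and>
      fst ` set (inorder l) \<inter> fst ` set (inorder r) = {}"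
    by (simp add: ball_Un image_iff) blast
  have t: "(\<forall>x \<in> A. fst a < fst x) \<longleftrightarrow> (\<forall>x \<in> A. fst a \<le> fst x) \<and> (\<forall>x \<in> A. fst a \<noteq> fst x)"
    for A :: "('a \<times> 'b) set"
    by (auto simp: order_less_le)
  show ?thesis unfolding heap_ordered_def h d t
    by (intro iffI conjI; elim conjE; assumption)
qed

text \<open>
  The nodes between leaves \<open>i < j\<close> in inorder are in the subtree of the lowest common ancestor, which is one of
  them; by the heap property it has the smallest label. In the induction, either both leaves are in the same subtree,
  or they are separated by the root.
\<close>

lemma dec_between_inorder:
  assumes "heap_ordered T" "i < j" "j \<le> size T"
  shows "dec_between (inorder T) i j \<longleftrightarrow>
    node_at (map_tree snd T) (longest_common_prefix (leaf_list T ! i) (leaf_list T ! j)) = Some True"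
  using assms
proof (induction T arbitrary: i j)
  case Leaf
  then show ?case by simp
next
  case (Node l a r)
  let ?L = "inorder (Node l a r)" and ?s = "size l"
  have hl: "heap_ordered l" "heap_ordered r"
    and lt: "\<And>x. x \<in> set (inorder l) \<union> set (inorder r) \<Longrightarrow> fst a < fst x"
    using Node.prems by (auto simp: heap_ordered_Node)
  consider "j \<le> ?s" | "i \<le> ?s" "?s < j" | "?s < i" using Node.prems by linarith
  then show ?case
  proof cases
    case 1
    have "dec_between ?L i j = dec_between (inorder l) i j"
      unfolding dec_between_def using 1 by (auto simp: nth_append)
    moreover have "leaf_list (Node l a r) ! i = False # leaf_list l ! i" "leaf_list (Node l a r) ! j = False # leaf_list l ! j"
      using 1 Node.prems by (simp_all add: nth_append length_leaf_list)
    ultimately show ?thesis using Node.IH(1)[OF hl(1) Node.prems(2) 1] by simp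
  next
    case 2
    have s: "?L ! ?s = a" by (simp add: nth_append)
    have min: "fst a < fst (?L ! k)" if "k \<noteq> ?s" "k < size (Node l a r)" for k
    proof -
      have "?L ! k \<in> set (inorder l) \<union> set (inorder r)"
      proof (cases "k < ?s")
        case True
        then show ?thesis using nth_mem[of k "inorder l"] by (simp add: nth_append)
      next
        case False
        then show ?thesis using nth_mem[of "k - Suc ?s" "inorder r"] that by (simp add: nth_append nth_Cons')
      qed
      then show ?thesis using lt by blast
    qed
    define xs where "xs = ?L"
    have xs: "xs ! ?s = a" and xs_min: "k = ?s \<or> fst a < fst (xs ! k)" if "k < j" for k
      using s min[of k] that Node.prems(3) by (auto simp: xs_def)
    have "dec_between xs i j = snd a"
      unfolding dec_between_def
    proof
      assume "snd a"
      moreover have "fst (xs ! ?s) \<le> fst (xs ! k)" if "k < j" for k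
        using xs_min[OF that] xs[OF 2(2)] by auto
      ultimately show "\<exists>k\<in>{i..<j}. snd (xs ! k) \<and> (\<forall>l\<in>{i..<j}. fst (xs ! k) \<le> fst (xs ! l))"
        using 2 xs[OF 2(2)] by (intro bexI[of _ ?s]) auto
    next
      assume "\<exists>k\<in>{i..<j}. snd (xs ! k) \<and> (\<forall>l\<in>{i..<j}. fst (xs ! k) \<le> fst (xs ! l))"
      then obtain k where k: "k < j" "snd (xs ! k)" "\<forall>l\<in>{i..<j}. fst (xs ! k) \<le> fst (xs ! l)" by auto
      have "fst (xs ! k) \<le> fst a" using bspec[OF k(3), of ?s] 2 xs[OF 2(2)] by simp
      then have "k = ?s" using xs_min[OF k(1)] by auto
      then show "snd a" using k xs[OF 2(2)] by simp
    qed
    moreover have "leaf_list (Node l a r) ! i = False # leaf_list l ! i"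
      "leaf_list (Node l a r) ! j = True # leaf_list r ! (j - Suc ?s)"
      using 2 Node.prems by (simp_all add: nth_append length_leaf_list)
    ultimately show ?thesis by (simp add: xs_def)
  next
    case 3
    have nth: "?L ! k = inorder r ! (k - Suc ?s)" if "?s < k" for k
      using that by (simp add: nth_append nth_Cons')
    have "dec_between ?L i j = dec_between (inorder r) (i - Suc ?s) (j - Suc ?s)"
    proof -
      have im: "{i..<j} = (\<lambda>k. k + Suc ?s) ` {i - Suc ?s..<j - Suc ?s}"
        using 3 Node.prems by (simp only: image_add_atLeastLessThan' le_add_diff_inverse2)
      show ?thesis unfolding dec_between_def im by (simp add: nth_append nth_Cons')
    qed
    moreover have "leaf_list (Node l a r) ! i = True # leaf_list r ! (i - Suc ?s)"
      "leaf_list (Node l a r) ! j = True # leaf_list r ! (j - Suc ?s)"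
      using 3 Node.prems by (simp_all add: nth_append length_leaf_list)
    moreover have "i - Suc ?s < j - Suc ?s" "j - Suc ?s \<le> size r" using 3 Node.prems by auto
    ultimately show ?thesis using Node.IH(2)[OF hl(2), of "i - Suc ?s" "j - Suc ?s"] by simp
  qed
qed

lemma list_graph_inorder_iso:
  assumes "heap_ordered T"
  shows "graph_iso (list_graph (inorder T)) (cotree_graph (map_tree snd T))"
proof (rule graph_iso_list_graphI)
  show "bij_betw ((!) (leaf_list T)) {..length (inorder T)} (verts (cotree_graph (map_tree snd T)))"
    using bij_betw_nth[OF distinct_leaf_list[of T] _ refl]
    by (simp add: cotree_graph_def set_leaf_list length_leaf_list lessThan_Suc_atMost)
  show "dec_between (inorder T) i j = ({leaf_list T ! i, leaf_list T ! j} \<in> edges (cotree_graph (map_tree snd T)))"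
    if "i < j" "j \<le> length (inorder T)" for i j
  proof -
    have "leaf_list T ! i \<in> leaf_paths T" "leaf_list T ! j \<in> leaf_paths T" "leaf_list T ! i \<noteq> leaf_list T ! j"
      using that distinct_leaf_list[of T] by (auto simp flip: set_leaf_list simp: length_leaf_list nth_eq_iff_index_eq)
    then show ?thesis using dec_between_inorder[OF assms, of i j] that
      by (subst edges_cotree_graph) auto
  qed
  show "{v} \<notin> edges (cotree_graph (map_tree snd T))" for v
    by (auto simp: cotree_graph_def)
qed

text \<open>
  The root is recovered from the inorder traversal as the entry of smallest label, and
  its position delimits the two subtrees.
\<close>

lemma inorder_inj:
  fixes T T' :: "('k::linorder \<times> bool) tree"
  assumes "heap_ordered T" "heap_ordered T'" "inorder T = inorder T'"
  shows "T = T'"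
  using assms
proof (induction T arbitrary: T')
  case Leaf
  then show ?case by (cases T') auto
next
  case (Node l a r)
  then obtain l' a' r' where T': "T' = Node l' a' r'" by (cases T') auto
  have eq: "inorder l @ a # inorder r = inorder l' @ a' # inorder r'" using Node.prems T' by simp
  have min: "fst a \<le> fst x" if "x \<in> set (inorder l @ a # inorder r)" for x
    using Node.prems(1) that unfolding heap_ordered_Node by (auto intro: less_imp_le)
  have min': "fst a' \<le> fst x" if "x \<in> set (inorder l' @ a' # inorder r')" for x
    using Node.prems(2) that unfolding T' heap_ordered_Node by (auto intro: less_imp_le)
  have ne: "fst a \<noteq> fst x" if "x \<in> set (inorder l) \<union> set (inorder r)" for x
    using Node.prems(1) that unfolding heap_ordered_Node by fastforce
  have "a' \<in> set (inorder l @ a # inorder r)" unfolding eq by simp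
  moreover have "a \<in> set (inorder l' @ a' # inorder r')" unfolding eq[symmetric] by simp
  ultimately have aa: "a' = a" using min[of a'] min'[of a] ne[of a'] by auto
  have "inorder l = inorder l' \<and> inorder r = inorder r'"
    using eq ne[of a] unfolding aa by (subst (asm) append_Cons_eq_iff) auto
  then show ?case using Node.IH Node.prems aa unfolding T' heap_ordered_Node by auto
qed

text \<open>
  Cartesian tree: put the entry of smallest label at the root and recurse on both sides.
\<close>

lemma inorder_surj:
  fixes L :: "('k::linorder \<times> bool) list"
  assumes "distinct (map fst L)"
  shows "\<exists>T. heap_ordered T \<and> inorder T = L"
  using assms
proof (induction "length L" arbitrary: L rule: less_induct)
  case less
  show ?case
  proof (cases "L = []")
    case True
    then show ?thesis by (intro exI[of _ Leaf]) auto
  next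
    case False
    then have "Min (fst ` set L) \<in> fst ` set L" by (intro Min_in) auto
    then obtain a where a: "a \<in> set L" "fst a = Min (fst ` set L)" by force
    then obtain xs ys where L: "L = xs @ a # ys" by (metis split_list)
    obtain l r where l: "heap_ordered l" "inorder l = xs" and r: "heap_ordered r" "inorder r = ys"
      using less.hyps[of xs] less.hyps[of ys] less.prems L by auto
    have "fst a \<le> fst x" if "x \<in> set L" for x using a that by simp
    then have "heap_ordered (Node l a r)"
      using l r less.prems L by (auto simp: heap_ordered_Node order_less_le)
    then show ?thesis using l r L by (intro exI[of _ "Node l a r"]) auto
  qed
qed

lemma increasing_iff: "increasing T \<longleftrightarrow> heap_ordered T \<and> inorder T \<in> labelings (size T)"
  by (auto simp: increasing_def Let_def heap_ordered_def labelings_def inorder_map_tree tree.set_map simp flip: set_inorder)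

lemma encodes_iff_list_graph:
  "increasing T \<Longrightarrow> encodes (map_tree snd T) H \<longleftrightarrow> graph_iso (list_graph (inorder T)) H"
  unfolding encodes_def increasing_iff
  using list_graph_inorder_iso graph_iso_cong by blast

text \<open>
  The inorder traversal is a bijection from the increasing cotrees encoding \<open>H\<close> to the labelled lists encoding \<open>H\<close>.
\<close>

lemma N_inc_eq:
  assumes "card (verts H) = Suc m"
  shows "N_inc H = card {L \<in> labelings m. graph_iso (list_graph L) H}"
proof -
  have "bij_betw inorder {T. increasing T \<and> encodes (map_tree snd T) H} {L \<in> labelings m. graph_iso (list_graph L) H}"
    unfolding bij_betw_def
  proof (intro conjI set_eqI iffI)
    show "inj_on inorder {T. increasing T \<and> encodes (map_tree snd T) H}"
      by (rule inj_onI) (auto intro: inorder_inj simp: increasing_iff)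
  next
    fix L assume "L \<in> inorder ` {T. increasing T \<and> encodes (map_tree snd T) H}"
    then obtain T where T: "L = inorder T" "increasing T" "encodes (map_tree snd T) H" by auto
    then have i: "graph_iso (list_graph L) H" using encodes_iff_list_graph by blast
    then have "length L = m" using graph_iso_card[OF i] assms by simp
    then show "L \<in> {L \<in> labelings m. graph_iso (list_graph L) H}" using T i by (auto simp: increasing_iff)
  next
    fix L assume L: "L \<in> {L \<in> labelings m. graph_iso (list_graph L) H}"
    then obtain T where T: "heap_ordered T" "inorder T = L" using inorder_surj[of L] by (auto simp: labelings_def)
    have "size T = m" using T L length_labelings[of L m] by (auto simp flip: length_inorder)
    then have "increasing T" using T L by (auto simp: increasing_iff)
    then show "L \<in> inorder ` {T. increasing T \<and> encodes (map_tree snd T) H}"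
      using T L encodes_iff_list_graph[of T H] by auto
  qed
  then show ?thesis unfolding N_inc_def by (rule bij_betw_same_card)
qed

lemma weight_labeling:
  assumes "L \<in> labelings m" "graph_iso (list_graph L) H"
  shows "weight p (map snd L) = p ^ Z H * (1 - p) ^ (m - Z H)"
proof -
  obtain T where T: "heap_ordered T" "inorder T = L" using inorder_surj[of L] assms by (auto simp: labelings_def)
  have "size T = m" using T length_labelings[OF assms(1)] by (auto simp flip: length_inorder)
  then have "increasing T" using T assms by (auto simp: increasing_iff)
  then have "encodes (map_tree snd T) H" using encodes_iff_list_graph T assms by blast
  then have "Z H = num_zeros (map_tree snd T)" by (rule Z_eq)
  then have "Z H = count_list (map snd L) False" by (simp add: num_zeros_def inorder_map_tree T)
  then show ?thesis using weight_count[of p "map snd L"] length_labelings[OF assms(1)] by simp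
qed

lemma sum_weight_labelings:
  assumes "card (verts H) = Suc m"
  shows "(\<Sum>L | L \<in> labelings m \<and> graph_iso (list_graph L) H. weight p (map snd L)) = 
    real (N_inc H) * p ^ Z H * (1 - p) ^ (m - Z H)"
  using weight_labeling[of _ m H p] by (simp add: N_inc_eq[OF assms] mult.assoc)

section \<open>The random recursive cograph\<close>

definition insert_at :: "nat \<Rightarrow> 'a \<Rightarrow> 'a list \<Rightarrow> 'a list" where
  "insert_at i x xs = take i xs @ x # drop i xs"

lemma length_insert_at [simp]: "length (insert_at i x xs) = Suc (length xs)"
  by (simp add: insert_at_def)

lemma set_insert_at [simp]: "set (insert_at i x xs) = insert x (set xs)"
  unfolding insert_at_def by (metis Un_insert_right append_take_drop_id list.simps(15) set_append)

lemma nth_insert_at: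
  "i \<le> length xs \<Longrightarrow> insert_at i x xs ! k = (if k < i then xs ! k else if k = i then x else xs ! (k - 1))"
  by (auto simp: insert_at_def nth_append nth_Cons' min_def)

lemma map_insert_at: "map f (insert_at i x xs) = insert_at i (f x) (map f xs)"
  by (simp add: insert_at_def take_map drop_map)

lemma distinct_insert_at: "x \<notin> set xs \<Longrightarrow> distinct (insert_at i x xs) = distinct xs"
proof -
  have "mset (insert_at i x xs) = mset (x # xs)"
    using arg_cong[OF append_take_drop_id[of i xs], of mset] by (simp add: insert_at_def del: append_take_drop_id)
  then have "distinct (insert_at i x xs) = distinct (x # xs)"
    by (rule mset_eq_imp_distinct_iff)
  then show "x \<notin> set xs \<Longrightarrow> ?thesis" by simp
qed

lemma insert_at_labeling:
  assumes "L \<in> labelings m"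
  shows "insert_at i (Suc m, d) L \<in> labelings (Suc m)"
proof -
  have "Suc m \<notin> set (map fst L)" using assms by (auto simp: labelings_def)
  moreover have "map fst (insert_at i (Suc m, d) L) = insert_at i (Suc m) (map fst L)"
    by (simp add: map_insert_at)
  ultimately show ?thesis using assms distinct_insert_at[of "Suc m" "map fst L" i]
    unfolding labelings_def by (simp add: atLeastAtMostSuc_conv del: set_map)
qed

text \<open>
  Removing the entry of largest label inverts the insertion: every permutation has exactly one history.
\<close>

lemma bij_betw_insert_at:
  "bij_betw (\<lambda>(L, i, d). insert_at i (Suc m, d) L) (labelings m \<times> {..m} \<times> UNIV) (labelings (Suc m))"
  unfolding bij_betw_def
proof (intro conjI inj_onI set_eqI iffI)
  fix x y assume x: "x \<in> labelings m \<times> {..m} \<times> (UNIV :: bool set)" and y: "y \<in> labelings m \<times> {..m} \<times> (UNIV :: bool set)"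
    and eq: "(\<lambda>(L, i, d). insert_at i (Suc m, d) L) x = (\<lambda>(L, i, d). insert_at i (Suc m, d) L) y"
  obtain L i d L' i' d' where xy: "x = (L, i, d)" "y = (L', i', d')" by (metis prod_cases3)
  have len: "length L = m" "length L' = m" using x y xy length_labelings by auto
  have new: "Suc m \<notin> fst ` set L" "Suc m \<notin> fst ` set L'"
    using x y xy by (auto simp: labelings_def)
  have eq': "take i L @ (Suc m, d) # drop i L = take i' L' @ (Suc m, d') # drop i' L'"
    using eq xy by (simp add: insert_at_def)
  have "(Suc m, d) \<in> insert (Suc m, d') (set L')"
    using eq xy set_insert_at[of i "(Suc m, d)" L] by simp
  then have d: "d = d'" using new by force
  have no: "(Suc m, d') \<notin> set (take i L)" "(Suc m, d') \<notin> set (drop i L)"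
    using new by (force dest: in_set_takeD in_set_dropD)+
  have tk: "take i L = take i' L'" "drop i L = drop i' L'"
    using eq' unfolding d append_Cons_eq_iff[OF no] by auto
  have "length (take i L) = i" "length (take i' L') = i'" using x y xy len by auto
  then have "i = i'" using tk by simp
  moreover have "L = L'" using tk append_take_drop_id[of i L] append_take_drop_id[of i' L'] by simp
  ultimately show "x = y" using d xy by simp
next
  fix K assume "K \<in> (\<lambda>(L, i, d). insert_at i (Suc m, d) L) ` (labelings m \<times> {..m} \<times> UNIV)"
  then show "K \<in> labelings (Suc m)" using insert_at_labeling by auto
next
  fix K assume K: "K \<in> labelings (Suc m)"
  then have "Suc m \<in> fst ` set K" by (simp add: labelings_def)
  then obtain d where "(Suc m, d) \<in> set K" by force
  then obtain xs ys where K': "K = xs @ (Suc m, d) # ys" by (metis split_list)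
  have i: "length xs \<le> m" using length_labelings[OF K] K' by simp
  have "Suc m \<notin> fst ` set (xs @ ys)" "distinct (map fst (xs @ ys))"
    using K unfolding labelings_def K' by auto
  moreover have "insert (Suc m) (fst ` set (xs @ ys)) = {1..Suc m}"
    using K unfolding labelings_def K' by auto
  then have "insert (Suc m) (fst ` set (xs @ ys)) = insert (Suc m) {1..m}" by (simp add: atLeastAtMostSuc_conv)
  ultimately have "fst ` set (xs @ ys) = {1..m}"
    by (subst (asm) insert_ident) auto
  then have "xs @ ys \<in> labelings m" using \<open>distinct (map fst (xs @ ys))\<close> by (simp add: labelings_def)
  moreover have "K = insert_at (length xs) (Suc m, d) (xs @ ys)" by (simp add: insert_at_def K')
  ultimately show "K \<in> (\<lambda>(L, i, d). insert_at i (Suc m, d) L) ` (labelings m \<times> {..m} \<times> UNIV)"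
    using i by (intro image_eqI[of _ _ "(xs @ ys, length xs, d)"]) auto
qed

lemma weight_insert_at:
  "weight p (map snd (insert_at i (k, d) L)) = (if d then 1 - p else p) * weight p (map snd L)"
proof -
  have "weight p (map snd L) = weight p (map snd (take i L)) * weight p (map snd (drop i L))"
    unfolding weight_append[symmetric] map_append[symmetric] append_take_drop_id ..
  then show ?thesis by (simp add: insert_at_def)
qed

text \<open>
  The inorder traversal of the random increasing cotree that grows by splitting a uniform leaf at each
  step.
\<close>

fun random_labeling :: "real \<Rightarrow> nat \<Rightarrow> (nat \<times> bool) list pmf" where
  "random_labeling p 0 = return_pmf []"
| "random_labeling p (Suc m) =
     do { L \<leftarrow> random_labeling p m;
          i \<leftarrow> pmf_of_set {..m};
          d \<leftarrow> bernoulli_pmf (1 - p);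
          return_pmf (insert_at i (Suc m, d) L) }"

lemma prob_bind_pmf:
  "measure_pmf.prob (bind_pmf q f) A = measure_pmf.expectation q (\<lambda>x. measure_pmf.prob (f x) A)"
  unfolding measure_pmf_bind by (rule measure_pmf.measure_bind[where N="count_space UNIV"])
    (auto simp: measure_pmf_in_subprob_algebra)

lemma labelings_0: "labelings 0 = {[]}"
  by (auto simp: labelings_def)

text \<open>
  Each list has a unique history, whose probability is \<open>1 / fact m\<close> for the positions times the weight of
  the decorations.
\<close>

lemma prob_random_labeling:
  assumes p: "0 < p" "p < 1"
  shows "measure_pmf.prob (random_labeling p m) A = (\<Sum>L\<in>labelings m. indicator A L * weight p (map snd L)) / fact m"
proof (induction m arbitrary: A)
  case 0
  then show ?case by (simp add: labelings_0)
next
  case (Suc m)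
  have exp: "measure_pmf.expectation (random_labeling p m) f = (\<Sum>L\<in>labelings m. f L * (weight p (map snd L) / fact m))" for f :: "_ \<Rightarrow> real"
  proof -
    have pm: "pmf (random_labeling p m) L = (if L \<in> labelings m then weight p (map snd L) / fact m else 0)" for L
    proof -
      have "pmf (random_labeling p m) L = measure_pmf.prob (random_labeling p m) {L}" by (simp add: pmf.rep_eq)
      also have "\<dots> = (\<Sum>K\<in>labelings m. if L = K then weight p (map snd K) else 0) / fact m"
        unfolding Suc.IH by (intro arg_cong2[of _ _ _ _ "(/)"] sum.cong) (auto simp: indicator_def)
      also have "\<dots> = (if L \<in> labelings m then weight p (map snd L) / fact m else 0)"
        by (simp add: sum.delta' finite_labelings)
      finally show ?thesis .
    qed
    show ?thesis
      by (subst integral_measure_pmf[OF finite_labelings[of m]]) (auto simp: pm set_pmf_iff split: if_splits intro!: sum.cong)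
  qed
  have sum_bool: "(\<Sum>d\<in>UNIV. h d) = h True + h False" for h :: "bool \<Rightarrow> real"
    by (simp add: UNIV_bool)
  have "measure_pmf.prob (random_labeling p (Suc m)) A =
    measure_pmf.expectation (random_labeling p m) (\<lambda>L. measure_pmf.expectation (pmf_of_set {..m})
      (\<lambda>i. measure_pmf.expectation (bernoulli_pmf (1 - p)) (\<lambda>d. indicator A (insert_at i (Suc m, d) L))))"
    by (simp add: prob_bind_pmf)
  also have "\<dots> = (\<Sum>L\<in>labelings m. (\<Sum>i\<le>m. \<Sum>d\<in>UNIV. indicator A (insert_at i (Suc m, d) L) * (if d then 1 - p else p)) / real (Suc m) * (weight p (map snd L) / fact m))"
    unfolding exp sum_bool using p by (simp add: integral_pmf_of_set)
  also have "\<dots> = (\<Sum>L\<in>labelings m. \<Sum>i\<le>m. \<Sum>d\<in>UNIV. indicator A (insert_at i (Suc m, d) L) * weight p (map snd (insert_at i (Suc m, d) L)) / fact (Suc m))"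
    unfolding sum_divide_distrib sum_distrib_right weight_insert_at
    by (intro sum.cong refl) simp
  also have "\<dots> = (\<Sum>x\<in>labelings m \<times> {..m} \<times> UNIV. case x of (L, i, d) \<Rightarrow> indicator A (insert_at i (Suc m, d) L) * weight p (map snd (insert_at i (Suc m, d) L)) / fact (Suc m))"
    by (simp add: sum.cartesian_product)
  also have "\<dots> = (\<Sum>K\<in>labelings (Suc m). indicator A K * weight p (map snd K) / fact (Suc m))"
    by (subst sum.reindex_bij_betw[OF bij_betw_insert_at, symmetric]) (auto intro!: sum.cong)
  finally show ?case by (simp only: sum_divide_distrib)
qed

text \<open>
  After position \<open>i\<close> is split, positions \<open>i\<close> and \<open>i + 1\<close> are the two copies of the old position \<open>i\<close>, and
  the positions to their right are shifted by one.
\<close>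

definition old_pos :: "nat \<Rightarrow> nat \<Rightarrow> nat" where
  "old_pos i k = (if k \<le> i then k else k - 1)"

text \<open>
  The new entry has the largest label, so it never is the minimum of a range that contains another entry. Only the
  two copies of position \<open>i\<close> see its decoration.
\<close>

lemma dec_between_insert_at:
  assumes i: "i \<le> length L" and ab: "a < b" "b \<le> Suc (length L)"
    and new: "\<And>x. x \<in> set L \<Longrightarrow> fst x < c"
  shows "dec_between (insert_at i (c, d) L) a b \<longleftrightarrow>
    (if a = i \<and> b = Suc i then d else dec_between L (old_pos i a) (old_pos i b))"
proof (cases "a = i \<and> b = Suc i")
  case True
  then show ?thesis using i by (auto simp: dec_between_def nth_insert_at)
next
  case False
  define K where "K = insert_at i (c, d) L"
  \<comment> \<open>\<open>up\<close> sends an index of the old list to its index in the new one, so it skips \<open>i\<close>.\<close>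
  define up where "up k = (if k < i then k else Suc k)" for k
  have K_up: "K ! up k = L ! k" for k using i by (simp add: K_def up_def nth_insert_at)
  have K_new: "K ! i = (c, d)" using i by (simp add: K_def nth_insert_at)
  have ran: "{a..<b} - {i} = up ` {old_pos i a..<old_pos i b}"
  proof (intro set_eqI iffI)
    fix k assume "k \<in> {a..<b} - {i}"
    then show "k \<in> up ` {old_pos i a..<old_pos i b}"
      by (intro image_eqI[of _ _ "if k < i then k else k - 1"]) (auto simp: up_def old_pos_def split: if_splits)
  next
    fix k assume "k \<in> up ` {old_pos i a..<old_pos i b}"
    then show "k \<in> {a..<b} - {i}" using ab by (auto simp: up_def old_pos_def split: if_splits)
  qed
  have lt: "old_pos i a < old_pos i b" "old_pos i b \<le> length L"
    using False ab i by (auto simp: old_pos_def)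
  have small: "fst (L ! k) < c" if "k < old_pos i b" for k
    using that lt by (intro new nth_mem) auto
  have "dec_between K a b \<longleftrightarrow> (\<exists>k\<in>{a..<b} - {i}. snd (K ! k) \<and> (\<forall>l\<in>{a..<b} - {i}. fst (K ! k) \<le> fst (K ! l)))"
  proof
    assume "dec_between K a b"
    then obtain k where k: "k \<in> {a..<b}" "snd (K ! k)" "\<And>l. l \<in> {a..<b} \<Longrightarrow> fst (K ! k) \<le> fst (K ! l)"
      unfolding dec_between_def by blast
    have "up (old_pos i a) \<in> {a..<b} - {i}" unfolding ran using lt by (intro imageI) auto
    then have "up (old_pos i a) \<in> {a..<b}" by blast
    from k(3)[OF this] have "fst (K ! k) < c" using small[of "old_pos i a"] lt by (simp add: K_up)
    then have "k \<noteq> i" using K_new by auto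
    then show "\<exists>k\<in>{a..<b} - {i}. snd (K ! k) \<and> (\<forall>l\<in>{a..<b} - {i}. fst (K ! k) \<le> fst (K ! l))"
      using k by (intro bexI[of _ k]) auto
  next
    assume "\<exists>k\<in>{a..<b} - {i}. snd (K ! k) \<and> (\<forall>l\<in>{a..<b} - {i}. fst (K ! k) \<le> fst (K ! l))"
    then obtain k where k: "k \<in> {a..<b} - {i}" "snd (K ! k)" "\<And>l. l \<in> {a..<b} - {i} \<Longrightarrow> fst (K ! k) \<le> fst (K ! l)"
      by blast
    from k(1) ran obtain k' where k': "k = up k'" "k' < old_pos i b" by auto
    have "fst (K ! k) \<le> fst (K ! i)" using small[OF k'(2)] by (simp add: K_new K_up k'(1))
    then have "fst (K ! k) \<le> fst (K ! l)" if "l \<in> {a..<b}" for l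
      using k(3)[of l] that by (cases "l = i") auto
    then show "dec_between K a b" unfolding dec_between_def using k by blast
  qed
  also have "\<dots> \<longleftrightarrow> dec_between L (old_pos i a) (old_pos i b)"
    unfolding ran dec_between_def by (simp add: K_up)
  finally show ?thesis using False unfolding K_def by auto
qed

text \<open>
  A bijection between positions and vertices is extended by keeping the vertex \<open>f i\<close> at the left copy of position
  \<open>i\<close> and by placing its twin at the right copy.
\<close>

lemma graph_iso_add_twin:
  assumes iso: "bij_betw f {..length L} (verts G)"
      "\<And>a b. a < b \<Longrightarrow> b \<le> length L \<Longrightarrow> dec_between L a b \<longleftrightarrow> {f a, f b} \<in> edges G"
    and G: "simple_graph G" "v' \<notin> verts G"
    and i: "i \<le> length L" and new: "\<And>x. x \<in> set L \<Longrightarrow> fst x < c"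
  defines "g \<equiv> \<lambda>k. if k = Suc i then v' else f (old_pos i k)"
  shows "bij_betw g {..Suc (length L)} (verts (add_twin (f i) v' d G))"
    and "\<And>a b. a < b \<Longrightarrow> b \<le> Suc (length L) \<Longrightarrow>
      dec_between (insert_at i (c, d) L) a b \<longleftrightarrow> {g a, g b} \<in> edges (add_twin (f i) v' d G)"
    and "simple_graph (add_twin (f i) v' d G)"
proof -
  let ?G = "add_twin (f i) v' d G"
  have fin: "finite (verts G)" and edge: "\<And>e. e \<in> edges G \<Longrightarrow> e \<subseteq> verts G \<and> card e = 2"
    using G(1) by (auto simp: simple_graph_def)
  have v'e: "{x, v'} \<notin> edges G" "{v', x} \<notin> edges G" for x using edge[of "{x, v'}"] edge[of "{v', x}"] G(2) by auto
  have loop: "{x} \<notin> edges G" for x using edge[of "{x}"] by auto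
  have fv: "f k \<in> verts G" if "k \<le> length L" for k using iso(1) that by (auto simp: bij_betw_def)
  have nv: "f k \<noteq> v'" if "k \<le> length L" for k using fv[OF that] G(2) by auto
  have old: "old_pos i k \<le> length L" if "k \<le> Suc (length L)" for k using that i by (auto simp: old_pos_def)
  have edges: "{x, y} \<in> edges ?G \<longleftrightarrow> {x, y} \<in> edges G" if "x \<noteq> v'" "y \<noteq> v'" for x y
    using that by (auto simp: add_twin_def doubleton_eq_iff)
  have edges': "{x, v'} \<in> edges ?G \<longleftrightarrow> {x, f i} \<in> edges G \<or> (x = f i \<and> d)" if "x \<noteq> v'" for x
    using that v'e by (auto simp: add_twin_def doubleton_eq_iff)
  show "bij_betw g {..Suc (length L)} (verts ?G)"
  proof -
    have "bij_betw (old_pos i) ({..Suc (length L)} - {Suc i}) {..length L}"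
      by (rule bij_betw_byWitness[where f' = "\<lambda>k. if k \<le> i then k else Suc k"]) (use i in \<open>auto simp: old_pos_def\<close>)
    then have "bij_betw (f \<circ> old_pos i) ({..Suc (length L)} - {Suc i}) (verts G)"
      using iso(1) by (rule bij_betw_trans)
    then have "bij_betw g ({..Suc (length L)} - {Suc i}) (verts G)"
      by (subst bij_betw_cong[where g = "f \<circ> old_pos i"]) (auto simp: g_def)
    then have "bij_betw g (({..Suc (length L)} - {Suc i}) \<union> {Suc i}) (verts G \<union> {v'})"
      by (rule bij_betw_combine) (use G(2) in \<open>auto simp: g_def bij_betw_def\<close>)
    moreover have "({..Suc (length L)} - {Suc i}) \<union> {Suc i} = {..Suc (length L)}" using i by auto
    ultimately show ?thesis by (simp add: add_twin_def)
  qed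
  show "simple_graph ?G"
    unfolding simple_graph_def
  proof (intro conjI ballI)
    show "finite (verts ?G)" using fin by (simp add: add_twin_def)
    fix e assume "e \<in> edges ?G"
    then consider "e \<in> edges G" | u where "e = {u, v'}" "{u, f i} \<in> edges G" | "e = {f i, v'}"
      by (auto simp: add_twin_def split: if_splits)
    then have "e \<subseteq> insert v' (verts G) \<and> card e = 2"
    proof cases
      case 1
      then show ?thesis using edge by blast
    next
      case 2
      then show ?thesis using edge[of "{u, f i}"] G(2) by (auto simp: card_2_iff)
    next
      case 3
      then show ?thesis using fv[OF i] nv[OF i] by auto
    qed
    then show "e \<subseteq> verts ?G" "card e = 2" by (auto simp: add_twin_def)
  qed
  fix a b assume ab: "a < b" "b \<le> Suc (length L)"
  show "dec_between (insert_at i (c, d) L) a b \<longleftrightarrow> {g a, g b} \<in> edges ?G"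
  proof (cases "a = i \<and> b = Suc i")
    case True
    then have "{g a, g b} = {f i, v'}" by (simp add: g_def old_pos_def)
    then show ?thesis using dec_between_insert_at[OF i ab new] True edges'[OF nv[OF i]] loop by simp
  next
    case False
    have lt: "old_pos i a < old_pos i b" using False ab by (auto simp: old_pos_def)
    have "{g a, g b} \<in> edges ?G \<longleftrightarrow> {f (old_pos i a), f (old_pos i b)} \<in> edges G"
    proof -
      have fi: "f (old_pos i k) = f i \<longleftrightarrow> k = i \<or> k = Suc i" if "k \<le> Suc (length L)" for k
        using iso(1) old[OF that] i unfolding bij_betw_def by (auto simp: inj_on_eq_iff old_pos_def)
      consider "a = Suc i" | "b = Suc i" | "a \<noteq> Suc i" "b \<noteq> Suc i" by blast
      then show ?thesis
      proof cases
        case 1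
        then show ?thesis using edges'[of "g b"] nv[OF old[OF ab(2)]] ab fi[OF ab(2)]
          by (auto simp: g_def insert_commute old_pos_def)
      next
        case 2
        then show ?thesis using edges'[of "g a"] nv[OF old, of a] ab fi[of a] False
          by (auto simp: g_def old_pos_def)
      next
        case 3
        then show ?thesis using edges[of "g a" "g b"] nv[OF old, of a] nv[OF old, of b] ab by (simp add: g_def)
      qed
    qed
    then show ?thesis using dec_between_insert_at[OF i ab new] False iso(2)[OF lt old[OF ab(2)]] by auto
  qed
qed

text \<open>
  The invariant of the coupling. Besides an isomorphism it records which names the vertices have
  and which labels occur, so that the next vertex and the next label are new.
\<close>

definition positions_of :: "nat graph \<Rightarrow> (nat \<times> bool) list \<Rightarrow> bool" where
  "positions_of G L \<longleftrightarrow> simple_graph G \<and> verts G = {1..Suc (length L)} \<and>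
     fst ` set L = {1..length L} \<and>
     (\<exists>f. bij_betw f {..length L} (verts G) \<and>
       (\<forall>a b. a < b \<and> b \<le> length L \<longrightarrow> (dec_between L a b \<longleftrightarrow> {f a, f b} \<in> edges G)))"

lemma positions_of_iso: "positions_of G L \<Longrightarrow> graph_iso (list_graph L) G"
proof -
  assume G: "positions_of G L"
  then obtain f where f: "bij_betw f {..length L} (verts G)"
    "\<And>a b. a < b \<Longrightarrow> b \<le> length L \<Longrightarrow> dec_between L a b \<longleftrightarrow> {f a, f b} \<in> edges G"
    unfolding positions_of_def by blast
  show ?thesis
    by (rule graph_iso_list_graphI[OF f]) (use G in \<open>auto simp: positions_of_def simple_graph_def\<close>)
qed

text \<open>
  The coupling splits the position of the duplicated vertex, and uses the same coin for the edge between
  the twins and for the decoration.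
\<close>

lemma rel_rec_cograph_random_labeling:
  "rel_pmf (\<lambda>G L. positions_of G L \<and> length L = m) (rec_cograph p (Suc m)) (random_labeling p m)"
proof (induction m)
  case 0
  have "positions_of (Graph {1} {}) []"
    unfolding positions_of_def by (auto simp: simple_graph_def intro!: exI[of _ Suc])
  then show ?case by simp
next
  case (Suc m)
  show ?case
    unfolding rec_cograph.simps random_labeling.simps
  proof (rule rel_pmf_bindI[OF Suc.IH])
    fix G :: "nat graph" and L :: "(nat \<times> bool) list"
    assume GL: "positions_of G L \<and> length L = m"
    then obtain f where f: "bij_betw f {..length L} (verts G)"
      "\<And>a b. a < b \<Longrightarrow> b \<le> length L \<Longrightarrow> dec_between L a b \<longleftrightarrow> {f a, f b} \<in> edges G"
      unfolding positions_of_def by blast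
    have sim: "simple_graph G" "Suc (Suc m) \<notin> verts G" using GL by (auto simp: positions_of_def)
    have new: "fst x < Suc m" if "x \<in> set L" for x
    proof -
      have "fst x \<in> fst ` set L" using that by (rule imageI)
      then show ?thesis using GL by (auto simp: positions_of_def)
    qed
    \<comment> \<open>A uniform vertex is the vertex at a uniform position.\<close>
    have "pmf_of_set (verts G) = map_pmf f (pmf_of_set {..m})"
      using map_pmf_of_set_bij_betw[OF f(1)] GL by simp
    moreover have "rel_pmf (\<lambda>v i. v = f i \<and> i \<le> m) (map_pmf f (pmf_of_set {..m})) (pmf_of_set {..m})"
      unfolding pmf.rel_map by (rule pmf.rel_refl_strong) auto
    ultimately have "rel_pmf (\<lambda>v i. v = f i \<and> i \<le> m) (pmf_of_set (verts G)) (pmf_of_set {..m})" by simp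
    then show "rel_pmf (\<lambda>G L. positions_of G L \<and> length L = Suc m)
      (pmf_of_set (verts G) \<bind> (\<lambda>v. bernoulli_pmf (1 - p) \<bind> (\<lambda>joined. return_pmf (add_twin v (Suc (Suc m)) joined G))))
      (pmf_of_set {..m} \<bind> (\<lambda>i. bernoulli_pmf (1 - p) \<bind> (\<lambda>d. return_pmf (insert_at i (Suc m, d) L))))"
    proof (rule rel_pmf_bindI)
      fix v i assume vi: "v = f i \<and> i \<le> m"
      show "rel_pmf (\<lambda>G L. positions_of G L \<and> length L = Suc m)
        (bernoulli_pmf (1 - p) \<bind> (\<lambda>joined. return_pmf (add_twin v (Suc (Suc m)) joined G)))
        (bernoulli_pmf (1 - p) \<bind> (\<lambda>d. return_pmf (insert_at i (Suc m, d) L)))"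
      proof (rule rel_pmf_bindI[where R = "(=)"])
        fix joined d :: bool assume "joined = d"
        have i: "i \<le> length L" using vi GL by simp
        note twin = graph_iso_add_twin[OF f sim i new, where d = d]
        have "positions_of (add_twin (f i) (Suc (Suc m)) d G) (insert_at i (Suc m, d) L)"
          unfolding positions_of_def length_insert_at
        proof (intro conjI)
          show "verts (add_twin (f i) (Suc (Suc m)) d G) = {1..Suc (Suc (length L))}"
            using GL by (simp add: positions_of_def add_twin_def atLeastAtMostSuc_conv)
          show "fst ` set (insert_at i (Suc m, d) L) = {1..Suc (length L)}"
            using GL by (simp add: positions_of_def atLeastAtMostSuc_conv)
        qed (use twin in blast)+
        then show "rel_pmf (\<lambda>G L. positions_of G L \<and> length L = Suc m)
          (return_pmf (add_twin v (Suc (Suc m)) joined G)) (return_pmf (insert_at i (Suc m, d) L))"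
          using vi GL \<open>joined = d\<close> by simp
      qed (simp add: pmf.rel_eq)
    qed
  qed
qed

lemma prob_rec_cograph:
  assumes p: "0 < p" "p < 1"
  shows "measure_pmf.prob (rec_cograph p (Suc m)) {G. graph_iso G H} =
    (\<Sum>L | L \<in> labelings m \<and> graph_iso (list_graph L) H. weight p (map snd L)) / fact m"
proof -
  let ?R = "\<lambda>G L. positions_of G L \<and> length L = m"
  have R: "graph_iso G H \<longleftrightarrow> graph_iso (list_graph L) H" if "?R G L" for G L
    using graph_iso_cong[OF positions_of_iso] that by blast
  have rel: "rel_pmf ?R (rec_cograph p (Suc m)) (random_labeling p m)"
    by (rule rel_rec_cograph_random_labeling)
  then have rel': "rel_pmf (\<lambda>L G. ?R G L) (random_labeling p m) (rec_cograph p (Suc m))"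
    by (subst pmf.rel_flip[symmetric]) (simp add: conversep_iff[abs_def])
  have "measure_pmf.prob (rec_cograph p (Suc m)) {G. graph_iso G H} =
    measure_pmf.prob (random_labeling p m) {L. graph_iso (list_graph L) H}"
  proof (rule antisym)
    show "measure_pmf.prob (rec_cograph p (Suc m)) {G. graph_iso G H} \<le>
        measure_pmf.prob (random_labeling p m) {L. graph_iso (list_graph L) H}"
      by (rule order_trans[OF rel_pmf_measureD[OF rel] measure_pmf.finite_measure_mono]) (use R in auto)
    show "measure_pmf.prob (random_labeling p m) {L. graph_iso (list_graph L) H} \<le>
        measure_pmf.prob (rec_cograph p (Suc m)) {G. graph_iso G H}"
      by (rule order_trans[OF rel_pmf_measureD[OF rel'] measure_pmf.finite_measure_mono]) (use R in auto)
  qed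
  also have "\<dots> = (\<Sum>L | L \<in> labelings m \<and> graph_iso (list_graph L) H. weight p (map snd L)) / fact m"
    unfolding prob_random_labeling[OF p]
    by (intro arg_cong2[of _ _ _ _ "(/)"] refl sum.mono_neutral_cong_right) (auto simp: finite_labelings)
  finally show ?thesis .
qed

section \<open>Sequences of uniform random variables\<close>

abbreviation unif :: "real measure" where
  "unif \<equiv> uniform_measure lborel {0..1}"

abbreviation unif_seq :: "(nat \<Rightarrow> real) measure" where
  "unif_seq \<equiv> (\<Pi>\<^sub>M j\<in>UNIV. unif)"

lemma prob_space_unif: "prob_space unif"
  by (rule prob_space_uniform_measure) auto

lemma prob_space_unif_seq: "prob_space unif_seq"
  by (intro prob_space_PiM prob_space_unif)

lemma measure_unif_gap: "0 \<le> a \<Longrightarrow> a \<le> b \<Longrightarrow> b \<le> 1 \<Longrightarrow> measure unif {a<..b} = b - a"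
proof -
  assume ab: "0 \<le> a" "a \<le> b" "b \<le> 1"
  then have "{0..1} \<inter> {a<..b} = {a<..b}" by auto
  then show ?thesis using ab by (subst measure_uniform_measure) auto
qed

lemma measurable_unif_seq_component [measurable]: "(\<lambda>u. u j) \<in> borel_measurable unif_seq"
proof -
  have "(\<lambda>u. u j) \<in> measurable unif_seq unif" by (rule measurable_component_singleton) simp
  moreover have "measurable unif_seq unif = borel_measurable unif_seq" by (rule measurable_cong_sets) auto
  ultimately show ?thesis by simp
qed

text \<open>
  Applying a function to each term of an i.i.d. sequence gives an i.i.d. sequence.
\<close>

lemma distr_PiM_map:
  fixes N :: "'a measure" and K :: "'b measure"
  assumes N: "prob_space N" and g: "g \<in> measurable N K"
  shows "distr (\<Pi>\<^sub>M j\<in>(UNIV::nat set). N) (\<Pi>\<^sub>M j\<in>UNIV. K) (\<lambda>u j. g (u j)) = (\<Pi>\<^sub>M j\<in>UNIV. distr N K g)"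
proof -
  let ?P = "\<Pi>\<^sub>M j\<in>(UNIV::nat set). N"
  interpret product_prob_space "\<lambda>_. N" "UNIV :: nat set"
    using N by (simp add: product_prob_space_def product_prob_space_axioms_def product_sigma_finite_def prob_space_imp_sigma_finite)
  interpret P: prob_space ?P by (rule prob_space_PiM) (rule N)
  have comp: "distr ?P N (\<lambda>u. u j) = N" for j
    using PiM_component[of j] by simp
  have "P.indep_vars (\<lambda>_. N) (\<lambda>j u. u j) UNIV"
    by (subst P.indep_vars_iff_distr_eq_PiM) (auto simp: comp restrict_def)
  then have "P.indep_vars (\<lambda>_. K) (\<lambda>j u. g (u j)) UNIV"
    by (rule P.indep_vars_compose2) (use g in auto)
  then have joint: "distr ?P (\<Pi>\<^sub>M j\<in>UNIV. K) (\<lambda>u j. g (u j)) = (\<Pi>\<^sub>M j\<in>UNIV. distr ?P K (\<lambda>u. g (u j)))"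
    using g by (subst (asm) P.indep_vars_iff_distr_eq_PiM) (auto simp: restrict_def)
  have "distr ?P K (\<lambda>u. g (u j)) = distr N K g" for j
    using distr_distr[OF g, of "\<lambda>u. u j" ?P] by (simp add: comp comp_def)
  with joint show ?thesis by simp
qed

text \<open>
  A probability on \<open>{..m}\<close> is determined by the masses of all points but one.
\<close>

lemma nat_law_eqI:
  fixes N N' :: "nat measure"
  assumes N: "prob_space N" "sets N = UNIV" "measure N {..m} = 1"
    and N': "prob_space N'" "sets N' = UNIV" "measure N' {..m} = 1"
    and eq: "\<And>k. k < m \<Longrightarrow> measure N {k} = measure N' {k}"
  shows "N = N'"
proof (rule measure_eqI_countable[where A = UNIV])
  have last: "measure K {m} = 1 - (\<Sum>k<m. measure K {k})" and beyond: "k > m \<Longrightarrow> measure K {k} = 0"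
    if K: "prob_space K" "sets K = UNIV" "measure K {..m} = 1" for K :: "nat measure" and k
  proof -
    interpret K: prob_space K by fact
    have "measure K A = (\<Sum>k\<in>A. measure K {k})" if "finite A" for A
      using that K(2) by (intro K.finite_measure_eq_sum_singleton) auto
    from this[of "{..m}"] show "measure K {m} = 1 - (\<Sum>k<m. measure K {k})"
      using K(3) by (simp add: lessThan_Suc_atMost[symmetric])
    assume "k > m"
    then have "measure K ({..m} \<union> {k}) = measure K {..m} + measure K {k}"
      using K(2) by (intro K.finite_measure_Union) auto
    then show "measure K {k} = 0" using K(3) K.prob_le_1[of "{..m} \<union> {k}"] measure_nonneg[of K "{k}"] by linarith
  qed
  fix k :: nat
  interpret N: prob_space N by fact
  interpret N': prob_space N' by fact
  have "measure N {k} = measure N' {k}"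
    using last[OF N] last[OF N'] beyond[OF N, of k] beyond[OF N', of k] eq by (cases k m rule: linorder_cases) auto
  then show "emeasure N {k} = emeasure N' {k}"
    by (simp add: N.emeasure_eq_measure N'.emeasure_eq_measure)
qed (use N N' in auto)

section \<open>The order in which gaps are hit\<close>

text \<open>
  The points of interest are \<open>y 0 < \<dots> < y m\<close>; they bound the gaps \<open>{y k<..y (Suc k)}\<close> with \<open>k < m\<close>.
\<close>

definition points_inc :: "nat \<Rightarrow> (nat \<Rightarrow> real) \<Rightarrow> bool" where
  "points_inc m y \<longleftrightarrow> (\<forall>k<m. y k < y (Suc k))"

text \<open>
  Here \<open>A k j\<close> says that item \<open>k < m\<close> appears at time \<open>j\<close>. All items appear, and the order of their first
  appearances is the order of the ranks \<open>\<pi> ! k\<close>.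
\<close>

definition appear_in_order :: "nat \<Rightarrow> nat list \<Rightarrow> (nat \<Rightarrow> nat \<Rightarrow> bool) \<Rightarrow> bool" where
  "appear_in_order m \<pi> A \<longleftrightarrow> (\<forall>k<m. \<exists>j. A k j) \<and>
     (\<forall>a<m. \<forall>b<m. (LEAST j. A a j) < (LEAST j. A b j) \<longleftrightarrow> \<pi> ! a < \<pi> ! b)"

definition hit_order :: "nat \<Rightarrow> nat list \<Rightarrow> (nat \<Rightarrow> real) \<Rightarrow> (nat \<Rightarrow> real) \<Rightarrow> bool" where
  "hit_order m \<pi> y u \<longleftrightarrow> appear_in_order m \<pi> (\<lambda>k j. u j \<in> {y k<..y (Suc k)})"

text \<open>
  Points outside of all gaps get the value \<open>m\<close>.
\<close>

definition gap_of :: "nat \<Rightarrow> (nat \<Rightarrow> real) \<Rightarrow> real \<Rightarrow> nat" where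
  "gap_of m y v = (LEAST k. k = m \<or> v \<in> {y k<..y (Suc k)})"

definition gap_seq_order :: "nat \<Rightarrow> nat list \<Rightarrow> (nat \<Rightarrow> nat) \<Rightarrow> bool" where
  "gap_seq_order m \<pi> c \<longleftrightarrow> appear_in_order m \<pi> (\<lambda>k j. c j = k)"

lemma appear_in_order_cong:
  "(\<And>k j. k < m \<Longrightarrow> A k j \<longleftrightarrow> B k j) \<Longrightarrow> appear_in_order m \<pi> A \<longleftrightarrow> appear_in_order m \<pi> B"
proof -
  assume "\<And>k j. k < m \<Longrightarrow> A k j \<longleftrightarrow> B k j"
  then have "A k = B k" if "k < m" for k using that by blast
  then show ?thesis unfolding appear_in_order_def by simp
qed

lemma measurable_appear_in_order:
  assumes A: "\<And>k j. k < m \<Longrightarrow> Measurable.pred M (\<lambda>z. A z k j)"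
  shows "Measurable.pred M (\<lambda>z. appear_in_order m \<pi> (A z))"
proof -
  have first: "(\<lambda>z. LEAST j. A z k j) \<in> borel_measurable M" if "k < m" for k
    using measurable_compose[OF measurable_Least[of "\<lambda>j z. A z k j" M], of "\<lambda>x. x" borel] A[OF that] by simp
  have less: "Measurable.pred M (\<lambda>z. (LEAST j. A z a j) < (LEAST j. A z b j))"
    if "a < m" "b < m" for a b
    by (rule borel_measurable_pred_less[OF first[OF that(1)] first[OF that(2)]])
  have "Measurable.pred M (\<lambda>z. \<forall>k<m. \<exists>j. A z k j)"
    by (intro pred_intros_countable pred_intros_imp' A)
  moreover have "Measurable.pred M (\<lambda>z. \<forall>a<m. \<forall>b<m.
      (LEAST j. A z a j) < (LEAST j. A z b j) \<longleftrightarrow> \<pi> ! a < \<pi> ! b)"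
    by (intro pred_intros_countable(1) pred_intros_imp' pred_intros_logic(6) less measurable_const) auto
  ultimately show ?thesis unfolding appear_in_order_def by (rule pred_intros_logic(3))
qed

lemma points_inc_mono: "points_inc m y \<Longrightarrow> a \<le> b \<Longrightarrow> b \<le> m \<Longrightarrow> y a \<le> y b"
proof (induction b)
  case (Suc b)
  show ?case
  proof (cases "a = Suc b")
    case False
    then have "y a \<le> y b" using Suc by auto
    moreover have "y b < y (Suc b)" using Suc.prems by (auto simp: points_inc_def)
    ultimately show ?thesis by simp
  qed simp
qed simp

lemma points_inc_strict: "points_inc m y \<Longrightarrow> a < b \<Longrightarrow> b \<le> m \<Longrightarrow> y a < y b"
proof -
  assume a: "points_inc m y" "a < b" "b \<le> m"
  then have "y a < y (Suc a)" by (simp add: points_inc_def)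
  also have "y (Suc a) \<le> y b" using a by (intro points_inc_mono) auto
  finally show ?thesis .
qed

lemma gap_of_le: "gap_of m y v \<le> m"
  unfolding gap_of_def by (rule Least_le) simp

lemma gap_of_eq_iff:
  assumes y: "points_inc m y" and k: "k < m"
  shows "gap_of m y v = k \<longleftrightarrow> v \<in> {y k<..y (Suc k)}"
proof
  assume "gap_of m y v = k"
  then show "v \<in> {y k<..y (Suc k)}"
    using LeastI[of "\<lambda>k. k = m \<or> v \<in> {y k<..y (Suc k)}" m] k by (auto simp: gap_of_def)
next
  assume v: "v \<in> {y k<..y (Suc k)}"
  show "gap_of m y v = k"
    unfolding gap_of_def
  proof (rule Least_equality)
    fix l assume l: "l = m \<or> v \<in> {y l<..y (Suc l)}"
    show "k \<le> l"
    proof (rule ccontr)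
      assume "\<not> k \<le> l"
      then have "y (Suc l) \<le> y k" using k by (intro points_inc_mono[OF y]) auto
      moreover have "v \<le> y (Suc l)" using l \<open>\<not> k \<le> l\<close> k by auto
      ultimately show False using v by auto
    qed
  qed (use v in auto)
qed

lemma hit_order_iff_gap_seq_order: "points_inc m y \<Longrightarrow> hit_order m \<pi> y u \<longleftrightarrow> gap_seq_order m \<pi> (\<lambda>j. gap_of m y (u j))"
  unfolding hit_order_def gap_seq_order_def by (intro appear_in_order_cong) (simp add: gap_of_eq_iff)

text \<open>
  Exchanging the names of two items exchanges their ranks.
\<close>

lemma gap_seq_order_swap:
  assumes i: "Suc i < m" and \<pi>: "\<And>k. k < m \<Longrightarrow> \<pi>' ! k = \<pi> ! (Transposition.transpose i (Suc i) k)"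
  shows "gap_seq_order m \<pi>' (\<lambda>j. Transposition.transpose i (Suc i) (c j)) \<longleftrightarrow> gap_seq_order m \<pi> c"
proof -
  let ?s = "Transposition.transpose i (Suc i)"
  have s: "?s k < m \<longleftrightarrow> k < m" for k using i by (auto simp: Transposition.transpose_def)
  have eq: "?s x = k \<longleftrightarrow> x = ?s k" for x k by (metis transpose_involutory)
  have all: "(\<forall>k<m. P (?s k)) \<longleftrightarrow> (\<forall>k<m. P k)" for P :: "nat \<Rightarrow> bool"
    by (metis s transpose_involutory)
  have all2: "(\<forall>a<m. \<forall>b<m. R (?s a) (?s b)) \<longleftrightarrow> (\<forall>a<m. \<forall>b<m. R a b)" for R :: "nat \<Rightarrow> nat \<Rightarrow> bool"
  proof -
    have "(\<forall>b<m. R a (?s b)) \<longleftrightarrow> (\<forall>b<m. R a b)" for a by (rule all)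
    then show ?thesis using all[of "\<lambda>a. \<forall>b<m. R a b"] by simp
  qed
  have "gap_seq_order m \<pi>' (\<lambda>j. ?s (c j)) \<longleftrightarrow> (\<forall>k<m. \<exists>j. c j = ?s k) \<and>
     (\<forall>a<m. \<forall>b<m. (LEAST j. c j = ?s a) < (LEAST j. c j = ?s b) \<longleftrightarrow> \<pi> ! ?s a < \<pi> ! ?s b)"
    unfolding gap_seq_order_def appear_in_order_def eq using \<pi> by simp
  also have "\<dots> \<longleftrightarrow> gap_seq_order m \<pi> c"
    unfolding gap_seq_order_def appear_in_order_def
    by (intro conj_cong all[of "\<lambda>k. \<exists>j. c j = k"]
      all2[of "\<lambda>a b. (LEAST j. c j = a) < (LEAST j. c j = b) \<longleftrightarrow> \<pi> ! a < \<pi> ! b"])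
  finally show ?thesis .
qed

lemma measurable_gap_seq_order [measurable]:
  "Measurable.pred (\<Pi>\<^sub>M j\<in>UNIV. count_space UNIV) (gap_seq_order m \<pi>)"
  unfolding gap_seq_order_def by (rule measurable_appear_in_order) measurable

lemma measurable_gap_of [measurable]: "gap_of m y \<in> measurable borel (count_space UNIV)"
  unfolding gap_of_def by measurable

lemma measurable_hit_order:
  assumes [measurable]: "\<And>k. k \<le> m \<Longrightarrow> (\<lambda>z. Y z k) \<in> borel_measurable M" "\<And>j. (\<lambda>z. V z j) \<in> borel_measurable M"
  shows "Measurable.pred M (\<lambda>z. hit_order m \<pi> (Y z) (V z))"
proof -
  have "Measurable.pred M (\<lambda>z. V z j \<in> {Y z k<..Y z (Suc k)})" if "k < m" for j k
  proof -
    have [measurable]: "(\<lambda>z. Y z k) \<in> borel_measurable M" "(\<lambda>z. Y z (Suc k)) \<in> borel_measurable M"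
      using that by (auto intro: assms(1))
    show ?thesis unfolding greaterThanAtMost_iff by measurable
  qed
  then show ?thesis unfolding hit_order_def by (rule measurable_appear_in_order)
qed

definition hit_prob :: "nat \<Rightarrow> nat list \<Rightarrow> (nat \<Rightarrow> real) \<Rightarrow> ennreal" where
  "hit_prob m \<pi> y = emeasure unif_seq {u. hit_order m \<pi> y u}"

text \<open>
  The indices of the gaps that contain the successive \<open>u j\<close> form an i.i.d. sequence whose law is given by the
  lengths of the gaps. So permuting the lengths has the same effect as permuting the names of the gaps.
\<close>

lemma hit_prob_swap:
  assumes y: "points_inc m y" "0 \<le> y 0" "y m \<le> 1" and y': "points_inc m y'" "0 \<le> y' 0" "y' m \<le> 1"
    and i: "Suc i < m"
    and \<pi>: "\<And>k. k < m \<Longrightarrow> \<pi>' ! k = \<pi> ! (Transposition.transpose i (Suc i) k)"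
    and gaps: "\<And>k. k < m \<Longrightarrow> y' (Suc k) - y' k = y (Suc (Transposition.transpose i (Suc i) k)) - y (Transposition.transpose i (Suc i) k)"
  shows "hit_prob m \<pi> y = hit_prob m \<pi>' y'"
proof -
  let ?s = "Transposition.transpose i (Suc i)" and ?C = "count_space UNIV :: nat measure"
  interpret prob_space unif by (rule prob_space_unif)
  have s: "?s k < m \<longleftrightarrow> k < m" "?s k \<le> m \<longleftrightarrow> k \<le> m" for k using i by (auto simp: Transposition.transpose_def)
  have g[measurable]: "gap_of m z \<in> measurable unif ?C" for z
  proof -
    have "measurable unif ?C = measurable borel ?C" by (rule measurable_cong_sets) auto
    then show ?thesis by simp
  qed
  have sg[measurable]: "(\<lambda>v. ?s (gap_of m z v)) \<in> measurable unif ?C" for z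
    by (rule measurable_compose[OF g]) simp
  \<comment> \<open>Both laws give mass \<open>y' (Suc k) - y' k\<close> to each gap index \<open>k < m\<close>.\<close>
  have law: "distr unif ?C (\<lambda>v. ?s (gap_of m y v)) = distr unif ?C (gap_of m y')"
  proof (rule nat_law_eqI[where m = m])
    show "prob_space (distr unif ?C (\<lambda>v. ?s (gap_of m y v)))" "prob_space (distr unif ?C (gap_of m y'))"
      by (auto intro: prob_space_distr g sg)
    have "(\<lambda>v. ?s (gap_of m y v)) -` {..m} = UNIV" "gap_of m y' -` {..m} = UNIV"
      using s gap_of_le by auto
    then show "measure (distr unif ?C (\<lambda>v. ?s (gap_of m y v))) {..m} = 1"
       "measure (distr unif ?C (gap_of m y')) {..m} = 1"
      using prob_space by (simp_all add: measure_distr[OF g] measure_distr[OF sg])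
    fix k assume k: "k < m"
    have len: "measure unif {z l<..z (Suc l)} = z (Suc l) - z l" if "points_inc m z" "0 \<le> z 0" "z m \<le> 1" "l < m" for z l
      using points_inc_mono[OF that(1), of 0 l] points_inc_mono[OF that(1), of "Suc l" m] that
      by (intro measure_unif_gap) (auto simp: points_inc_def intro: less_imp_le)
    have v1: "(\<lambda>v. ?s (gap_of m y v)) -` {k} = {y (?s k)<..y (Suc (?s k))}"
    proof -
      have "?s x = k \<longleftrightarrow> x = ?s k" for x by (metis transpose_involutory)
      then have "(\<lambda>v. ?s (gap_of m y v)) -` {k} = {v. gap_of m y v = ?s k}" by auto
      also have "\<dots> = {y (?s k)<..y (Suc (?s k))}" using gap_of_eq_iff[OF y(1), of "?s k"] s k by auto
      finally show ?thesis .
    qed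
    have v2: "gap_of m y' -` {k} = {y' k<..y' (Suc k)}"
      unfolding vimage_def singleton_iff gap_of_eq_iff[OF y'(1) k] by (rule Collect_mem_eq)
    have "measure (distr unif ?C (\<lambda>v. ?s (gap_of m y v))) {k} = measure unif {y (?s k)<..y (Suc (?s k))}"
      using measure_distr[OF sg, of "{k}" y] unfolding v1 by simp
    also have "\<dots> = y (Suc (?s k)) - y (?s k)" using k s(1)[of k] by (intro len y) simp
    also have "\<dots> = y' (Suc k) - y' k" using gaps[OF k] by simp
    also have "\<dots> = measure unif {y' k<..y' (Suc k)}" by (rule len[OF y' k, symmetric])
    also have "\<dots> = measure (distr unif ?C (gap_of m y')) {k}"
      using measure_distr[OF g, of "{k}" y'] unfolding v2 by simp
    finally show "measure (distr unif ?C (\<lambda>v. ?s (gap_of m y v))) {k} = measure (distr unif ?C (gap_of m y')) {k}" .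
  qed auto
  have space: "space unif_seq = UNIV" by (simp add: space_PiM)
  have em: "emeasure unif_seq {u. gap_seq_order m \<rho> (\<lambda>j. h (u j))} =
    emeasure (\<Pi>\<^sub>M j\<in>UNIV. distr unif ?C h) {c. gap_seq_order m \<rho> c}" if h: "h \<in> measurable unif ?C" for h \<rho>
  proof -
    have "(\<lambda>u j. h (u j)) \<in> measurable unif_seq (\<Pi>\<^sub>M j\<in>UNIV. ?C)"
      using h by (intro measurable_PiM_single') auto
    moreover have "{c. gap_seq_order m \<rho> c} \<in> sets (\<Pi>\<^sub>M j\<in>(UNIV::nat set). ?C)"
      using predE[OF measurable_gap_seq_order[of m \<rho>]] by (simp add: space_PiM)
    ultimately show ?thesis
      unfolding distr_PiM_map[OF prob_space_unif h, symmetric]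
      by (subst emeasure_distr) (auto simp: space vimage_def)
  qed
  have swap: "gap_seq_order m \<pi>' (\<lambda>j. ?s (c j)) \<longleftrightarrow> gap_seq_order m \<pi> c" for c
    by (rule gap_seq_order_swap[OF i]) (rule \<pi>)
  have "hit_prob m \<pi> y = emeasure unif_seq {u. gap_seq_order m \<pi>' (\<lambda>j. ?s (gap_of m y (u j)))}"
    unfolding hit_prob_def hit_order_iff_gap_seq_order[OF y(1)] swap ..
  also have "\<dots> = emeasure unif_seq {u. gap_seq_order m \<pi>' (\<lambda>j. gap_of m y' (u j))}"
    unfolding em[OF sg] em[OF g] law ..
  also have "\<dots> = hit_prob m \<pi>' y'"
    unfolding hit_prob_def hit_order_iff_gap_seq_order[OF y'(1)] ..
  finally show ?thesis .
qed

text \<open>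
  The probability that the first \<open>n\<close> terms avoid a given gap of positive length tends to \<open>0\<close> geometrically.
\<close>

lemma AE_all_hit:
  assumes y: "points_inc m y" "0 \<le> y 0" "y m \<le> 1"
  shows "AE u in unif_seq. \<forall>k<m. \<exists>j. u j \<in> {y k<..y (Suc k)}"
proof -
  have "AE u in unif_seq. \<exists>j. u j \<in> {y k<..y (Suc k)}" if k: "k < m" for k
  proof -
    interpret U: prob_space unif by (rule prob_space_unif)
    interpret sequence_space unif
      by (simp add: sequence_space_def product_prob_space_def product_prob_space_axioms_def product_sigma_finite_def
        prob_space_unif prob_space_imp_sigma_finite)
    let ?E = "UNIV - {y k<..y (Suc k)}"
    have "0 \<le> y k" "y k < y (Suc k)" "y (Suc k) \<le> 1"
      using points_inc_mono[OF y(1), of 0 k] points_inc_mono[OF y(1), of "Suc k" m] k y by (auto simp: points_inc_def)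
    then have "measure unif ?E = 1 - (y (Suc k) - y k)"
      using U.prob_compl[of "{y k<..y (Suc k)}"] measure_unif_gap[of "y k" "y (Suc k)"] by simp
    moreover have "(\<lambda>n. \<Prod>i\<le>n. measure unif ?E) \<longlonglongrightarrow> measure unif_seq (Pi UNIV (\<lambda>_. ?E))"
      by (rule measure_PiM_countable) auto
    moreover have "(\<lambda>n. \<Prod>i\<le>n. r) \<longlonglongrightarrow> 0" if "0 \<le> r" "r < 1" for r :: real
      using LIMSEQ_Suc[OF LIMSEQ_realpow_zero[OF that]] by simp
    ultimately have "measure unif_seq (Pi UNIV (\<lambda>_. ?E)) = 0"
      using \<open>0 \<le> y k\<close> \<open>y k < y (Suc k)\<close> \<open>y (Suc k) \<le> 1\<close>
      by (intro LIMSEQ_unique[of "\<lambda>n. \<Prod>i\<le>n. measure unif ?E"]) auto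
    moreover have "Pi UNIV (\<lambda>_. ?E) \<in> sets unif_seq" by (rule infprod_in_sets) auto
    ultimately have "Pi UNIV (\<lambda>_. ?E) \<in> null_sets unif_seq"
      using finite_measure.emeasure_eq_measure[OF prob_space.finite_measure[OF prob_space_unif_seq]] by (auto simp: null_sets_def)
    then show ?thesis by (rule AE_I') auto
  qed
  then have "AE u in unif_seq. \<forall>k\<in>{..<m}. \<exists>j. u j \<in> {y k<..y (Suc k)}"
    by (subst AE_ball_countable) auto
  then show ?thesis by (rule eventually_mono) auto
qed

section \<open>Exchangeability of the gaps\<close>

lemma hit_order_cong: "(\<And>k. k \<le> m \<Longrightarrow> y k = y' k) \<Longrightarrow> hit_order m \<pi> y u \<longleftrightarrow> hit_order m \<pi> y' u"
  unfolding hit_order_def by (rule appear_in_order_cong) simp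

lemma hit_prob_cong: "(\<And>k. k \<le> m \<Longrightarrow> y k = y' k) \<Longrightarrow> hit_prob m \<pi> y = hit_prob m \<pi> y'"
proof -
  assume "\<And>k. k \<le> m \<Longrightarrow> y k = y' k"
  then have "hit_order m \<pi> y = hit_order m \<pi> y'" by (intro ext hit_order_cong)
  then show ?thesis by (simp add: hit_prob_def)
qed

lemma points_inc_cong: "(\<And>k. k \<le> m \<Longrightarrow> y k = y' k) \<Longrightarrow> points_inc m y \<longleftrightarrow> points_inc m y'"
  unfolding points_inc_def by simp

lemma measurable_points_inc:
  assumes "\<And>k. k \<le> m \<Longrightarrow> (\<lambda>z. Y z k) \<in> borel_measurable M"
  shows "Measurable.pred M (\<lambda>z. points_inc m (Y z))"
  unfolding points_inc_def
  by (intro pred_intros_countable pred_intros_imp' borel_measurable_pred_less assms) auto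

text \<open>
  Cutting off at points that are not increasing leaves a function on all of \<open>\<real>\<^sup>n\<close> that can be integrated one
  coordinate at a time.
\<close>

definition ordered_hit_prob :: "nat \<Rightarrow> nat list \<Rightarrow> (nat \<Rightarrow> real) \<Rightarrow> ennreal" where
  "ordered_hit_prob m \<pi> y = (if points_inc m y then hit_prob m \<pi> y else 0)"

lemma ordered_hit_prob_cong: "(\<And>k. k \<le> m \<Longrightarrow> y k = y' k) \<Longrightarrow> ordered_hit_prob m \<pi> y = ordered_hit_prob m \<pi> y'"
proof -
  assume eq: "\<And>k. k \<le> m \<Longrightarrow> y k = y' k"
  have "hit_prob m \<pi> y = hit_prob m \<pi> y'" by (rule hit_prob_cong) (rule eq)
  moreover have "points_inc m y \<longleftrightarrow> points_inc m y'" by (rule points_inc_cong) (rule eq)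
  ultimately show ?thesis by (simp add: ordered_hit_prob_def)
qed

lemma sets_hit_order: "{u. hit_order m \<pi> y u} \<in> sets unif_seq"
proof -
  have "Measurable.pred unif_seq (hit_order m \<pi> y)"
    by (rule measurable_hit_order) (auto intro: measurable_unif_seq_component)
  from predE[OF this] show ?thesis by (simp add: space_PiM)
qed

lemma hit_prob_nn_integral: "hit_prob m \<pi> y = (\<integral>\<^sup>+ u. indicator {u. hit_order m \<pi> y u} u \<partial>unif_seq)"
  unfolding hit_prob_def by (rule nn_integral_indicator[OF sets_hit_order, symmetric])

lemma measurable_ordered_hit_prob:
  assumes Y: "\<And>k. k \<le> m \<Longrightarrow> (\<lambda>z. Y z k) \<in> borel_measurable M"
  shows "(\<lambda>z. ordered_hit_prob m \<pi> (Y z)) \<in> borel_measurable M"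
proof -
  interpret sigma_finite_measure unif_seq
    by (rule prob_space_imp_sigma_finite[OF prob_space_unif_seq])
  have "Measurable.pred (M \<Otimes>\<^sub>M unif_seq) (\<lambda>z. hit_order m \<pi> (Y (fst z)) (snd z))"
  proof (rule measurable_hit_order)
    show "(\<lambda>z. Y (fst z) k) \<in> borel_measurable (M \<Otimes>\<^sub>M unif_seq)" if "k \<le> m" for k
      by (rule measurable_compose[OF measurable_fst Y[OF that]])
    show "(\<lambda>z. snd z j) \<in> borel_measurable (M \<Otimes>\<^sub>M unif_seq)" for j
      by (rule measurable_compose[OF measurable_snd measurable_unif_seq_component])
  qed
  then have "(\<lambda>z. indicator {z. hit_order m \<pi> (Y (fst z)) (snd z)} z :: ennreal) \<in> borel_measurable (M \<Otimes>\<^sub>M unif_seq)"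
    by (intro borel_measurable_indicator') (simp add: pred_def)
  then have "(\<lambda>(z, u). indicator {u. hit_order m \<pi> (Y z) u} u :: ennreal) \<in> borel_measurable (M \<Otimes>\<^sub>M unif_seq)"
    by (simp add: indicator_def split_beta)
  then have "(\<lambda>z. hit_prob m \<pi> (Y z)) \<in> borel_measurable M"
    unfolding hit_prob_nn_integral by (rule borel_measurable_nn_integral)
  then show ?thesis
    unfolding ordered_hit_prob_def by (intro measurable_If_set measurable_If measurable_points_inc[OF Y, unfolded pred_def]) (auto intro: measurable_points_inc[OF Y, unfolded pred_def])
qed

text \<open>
  The reflection \<open>z \<mapsto> Y i + Y (i + 2) - z\<close> exchanges the gaps on both sides of the point with index \<open>i + 1\<close>,
  keeps this point between its neighbours and preserves Lebesgue measure.
\<close>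

lemma integral_swap_gaps:
  assumes Y: "0 \<le> Y 0" "Y m \<le> 1" and i: "Suc i < m"
    and \<pi>: "\<And>k. k < m \<Longrightarrow> \<pi>' ! k = \<pi> ! (Transposition.transpose i (Suc i) k)"
  shows "(\<integral>\<^sup>+ z. ordered_hit_prob m \<pi> (Y(Suc i := z)) \<partial>lborel) = (\<integral>\<^sup>+ z. ordered_hit_prob m \<pi>' (Y(Suc i := z)) \<partial>lborel)"
proof -
  let ?c = "Y i + Y (Suc (Suc i))"
  have meas: "(\<lambda>z. ordered_hit_prob m \<rho> (Y(Suc i := z))) \<in> borel_measurable borel" for \<rho>
  proof (rule measurable_ordered_hit_prob)
    show "(\<lambda>z. (Y(Suc i := z)) k) \<in> borel_measurable borel" for k by (cases "k = Suc i") auto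
  qed
  \<comment> \<open>The point with index \<open>i + 1\<close> is the only one that moves, and it stays between its neighbours.\<close>
  have flip: "points_inc m (Y(Suc i := ?c - z))" if points_inc: "points_inc m (Y(Suc i := z))" for z
    unfolding points_inc_def
  proof (intro allI impI)
    fix k assume k: "k < m"
    have "Y i < z" "z < Y (Suc (Suc i))"
      using points_inc i unfolding points_inc_def by (auto dest: spec[of _ i] spec[of _ "Suc i"])
    moreover have "(Y(Suc i := z)) k < (Y(Suc i := z)) (Suc k)" using points_inc k unfolding points_inc_def by blast
    ultimately show "(Y(Suc i := ?c - z)) k < (Y(Suc i := ?c - z)) (Suc k)"
      by (cases "k = i \<or> k = Suc i") auto
  qed
  have eq: "ordered_hit_prob m \<pi> (Y(Suc i := z)) = ordered_hit_prob m \<pi>' (Y(Suc i := ?c + (-1) * z))" for z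
  proof (cases "points_inc m (Y(Suc i := z))")
    case True
    have "hit_prob m \<pi> (Y(Suc i := z)) = hit_prob m \<pi>' (Y(Suc i := ?c - z))"
    proof (rule hit_prob_swap[OF True _ _ flip[OF True] _ _ i \<pi>])
      fix k assume "k < m"
      show "(Y(Suc i := ?c - z)) (Suc k) - (Y(Suc i := ?c - z)) k =
        (Y(Suc i := z)) (Suc (Transposition.transpose i (Suc i) k)) - (Y(Suc i := z)) (Transposition.transpose i (Suc i) k)"
        by (cases "k = i"; cases "k = Suc i") (auto simp: transpose_apply_other)
    qed (use Y i in auto)
    then show ?thesis using True flip[OF True] by (simp add: ordered_hit_prob_def)
  next
    case False
    have "\<not> points_inc m (Y(Suc i := ?c - z))"
      using flip[of "?c - z"] False by auto
    then show ?thesis using False by (simp add: ordered_hit_prob_def)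
  qed
  have "(\<integral>\<^sup>+ z. ordered_hit_prob m \<pi>' (Y(Suc i := z)) \<partial>lborel) = \<bar>-1::real\<bar> * (\<integral>\<^sup>+ z. ordered_hit_prob m \<pi>' (Y(Suc i := ?c + (-1) * z)) \<partial>lborel)"
    by (rule nn_integral_real_affine[OF meas]) simp
  then show ?thesis unfolding eq[symmetric] by simp
qed

abbreviation unit_cube :: "nat \<Rightarrow> (nat \<Rightarrow> real) measure" where
  "unit_cube n \<equiv> (\<Pi>\<^sub>M i\<in>{1..n}. unit_lborel)"

lemma product_sigma_finite_unit: "product_sigma_finite (\<lambda>_::nat. unit_lborel)"
  unfolding product_sigma_finite_def
  by (intro allI prob_space_imp_sigma_finite prob_space_restrict_space) auto

lemma measurable_unit_cube_component:
  assumes "i \<in> I" shows "(\<lambda>x. x i) \<in> borel_measurable (\<Pi>\<^sub>M i\<in>I. unit_lborel)"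
proof -
  have "(\<lambda>x. x) \<in> borel_measurable unit_lborel" by (rule measurable_restrict_space1) auto
  from measurable_compose[OF measurable_component_singleton[OF assms] this] show ?thesis .
qed

text \<open>
  The probability that \<open>\<rho>\<close> lists the uniform points in increasing order and that their gaps are hit in the order
  \<open>\<pi>\<close>.
\<close>

definition order_weight :: "nat \<Rightarrow> nat list \<Rightarrow> nat list \<Rightarrow> ennreal" where
  "order_weight m \<rho> \<pi> = (\<integral>\<^sup>+ x. ordered_hit_prob m \<pi> (\<lambda>k. x (\<rho> ! k)) \<partial>unit_cube (Suc m))"

lemma measurable_ordered_hit_prob_cube:
  assumes \<rho>: "\<rho> \<in> permutations_of_set {1..Suc m}"
  shows "(\<lambda>x. ordered_hit_prob m \<pi> (\<lambda>k. x (\<rho> ! k))) \<in> borel_measurable (unit_cube (Suc m))"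
proof (rule measurable_ordered_hit_prob)
  fix k assume "k \<le> m"
  moreover have "length \<rho> = Suc m" using length_finite_permutations_of_set[OF \<rho>] by simp
  ultimately have "\<rho> ! k \<in> set \<rho>" by (intro nth_mem) auto
  then have "\<rho> ! k \<in> {1..Suc m}" using \<rho> by (simp add: permutations_of_set_def)
  then show "(\<lambda>x. x (\<rho> ! k)) \<in> borel_measurable (unit_cube (Suc m))"
    by (rule measurable_unit_cube_component)
qed

text \<open>
  By Fubini, the coordinate of the sample point between the two gaps is integrated first.
\<close>

lemma order_weight_swap:
  assumes \<rho>: "\<rho> \<in> permutations_of_set {1..Suc m}" and i: "Suc i < m"
    and \<pi>: "\<And>k. k < m \<Longrightarrow> \<pi>' ! k = \<pi> ! (Transposition.transpose i (Suc i) k)"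
  shows "order_weight m \<rho> \<pi> = order_weight m \<rho> \<pi>'"
proof -
  interpret product_sigma_finite "\<lambda>_::nat. unit_lborel" by (rule product_sigma_finite_unit)
  have len: "length \<rho> = Suc m" and set\<rho>: "set \<rho> = {1..Suc m}" and dist: "distinct \<rho>"
    using length_finite_permutations_of_set[OF \<rho>] \<rho> by (auto simp: permutations_of_set_def)
  define c where "c = \<rho> ! Suc i"
  define I where "I = {1..Suc m} - {c}"
  have nth: "\<rho> ! k \<in> {1..Suc m}" if "k \<le> m" for k using that len set\<rho> nth_mem[of k \<rho>] by simp
  have ins: "insert c I = {1..Suc m}" using nth[of "Suc i"] i by (auto simp: I_def c_def)
  have ne: "\<rho> ! k \<noteq> c" if "k \<le> m" "k \<noteq> Suc i" for k
    unfolding c_def using that i len dist by (subst nth_eq_iff_index_eq) auto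
  have inner: "(\<integral>\<^sup>+ z. ordered_hit_prob m \<sigma> (\<lambda>k. (x(c := z)) (\<rho> ! k)) \<partial>unit_lborel) =
      (\<integral>\<^sup>+ z. ordered_hit_prob m \<sigma> ((\<lambda>k. x (\<rho> ! k))(Suc i := z)) \<partial>lborel)"
    if x: "x \<in> space (\<Pi>\<^sub>M j\<in>I. unit_lborel)" for x \<sigma>
  proof -
    let ?Y = "\<lambda>k. x (\<rho> ! k)"
    have "(\<integral>\<^sup>+ z. ordered_hit_prob m \<sigma> (\<lambda>k. (x(c := z)) (\<rho> ! k)) \<partial>unit_lborel) =
        (\<integral>\<^sup>+ z. ordered_hit_prob m \<sigma> (\<lambda>k. (x(c := z)) (\<rho> ! k)) * indicator {0..1} z \<partial>lborel)"
      by (rule nn_integral_restrict_space) simp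
    also have "\<dots> = (\<integral>\<^sup>+ z. ordered_hit_prob m \<sigma> (?Y(Suc i := z)) \<partial>lborel)"
    proof (rule nn_integral_cong)
      fix z :: real
      have "ordered_hit_prob m \<sigma> (\<lambda>k. (x(c := z)) (\<rho> ! k)) = ordered_hit_prob m \<sigma> (?Y(Suc i := z))"
        by (rule ordered_hit_prob_cong) (use ne in \<open>auto simp: c_def\<close>)
      \<comment> \<open>The points with indices \<open>i\<close> and \<open>i + 2\<close> lie in the unit interval, hence so does a point between them; this removes the restriction of the domain.\<close>
      moreover have "z \<in> {0..1}" if points_inc: "points_inc m (?Y(Suc i := z))"
      proof -
        have "?Y i < z" "z < ?Y (Suc (Suc i))"
          using points_inc i unfolding points_inc_def by (auto dest: spec[of _ i] spec[of _ "Suc i"])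
        moreover have "\<rho> ! i \<in> I" "\<rho> ! Suc (Suc i) \<in> I"
          using nth[of i] nth[of "Suc (Suc i)"] ne[of i] ne[of "Suc (Suc i)"] i by (auto simp: I_def)
        then have "?Y i \<in> {0..1}" "?Y (Suc (Suc i)) \<in> {0..1}"
          using x by (auto simp: space_PiM space_restrict_space PiE_iff)
        ultimately show ?thesis by auto
      qed
      ultimately show "ordered_hit_prob m \<sigma> (\<lambda>k. (x(c := z)) (\<rho> ! k)) * indicator {0..1} z = ordered_hit_prob m \<sigma> (?Y(Suc i := z))"
        by (cases "points_inc m (?Y(Suc i := z))") (simp_all add: ordered_hit_prob_def)
    qed
    finally show ?thesis .
  qed
  have split: "order_weight m \<rho> \<sigma> = (\<integral>\<^sup>+ x. (\<integral>\<^sup>+ z. ordered_hit_prob m \<sigma> (\<lambda>k. (x(c := z)) (\<rho> ! k)) \<partial>unit_lborel) \<partial>(\<Pi>\<^sub>M j\<in>I. unit_lborel))" for \<sigma>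
    unfolding order_weight_def ins[symmetric]
    by (rule product_nn_integral_insert) (use measurable_ordered_hit_prob_cube[OF \<rho>] ins in \<open>auto simp: I_def\<close>)
  show ?thesis
    unfolding split
  proof (rule nn_integral_cong)
    fix x assume x: "x \<in> space (\<Pi>\<^sub>M j\<in>I. unit_lborel)"
    have "\<rho> ! 0 \<in> I" "\<rho> ! m \<in> I" using nth[of 0] nth[of m] ne[of 0] ne[of m] i by (auto simp: I_def)
    then have "0 \<le> x (\<rho> ! 0)" "x (\<rho> ! m) \<le> 1"
      using x by (auto simp: space_PiM space_restrict_space PiE_iff)
    then show "(\<integral>\<^sup>+ z. ordered_hit_prob m \<pi> (\<lambda>k. (x(c := z)) (\<rho> ! k)) \<partial>unit_lborel) =
        (\<integral>\<^sup>+ z. ordered_hit_prob m \<pi>' (\<lambda>k. (x(c := z)) (\<rho> ! k)) \<partial>unit_lborel)"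
      unfolding inner[OF x] by (intro integral_swap_gaps i \<pi>)
  qed
qed

text \<open>
  Adjacent transpositions generate all permutations; an element is bubbled to the front and the tail is
  treated by induction.
\<close>

lemma adjacent_swaps_imp_mset_invariant:
  assumes swap: "\<And>xs a b ys. length xs + length ys + 2 = m \<Longrightarrow> f (xs @ a # b # ys) = f (xs @ b # a # ys)"
    and us: "mset us = mset vs" "length us = m"
  shows "f us = f vs"
proof -
  have move: "f (pre @ v @ x # w) = f (pre @ x # v @ w)" if "length pre + length v + length w + 1 = m" for pre v x w
    using that
  proof (induction v arbitrary: pre)
    case (Cons a v)
    have "f (pre @ a # v @ x # w) = f (pre @ a # x # v @ w)" using Cons.IH[of "pre @ [a]"] Cons.prems by simp
    also have "\<dots> = f (pre @ x # a # v @ w)" using swap[of pre "v @ w"] Cons.prems by simp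
    finally show ?case by simp
  qed simp
  have "f (pre @ us) = f (pre @ vs)" if "mset us = mset vs" "length pre + length us = m" for pre us vs
    using that
  proof (induction us arbitrary: pre vs)
    case (Cons x us)
    then have "x \<in> set vs" by (metis list.set_intros(1) set_mset_mset)
    then obtain v w where vs: "vs = v @ x # w" by (metis split_list)
    have ms: "mset us = mset (v @ w)" using Cons.prems vs by simp
    have "length us = length (v @ w)" using mset_eq_length[OF ms] .
    then have "f (pre @ vs) = f (pre @ x # v @ w)" using move[of pre v w x] Cons.prems vs by simp
    also have "\<dots> = f (pre @ x # us)" using Cons.IH[OF ms, of "pre @ [x]"] Cons.prems by simp
    finally show ?case by simp
  qed simp
  from this[of us vs "[]"] us show ?thesis by simp
qed

lemma order_weight_const:
  assumes \<rho>: "\<rho> \<in> permutations_of_set {1..Suc m}"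
    and \<pi>: "\<pi> \<in> permutations_of_set {1..m}" "\<pi>' \<in> permutations_of_set {1..m}"
  shows "order_weight m \<rho> \<pi> = order_weight m \<rho> \<pi>'"
proof (rule adjacent_swaps_imp_mset_invariant)
  show "length \<pi> = m" using length_finite_permutations_of_set[OF \<pi>(1)] by simp
  show "mset \<pi> = mset \<pi>'" using \<pi> by (auto simp: permutations_of_set_def set_eq_iff_mset_eq_distinct[symmetric])
  fix xs ys :: "nat list" and a b assume len: "length xs + length ys + 2 = m"
  show "order_weight m \<rho> (xs @ a # b # ys) = order_weight m \<rho> (xs @ b # a # ys)"
  proof (rule order_weight_swap[OF \<rho>, of "length xs"])
    show "Suc (length xs) < m" using len by simp
    show "(xs @ b # a # ys) ! k = (xs @ a # b # ys) ! (Transposition.transpose (length xs) (Suc (length xs)) k)" for k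
      by (auto simp: Transposition.transpose_def nth_append nth_Cons')
  qed
qed

lemma AE_unit_cube_inj: "AE x in unit_cube n. inj_on x {1..n}"
proof -
  interpret product_sigma_finite "\<lambda>_::nat. unit_lborel" by (rule product_sigma_finite_unit)
  have "AE x in unit_cube n. x i \<noteq> x j" if ij: "i \<in> {1..n}" "j \<in> {1..n}" "i \<noteq> j" for i j
  proof -
    let ?I = "{1..n} - {i}"
    have ins: "insert i ?I = {1..n}" using ij by auto
    have "(\<lambda>x. x i) \<in> borel_measurable (unit_cube n)" "(\<lambda>x. x j) \<in> borel_measurable (unit_cube n)"
      using ij by (auto intro!: measurable_unit_cube_component)
    then have m: "Measurable.pred (unit_cube n) (\<lambda>x. x i = x j)"
      unfolding pred_def by (rule borel_measurable_eq)
    have ind: "(indicator {x. x i = x j} :: (nat \<Rightarrow> real) \<Rightarrow> ennreal) \<in> borel_measurable (unit_cube n)"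
      using m by (intro borel_measurable_indicator') (simp add: pred_def)
    have "(\<integral>\<^sup>+ x. indicator {x. x i = x j} x \<partial>unit_cube n) =
        (\<integral>\<^sup>+ x. (\<integral>\<^sup>+ z. indicator {x. x i = x j} (x(i := z)) \<partial>unit_lborel) \<partial>(\<Pi>\<^sub>M k\<in>?I. unit_lborel))"
      using product_nn_integral_insert[of ?I i "indicator {x. x i = x j}"] ind unfolding ins by simp
    also have "\<dots> = (\<integral>\<^sup>+ x. 0 \<partial>(\<Pi>\<^sub>M k\<in>?I. unit_lborel))"
    proof (rule nn_integral_cong)
      fix x
      have "(\<integral>\<^sup>+ z. indicator {x. x i = x j} (x(i := z)) \<partial>unit_lborel) =
          (\<integral>\<^sup>+ z. indicator {x j} z * indicator {0..1} z \<partial>lborel)"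
        using ij by (subst nn_integral_restrict_space) (auto intro!: nn_integral_cong simp: indicator_def)
      also have "\<dots> \<le> (\<integral>\<^sup>+ z. indicator {x j} z \<partial>lborel)"
        by (intro nn_integral_mono) (auto simp: indicator_def)
      also have "\<dots> = 0" by simp
      finally show "(\<integral>\<^sup>+ z. indicator {x. x i = x j} (x(i := z)) \<partial>unit_lborel) = (0::ennreal)" by simp
    qed
    finally have "(\<integral>\<^sup>+ x. indicator {x. x i = x j} x \<partial>unit_cube n) = 0" by simp
    then have "AE x in unit_cube n. indicator {x. x i = x j} x = (0::ennreal)"
      unfolding nn_integral_0_iff_AE[OF ind] .
    then show ?thesis by (rule eventually_mono) (auto simp: indicator_def split: if_splits)
  qed
  then have "AE x in unit_cube n. \<forall>i\<in>{1..n}. \<forall>j\<in>{1..n}. i \<noteq> j \<longrightarrow> x i \<noteq> x j"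
    by (auto simp: AE_ball_countable)
  then show ?thesis by (rule eventually_mono) (auto simp: inj_on_def)
qed

lemma ex1_sorting_permutation:
  fixes x :: "nat \<Rightarrow> real"
  assumes x: "inj_on x {1..Suc m}"
  shows "\<exists>!\<rho>. \<rho> \<in> permutations_of_set {1..Suc m} \<and> points_inc m (\<lambda>k. x (\<rho> ! k))"
proof -
  have iff: "points_inc m (\<lambda>k. x (\<rho> ! k)) \<longleftrightarrow> sorted_wrt (<) (map x \<rho>)" if "\<rho> \<in> permutations_of_set {1..Suc m}" for \<rho>
  proof -
    have "length \<rho> = Suc m" using length_finite_permutations_of_set[OF that] by simp
    then show ?thesis by (subst sorted_wrt_iff_nth_Suc_transp) (auto simp: points_inc_def)
  qed
  let ?S = "x ` {1..Suc m}"
  let ?\<rho> = "map (inv_into {1..Suc m} x) (sorted_list_of_set ?S)"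
  have map: "map x ?\<rho> = sorted_list_of_set ?S"
    by (auto simp: comp_def f_inv_into_f intro!: map_idI)
  have set: "set ?\<rho> = {1..Suc m}"
    using inv_into_image_cancel[OF x order_refl] by simp
  have dist: "distinct ?\<rho>"
    using distinct_map[of x ?\<rho>] unfolding map by simp
  have \<rho>: "?\<rho> \<in> permutations_of_set {1..Suc m}" using set dist by (rule permutations_of_setI)
  show ?thesis
  proof (rule ex1I[of _ ?\<rho>])
    show "?\<rho> \<in> permutations_of_set {1..Suc m} \<and> points_inc m (\<lambda>k. x (?\<rho> ! k))"
      using \<rho> iff[OF \<rho>] unfolding map by simp
    fix \<sigma> assume \<sigma>: "\<sigma> \<in> permutations_of_set {1..Suc m} \<and> points_inc m (\<lambda>k. x (\<sigma> ! k))"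
    then have s: "sorted_wrt (<) (map x \<sigma>)" "set \<sigma> = {1..Suc m}" using iff by (auto simp: permutations_of_set_def)
    then have "map x \<sigma> = sorted_list_of_set ?S"
      by (intro strict_sorted_equal) auto
    then have "map x \<sigma> = map x ?\<rho>" using map by simp
    then show "\<sigma> = ?\<rho>" using x s(2) set by (subst (asm) inj_on_map_eq_map) auto
  qed
qed

text \<open>
  The pattern consists of the ranks of the values of \<open>t\<close>.
\<close>

lemma ex1_order_pattern:
  fixes t :: "nat \<Rightarrow> nat"
  assumes t: "inj_on t {..<m}"
  shows "\<exists>!\<pi>. \<pi> \<in> permutations_of_set {1..m} \<and> (\<forall>a<m. \<forall>b<m. t a < t b \<longleftrightarrow> \<pi> ! a < \<pi> ! b)"
proof -
  \<comment> \<open>The rank of \<open>t a\<close>, starting at 1.\<close>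
  let ?r = "\<lambda>a. card {b \<in> {..<m}. t b \<le> t a}"
  let ?\<pi> = "map ?r [0..<m]"
  have rank: "?r a < ?r b \<longleftrightarrow> t a < t b" if "a < m" "b < m" for a b
  proof -
    have mono: "?r a < ?r b" if "t a < t b" "b < m" for a b
    proof (rule psubset_card_mono)
      have "b \<in> {c \<in> {..<m}. t c \<le> t b}" "b \<notin> {c \<in> {..<m}. t c \<le> t a}" using that by auto
      moreover have "{c \<in> {..<m}. t c \<le> t a} \<subseteq> {c \<in> {..<m}. t c \<le> t b}" using that by auto
      ultimately show "{c \<in> {..<m}. t c \<le> t a} \<subset> {c \<in> {..<m}. t c \<le> t b}" by blast
    qed simp
    show ?thesis
    proof (cases "t a" "t b" rule: linorder_cases)
      case equal
      then have "a = b" using t that by (auto simp: inj_on_def)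
      then show ?thesis by simp
    next
      case less
      then show ?thesis using mono[OF less that(2)] by simp
    next
      case greater
      then show ?thesis using mono[OF greater that(1)] by simp
    qed
  qed
  have "inj_on ?r {..<m}"
  proof (rule inj_onI)
    fix a b assume "a \<in> {..<m}" "b \<in> {..<m}" "?r a = ?r b"
    then have "t a = t b" using rank[of a b] rank[of b a] by (cases "t a" "t b" rule: linorder_cases) auto
    then show "a = b" using t \<open>a \<in> {..<m}\<close> \<open>b \<in> {..<m}\<close> by (simp add: inj_on_def)
  qed
  moreover have "?r ` {..<m} \<subseteq> {1..m}"
  proof
    fix r assume "r \<in> ?r ` {..<m}"
    then obtain a where a: "a < m" "r = ?r a" by auto
    have "{b \<in> {..<m}. t b \<le> t a} \<noteq> {}" using a by auto
    then have "0 < ?r a" by (subst card_gt_0_iff) auto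
    moreover have "?r a \<le> card {..<m}" by (rule card_mono) auto
    ultimately show "r \<in> {1..m}" using a by simp
  qed
  ultimately have im: "?r ` {..<m} = {1..m}" by (intro card_subset_eq) (auto simp: card_image)
  have \<pi>: "?\<pi> \<in> permutations_of_set {1..m}"
  proof (rule permutations_of_setI)
    show "set ?\<pi> = {1..m}" using im by (simp add: atLeast0LessThan)
    show "distinct ?\<pi>" using \<open>inj_on ?r {..<m}\<close> by (simp add: distinct_map atLeast0LessThan)
  qed
  show ?thesis
  proof (rule ex1I[of _ ?\<pi>])
    show "?\<pi> \<in> permutations_of_set {1..m} \<and> (\<forall>a<m. \<forall>b<m. t a < t b \<longleftrightarrow> ?\<pi> ! a < ?\<pi> ! b)"
      using \<pi> rank by simp
    fix \<sigma> assume \<sigma>: "\<sigma> \<in> permutations_of_set {1..m} \<and> (\<forall>a<m. \<forall>b<m. t a < t b \<longleftrightarrow> \<sigma> ! a < \<sigma> ! b)"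
    then have len: "length \<sigma> = m" using length_finite_permutations_of_set[of \<sigma> "{1..m}"] by simp
    have d: "distinct \<sigma>" "set \<sigma> = {1..m}" using \<sigma> by (auto simp: permutations_of_set_def)
    have "\<sigma> ! a = ?r a" if a: "a < m" for a
    proof -
      have in1: "\<sigma> ! a \<in> {1..m}" using d len a nth_mem[of a \<sigma>] by simp
      have "?r a = card {b \<in> {..<m}. \<sigma> ! b \<le> \<sigma> ! a}"
        using \<sigma> a by (intro arg_cong[of _ _ card] Collect_cong) (auto simp flip: not_less)
      also have "\<dots> = card ((!) \<sigma> ` {b \<in> {..<m}. \<sigma> ! b \<le> \<sigma> ! a})"
        using d len by (intro card_image[symmetric]) (auto simp: inj_on_def nth_eq_iff_index_eq)
      also have "(!) \<sigma> ` {b \<in> {..<m}. \<sigma> ! b \<le> \<sigma> ! a} = {v \<in> set \<sigma>. v \<le> \<sigma> ! a}"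
        using len by (auto simp: in_set_conv_nth)
      also have "\<dots> = {1..\<sigma> ! a}" using in1 d by auto
      finally show ?thesis by simp
    qed
    then show "\<sigma> = ?\<pi>" using len by (intro nth_equalityI) auto
  qed
qed

lemma hits_inj:
  fixes u :: "nat \<Rightarrow> real"
  assumes y: "points_inc m y" and hit: "\<forall>k<m. \<exists>j. u j \<in> {y k<..y (Suc k)}"
  shows "inj_on (\<lambda>k. LEAST j. u j \<in> {y k<..y (Suc k)}) {..<m}"
proof (rule inj_onI)
  let ?t = "\<lambda>k. LEAST j. u j \<in> {y k<..y (Suc k)}"
  fix a b assume ab: "a \<in> {..<m}" "b \<in> {..<m}" "?t a = ?t b"
  have t: "u (?t k) \<in> {y k<..y (Suc k)}" if "k < m" for k
    using LeastI_ex[of "\<lambda>j. u j \<in> {y k<..y (Suc k)}"] hit that by blast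
  have gap: "gap_of m y (u (?t k)) = k" if "k < m" for k
    using t[OF that] by (subst gap_of_eq_iff[OF y that])
  have "a = gap_of m y (u (?t a))" using ab(1) by (intro gap[symmetric]) simp
  also have "\<dots> = gap_of m y (u (?t b))" unfolding ab(3) ..
  also have "\<dots> = b" using ab(2) by (intro gap) simp
  finally show "a = b" .
qed

lemma ex1_hit_order:
  fixes u :: "nat \<Rightarrow> real"
  assumes y: "points_inc m y" and hit: "\<forall>k<m. \<exists>j. u j \<in> {y k<..y (Suc k)}"
  shows "\<exists>!\<pi>. \<pi> \<in> permutations_of_set {1..m} \<and> hit_order m \<pi> y u"
proof -
  have "hit_order m \<pi> y u \<longleftrightarrow> (\<forall>a<m. \<forall>b<m. (LEAST j. u j \<in> {y a<..y (Suc a)}) < (LEAST j. u j \<in> {y b<..y (Suc b)})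
      \<longleftrightarrow> \<pi> ! a < \<pi> ! b)" for \<pi>
    unfolding hit_order_def appear_in_order_def using hit by blast
  then show ?thesis using ex1_order_pattern[OF hits_inj[OF y hit]] by (simp only:)
qed

text \<open>
  Almost surely the sample points are distinct, so that exactly one \<open>\<rho>\<close> sorts them, and all gaps are hit, so
  that exactly one \<open>\<pi>\<close> describes the order of the hits. The integrand \<open>\<Psi>\<close> therefore is almost everywhere
  a finite sum over \<open>\<rho>\<close> and \<open>\<pi>\<close>.
\<close>

lemma integral_over_orders:
  fixes \<Phi> :: "nat list \<Rightarrow> ennreal"
  assumes \<Psi>: "\<And>x u \<rho> \<pi>. x \<in> space (unit_cube (Suc m)) \<Longrightarrow> \<rho> \<in> permutations_of_set {1..Suc m} \<Longrightarrow>
      \<pi> \<in> permutations_of_set {1..m} \<Longrightarrow> points_inc m (\<lambda>k. x (\<rho> ! k)) \<Longrightarrow> hit_order m \<pi> (\<lambda>k. x (\<rho> ! k)) u \<Longrightarrow>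
      \<Psi> x u = \<Phi> \<pi>"
  shows "(\<integral>\<^sup>+ x. (\<integral>\<^sup>+ u. \<Psi> x u \<partial>unif_seq) \<partial>unit_cube (Suc m)) =
    (\<Sum>\<pi>\<in>permutations_of_set {1..m}. \<Phi> \<pi> * (\<Sum>\<rho>\<in>permutations_of_set {1..Suc m}. order_weight m \<rho> \<pi>))"
proof -
  let ?R = "permutations_of_set {1..Suc m}" and ?P = "permutations_of_set {1..m}"
  have term_eq: "(\<integral>\<^sup>+ u. \<Phi> \<pi> * (if points_inc m y then indicator {u. hit_order m \<pi> y u} u else 0) \<partial>unif_seq)
      = \<Phi> \<pi> * ordered_hit_prob m \<pi> y" for \<pi> y
    using sets_hit_order[of m \<pi> y]
    by (cases "points_inc m y") (simp_all add: ordered_hit_prob_def hit_prob_def nn_integral_cmult_indicator)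
  have meas: "(\<lambda>u. \<Phi> \<pi> * (if points_inc m y then indicator {u. hit_order m \<pi> y u} u else 0)) \<in> borel_measurable unif_seq" for \<pi> y
    using sets_hit_order[of m \<pi> y] by (cases "points_inc m y") simp_all
  have meas_x: "(\<lambda>x. \<Phi> \<pi> * ordered_hit_prob m \<pi> (\<lambda>k. x (\<rho> ! k))) \<in> borel_measurable (unit_cube (Suc m))"
    if "\<rho> \<in> ?R" for \<rho> \<pi>
    using measurable_ordered_hit_prob_cube[OF that, of \<pi>] by (intro borel_measurable_times_ennreal borel_measurable_const)
  have "AE x in unit_cube (Suc m). inj_on x {1..Suc m} \<and> x \<in> space (unit_cube (Suc m))"
    using AE_unit_cube_inj AE_space by eventually_elim simp
  then have "AE x in unit_cube (Suc m). (\<integral>\<^sup>+ u. \<Psi> x u \<partial>unif_seq) =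
      (\<Sum>\<rho>\<in>?R. \<Sum>\<pi>\<in>?P. \<Phi> \<pi> * ordered_hit_prob m \<pi> (\<lambda>k. x (\<rho> ! k)))"
  proof (rule eventually_mono)
    fix x assume x: "inj_on x {1..Suc m} \<and> x \<in> space (unit_cube (Suc m))"
    obtain \<rho> where \<rho>: "\<rho> \<in> ?R" "points_inc m (\<lambda>k. x (\<rho> ! k))"
      and \<rho>_unique: "\<And>\<sigma>. \<sigma> \<in> ?R \<Longrightarrow> points_inc m (\<lambda>k. x (\<sigma> ! k)) \<Longrightarrow> \<sigma> = \<rho>"
      using ex1_sorting_permutation[of x m] x by blast
    let ?y = "\<lambda>k. x (\<rho> ! k)"
    have len: "length \<rho> = Suc m" "set \<rho> = {1..Suc m}"
      using length_finite_permutations_of_set[OF \<rho>(1)] \<rho>(1) by (auto simp: permutations_of_set_def)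
    have "\<rho> ! k \<in> {1..Suc m}" if "k \<le> m" for k using nth_mem[of k \<rho>] that len by simp
    from this[of 0] this[of m] have "?y 0 \<in> {0..1}" "?y m \<in> {0..1}"
      using x by (auto simp: space_PiM space_restrict_space PiE_iff)
    then have "AE u in unif_seq. \<forall>k<m. \<exists>j. u j \<in> {?y k<..?y (Suc k)}"
      by (intro AE_all_hit \<rho>) auto
    then have "AE u in unif_seq. \<Psi> x u =
      (\<Sum>\<sigma>\<in>?R. \<Sum>\<pi>\<in>?P. \<Phi> \<pi> * (if points_inc m (\<lambda>k. x (\<sigma> ! k)) then indicator {u. hit_order m \<pi> (\<lambda>k. x (\<sigma> ! k)) u} u else 0))"
    proof (rule eventually_mono)
      fix u :: "nat \<Rightarrow> real" assume hit: "\<forall>k<m. \<exists>j. u j \<in> {?y k<..?y (Suc k)}"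
      obtain \<pi> where \<pi>: "\<pi> \<in> ?P" "hit_order m \<pi> ?y u"
        and \<pi>_unique: "\<And>\<sigma>. \<sigma> \<in> ?P \<Longrightarrow> hit_order m \<sigma> ?y u \<Longrightarrow> \<sigma> = \<pi>"
        using ex1_hit_order[OF \<rho>(2) hit] by blast
      have "(\<Sum>\<sigma>\<in>?R. \<Sum>\<tau>\<in>?P. \<Phi> \<tau> * (if points_inc m (\<lambda>k. x (\<sigma> ! k)) then indicator {u. hit_order m \<tau> (\<lambda>k. x (\<sigma> ! k)) u} u else 0))
        = (\<Sum>\<sigma>\<in>?R. if \<sigma> = \<rho> then (\<Sum>\<tau>\<in>?P. if \<tau> = \<pi> then \<Phi> \<pi> else 0) else 0)"
      proof (rule sum.cong[OF refl])
        fix \<sigma> assume \<sigma>: "\<sigma> \<in> ?R"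
        show "(\<Sum>\<tau>\<in>?P. \<Phi> \<tau> * (if points_inc m (\<lambda>k. x (\<sigma> ! k)) then indicator {u. hit_order m \<tau> (\<lambda>k. x (\<sigma> ! k)) u} u else 0))
          = (if \<sigma> = \<rho> then (\<Sum>\<tau>\<in>?P. if \<tau> = \<pi> then \<Phi> \<pi> else 0) else 0)"
        proof (cases "\<sigma> = \<rho>")
          case True
          have "\<Phi> \<tau> * indicator {u. hit_order m \<tau> ?y u} u = (if \<tau> = \<pi> then \<Phi> \<pi> else 0)" if "\<tau> \<in> ?P" for \<tau>
          proof (cases "\<tau> = \<pi>")
            case True
            then show ?thesis using \<pi>(2) by simp
          next
            case False
            then have "u \<notin> {u. hit_order m \<tau> ?y u}" using \<pi>_unique[OF that] by blast
            then show ?thesis using False by simp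
          qed
          then show ?thesis using True \<rho>(2) by simp
        next
          case False
          then have "\<not> points_inc m (\<lambda>k. x (\<sigma> ! k))" using \<rho>_unique[OF \<sigma>] by blast
          then show ?thesis using False by simp
        qed
      qed
      also have "\<dots> = \<Phi> \<pi>" using \<rho>(1) \<pi>(1) by simp
      finally show "\<Psi> x u = (\<Sum>\<sigma>\<in>?R. \<Sum>\<pi>\<in>?P. \<Phi> \<pi> * (if points_inc m (\<lambda>k. x (\<sigma> ! k)) then indicator {u. hit_order m \<pi> (\<lambda>k. x (\<sigma> ! k)) u} u else 0))"
        using \<Psi>[OF _ \<rho>(1) \<pi>(1) \<rho>(2) \<pi>(2)] x by simp
    qed
    then have "(\<integral>\<^sup>+ u. \<Psi> x u \<partial>unif_seq) = (\<integral>\<^sup>+ u. (\<Sum>\<sigma>\<in>?R. \<Sum>\<pi>\<in>?P. \<Phi> \<pi> *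
        (if points_inc m (\<lambda>k. x (\<sigma> ! k)) then indicator {u. hit_order m \<pi> (\<lambda>k. x (\<sigma> ! k)) u} u else 0)) \<partial>unif_seq)"
      by (rule nn_integral_cong_AE)
    also have "\<dots> = (\<Sum>\<sigma>\<in>?R. \<Sum>\<pi>\<in>?P. \<Phi> \<pi> * ordered_hit_prob m \<pi> (\<lambda>k. x (\<sigma> ! k)))"
      by (simp only: nn_integral_sum borel_measurable_sum meas term_eq)
    finally show "(\<integral>\<^sup>+ u. \<Psi> x u \<partial>unif_seq) = (\<Sum>\<sigma>\<in>?R. \<Sum>\<pi>\<in>?P. \<Phi> \<pi> * ordered_hit_prob m \<pi> (\<lambda>k. x (\<sigma> ! k)))" .
  qed
  then have "(\<integral>\<^sup>+ x. (\<integral>\<^sup>+ u. \<Psi> x u \<partial>unif_seq) \<partial>unit_cube (Suc m)) =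
      (\<integral>\<^sup>+ x. (\<Sum>\<rho>\<in>?R. \<Sum>\<pi>\<in>?P. \<Phi> \<pi> * ordered_hit_prob m \<pi> (\<lambda>k. x (\<rho> ! k))) \<partial>unit_cube (Suc m))"
    by (rule nn_integral_cong_AE)
  also have "\<dots> = (\<Sum>\<rho>\<in>?R. \<integral>\<^sup>+ x. (\<Sum>\<pi>\<in>?P. \<Phi> \<pi> * ordered_hit_prob m \<pi> (\<lambda>k. x (\<rho> ! k))) \<partial>unit_cube (Suc m))"
    by (intro nn_integral_sum borel_measurable_sum meas_x)
  also have "\<dots> = (\<Sum>\<rho>\<in>?R. \<Sum>\<pi>\<in>?P. \<Phi> \<pi> * order_weight m \<rho> \<pi>)"
  proof (rule sum.cong[OF refl])
    fix \<rho> assume \<rho>: "\<rho> \<in> ?R"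
    show "(\<integral>\<^sup>+ x. (\<Sum>\<pi>\<in>?P. \<Phi> \<pi> * ordered_hit_prob m \<pi> (\<lambda>k. x (\<rho> ! k))) \<partial>unit_cube (Suc m)) =
        (\<Sum>\<pi>\<in>?P. \<Phi> \<pi> * order_weight m \<rho> \<pi>)"
      unfolding order_weight_def
      by (simp only: nn_integral_sum meas_x[OF \<rho>] nn_integral_cmult measurable_ordered_hit_prob_cube[OF \<rho>])
  qed
  also have "\<dots> = (\<Sum>\<pi>\<in>?P. \<Phi> \<pi> * (\<Sum>\<rho>\<in>?R. order_weight m \<rho> \<pi>))"
    by (subst sum.swap) (simp add: sum_distrib_left)
  finally show ?thesis .
qed

text \<open>
  The total weight of an order \<open>\<pi>\<close> does not depend on \<open>\<pi>\<close>, and the weights sum to \<open>1\<close>, as the choice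
  \<open>\<Psi> = 1\<close> shows.
\<close>

lemma average_over_orders:
  fixes \<Phi> :: "nat list \<Rightarrow> ennreal"
  assumes \<Psi>: "\<And>x u \<rho> \<pi>. x \<in> space (unit_cube (Suc m)) \<Longrightarrow> \<rho> \<in> permutations_of_set {1..Suc m} \<Longrightarrow>
      \<pi> \<in> permutations_of_set {1..m} \<Longrightarrow> points_inc m (\<lambda>k. x (\<rho> ! k)) \<Longrightarrow> hit_order m \<pi> (\<lambda>k. x (\<rho> ! k)) u \<Longrightarrow>
      \<Psi> x u = \<Phi> \<pi>"
  shows "(\<integral>\<^sup>+ x. (\<integral>\<^sup>+ u. \<Psi> x u \<partial>unif_seq) \<partial>unit_cube (Suc m)) =
    (\<Sum>\<pi>\<in>permutations_of_set {1..m}. \<Phi> \<pi>) / ennreal (fact m)"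
proof -
  let ?R = "permutations_of_set {1..Suc m}" and ?P = "permutations_of_set {1..m}"
  define q where "q \<pi> = (\<Sum>\<rho>\<in>?R. order_weight m \<rho> \<pi>)" for \<pi>
  have const: "q \<pi> = q [1..<Suc m]" if "\<pi> \<in> ?P" for \<pi>
  proof -
    have "[1..<Suc m] \<in> ?P"
      by (rule permutations_of_setI) (simp_all only: set_upt atLeastLessThanSuc_atLeastAtMost distinct_upt)
    then show ?thesis unfolding q_def by (intro sum.cong refl order_weight_const that)
  qed
  have "(\<Sum>\<pi>\<in>?P. q \<pi>) = (\<integral>\<^sup>+ x. (\<integral>\<^sup>+ u. 1 \<partial>unif_seq) \<partial>unit_cube (Suc m))"
    using integral_over_orders[of m "\<lambda>_ _. 1" "\<lambda>_. 1"] by (simp add: q_def)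
  also have "\<dots> = 1"
    using prob_space.emeasure_space_1[OF prob_space_unif_seq] prob_space.emeasure_space_1[OF prob_space_PiM_unit[of "Suc m"]] by simp
  also have "(\<Sum>\<pi>\<in>?P. q \<pi>) = of_nat (card ?P) * q [1..<Suc m]"
    using const by simp
  finally have "q [1..<Suc m] * ennreal (fact m) = 1"
    by (simp add: mult.commute ennreal_of_nat_eq_real_of_nat)
  then have "q [1..<Suc m] = 1 / ennreal (fact m)"
    using ennreal_mult_divide_eq[of "ennreal (fact m)" "q [1..<Suc m]"] by simp
  then have q: "q \<pi> = 1 / ennreal (fact m)" if "\<pi> \<in> ?P" for \<pi> using const[OF that] by simp
  have "(\<integral>\<^sup>+ x. (\<integral>\<^sup>+ u. \<Psi> x u \<partial>unif_seq) \<partial>unit_cube (Suc m)) = (\<Sum>\<pi>\<in>?P. \<Phi> \<pi> * q \<pi>)"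
    unfolding q_def by (rule integral_over_orders) (rule \<Psi>)
  also have "\<dots> = (\<Sum>\<pi>\<in>?P. \<Phi> \<pi> * (1 / ennreal (fact m)))"
    using q by (intro sum.cong refl) simp
  also have "\<dots> = (\<Sum>\<pi>\<in>?P. \<Phi> \<pi>) * (1 / ennreal (fact m))" by (rule sum_distrib_right[symmetric])
  finally show ?thesis by (simp add: ennreal_times_divide)
qed

section \<open>Independent signs\<close>

text \<open>
  This replaces hitting times by their ranks.
\<close>

lemma list_graph_cong_order:
  fixes ts :: "'k::linorder list" and us :: "'l::linorder list"
  assumes len: "length ts = length us" "length ds = length us"
    and ord: "\<And>a b. a < length us \<Longrightarrow> b < length us \<Longrightarrow> ts ! a < ts ! b \<longleftrightarrow> us ! a < us ! b"
  shows "list_graph (zip ts ds) = list_graph (zip us ds)"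
proof -
  have "dec_between (zip ts ds) i j = dec_between (zip us ds) i j" if "j \<le> length us" for i j
  proof -
    have "ts ! a \<le> ts ! b \<longleftrightarrow> us ! a \<le> us ! b" if "a < length us" "b < length us" for a b
      using ord[OF that(2,1)] by (simp add: not_less[symmetric])
    then show ?thesis
      unfolding dec_between_def using that len by (intro bex_cong refl conj_cong ball_cong) auto
  qed
  then show ?thesis unfolding list_graph_def using len by auto
qed

text \<open>
  The decoration \<open>1\<close>, of probability \<open>1 - p\<close>, corresponds to \<open>Ominus\<close>.
\<close>

definition sign_seq :: "real \<Rightarrow> (nat \<Rightarrow> sign) measure" where
  "sign_seq p = (\<Pi>\<^sub>M j\<in>UNIV. distr (measure_pmf (bernoulli_pmf (1 - p))) (count_space UNIV) (\<lambda>b. if b then Ominus else Oplus))"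

lemma prob_space_sign: "prob_space (distr (measure_pmf (bernoulli_pmf (1 - p))) (count_space UNIV) (\<lambda>b. if b then Ominus else Oplus))"
  by (rule measure_pmf.prob_space_distr) simp

lemma prob_space_sign_seq: "prob_space (sign_seq p)"
  unfolding sign_seq_def by (intro prob_space_PiM prob_space_sign)

lemma space_sign_seq [simp]: "space (sign_seq p) = UNIV"
  by (simp add: sign_seq_def space_PiM)

lemma sets_sign_seq [measurable_cong]: "sets (sign_seq p) = sets (\<Pi>\<^sub>M j\<in>UNIV. count_space UNIV)"
  unfolding sign_seq_def by (intro sets_PiM_cong) auto

lemma weight_nonneg: "0 \<le> p \<Longrightarrow> p \<le> 1 \<Longrightarrow> 0 \<le> weight p ds"
  by (induction ds) auto

text \<open>
  Signs read at different times are independent.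
\<close>

lemma emeasure_signs:
  assumes p: "0 \<le> p" "p \<le> 1" and t: "inj_on t {..<m}" and ds: "length ds = m"
  shows "emeasure (sign_seq p) {s. \<forall>k<m. (s (t k) = Ominus) = ds ! k} = ennreal (weight p ds)"
    and "{s. \<forall>k<m. (s (t k) = Ominus) = ds ! k} \<in> sets (sign_seq p)"
proof -
  let ?\<nu> = "distr (measure_pmf (bernoulli_pmf (1 - p))) (count_space UNIV) (\<lambda>b. if b then Ominus else Oplus)"
  interpret product_prob_space "\<lambda>_. ?\<nu>" "UNIV :: nat set"
    by (simp add: product_prob_space_def product_prob_space_axioms_def product_sigma_finite_def
      prob_space_sign prob_space_imp_sigma_finite)
  \<comment> \<open>\<open>X j\<close> is the set of the signs allowed at time \<open>j\<close>.\<close>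
  define X where "X j = (if ds ! the_inv_into {..<m} t j then {Ominus} else {Oplus})" for j
  have Xt: "X (t k) = (if ds ! k then {Ominus} else {Oplus})" if "k < m" for k
    using the_inv_into_f_f[OF t, of k] that by (simp add: X_def)
  have sign_iff: "(sg = Ominus) = d \<longleftrightarrow> sg \<in> (if d then {Ominus} else {Oplus})" for sg d
    by (cases sg) auto
  have set: "{s. \<forall>k<m. (s (t k) = Ominus) = ds ! k} = emb UNIV (t ` {..<m}) (Pi\<^sub>E (t ` {..<m}) X)"
    unfolding sign_iff by (auto simp: prod_emb_def restrict_def PiE_iff Xt split: if_splits)
  have \<nu>: "emeasure ?\<nu> (if d then {Ominus} else {Oplus}) = ennreal (if d then 1 - p else p)" for d
  proof -
    have "(\<lambda>b. if b then Ominus else Oplus) -` (if d then {Ominus} else {Oplus}) = {d}" by (cases d) (auto split: if_splits)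
    then show ?thesis using p by (simp add: emeasure_distr emeasure_pmf_single)
  qed
  have "emeasure (sign_seq p) {s. \<forall>k<m. (s (t k) = Ominus) = ds ! k} = (\<Prod>j\<in>t ` {..<m}. emeasure ?\<nu> (X j))"
    unfolding set sign_seq_def by (rule emeasure_PiM_emb) auto
  also have "\<dots> = (\<Prod>k<m. ennreal (if ds ! k then 1 - p else p))"
    by (subst prod.reindex[OF t]) (auto intro!: prod.cong simp: Xt \<nu> simp del: if_split)
  also have "\<dots> = ennreal (\<Prod>k<m. if ds ! k then 1 - p else p)"
    using p by (intro prod_ennreal) auto
  also have "(\<Prod>k<m. if ds ! k then 1 - p else p) = weight p ds"
    unfolding weight_def prod.list_conv_set_nth using ds by (simp add: atLeast0LessThan)
  finally show "emeasure (sign_seq p) {s. \<forall>k<m. (s (t k) = Ominus) = ds ! k} = ennreal (weight p ds)" .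
  show "{s. \<forall>k<m. (s (t k) = Ominus) = ds ! k} \<in> sets (sign_seq p)"
    unfolding set sign_seq_def by (rule sets_PiM_I) auto
qed

lemma nn_integral_signs:
  assumes p: "0 \<le> p" "p \<le> 1" and t: "inj_on t {..<m}"
  shows "(\<integral>\<^sup>+ s. of_bool (Q (map (\<lambda>k. s (t k) = Ominus) [0..<m])) \<partial>sign_seq p) =
    (\<Sum>ds | length ds = m. of_bool (Q ds) * ennreal (weight p ds))"
proof -
  have fin: "finite {ds :: bool list. length ds = m}"
    using finite_lists_length_eq[of "UNIV :: bool set" m] by simp
  have "of_bool (Q (map (\<lambda>k. s (t k) = Ominus) [0..<m])) =
      (\<Sum>ds | length ds = m. of_bool (Q ds) * indicator {s. \<forall>k<m. (s (t k) = Ominus) = ds ! k} s :: ennreal)" for s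
  proof -
    have eq: "(\<forall>k<m. (s (t k) = Ominus) = ds ! k) \<longleftrightarrow> ds = map (\<lambda>k. s (t k) = Ominus) [0..<m]" if "length ds = m" for ds
      using that by (auto simp: list_eq_iff_nth_eq)
    have "(\<Sum>ds | length ds = m. of_bool (Q ds) * indicator {s. \<forall>k<m. (s (t k) = Ominus) = ds ! k} s :: ennreal) =
       (\<Sum>ds | length ds = m. if ds = map (\<lambda>k. s (t k) = Ominus) [0..<m] then of_bool (Q ds) else 0)"
      by (intro sum.cong refl) (auto simp: indicator_def eq)
    also have "\<dots> = of_bool (Q (map (\<lambda>k. s (t k) = Ominus) [0..<m]))"
      using fin by simp
    finally show ?thesis by simp
  qed
  then have "(\<integral>\<^sup>+ s. of_bool (Q (map (\<lambda>k. s (t k) = Ominus) [0..<m])) \<partial>sign_seq p) =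
      (\<integral>\<^sup>+ s. (\<Sum>ds | length ds = m. of_bool (Q ds) * indicator {s. \<forall>k<m. (s (t k) = Ominus) = ds ! k} s) \<partial>sign_seq p)"
    by simp
  also have "\<dots> = (\<Sum>ds | length ds = m. \<integral>\<^sup>+ s. of_bool (Q ds) * indicator {s. \<forall>k<m. (s (t k) = Ominus) = ds ! k} s \<partial>sign_seq p)"
    using emeasure_signs(2)[OF p t] by (intro nn_integral_sum) auto
  also have "\<dots> = (\<Sum>ds | length ds = m. of_bool (Q ds) * ennreal (weight p ds))"
    using emeasure_signs[OF p t] by (intro sum.cong refl) (simp add: nn_integral_cmult_indicator)
  finally show ?thesis .
qed

lemma sum_labelings_zip:
  assumes p: "0 \<le> p" "p \<le> 1"
  shows "(\<Sum>\<pi>\<in>permutations_of_set {1..m}. \<Sum>ds | length ds = m. of_bool (Q (zip \<pi> ds)) * ennreal (weight p ds)) =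
    ennreal (\<Sum>L | L \<in> labelings m \<and> Q L. weight p (map snd L))"
proof -
  have fin: "finite {ds :: bool list. length ds = m}"
    using finite_lists_length_eq[of "UNIV :: bool set" m] by simp
  have len: "length \<pi> = m" if "\<pi> \<in> permutations_of_set {1..m}" for \<pi> :: "nat list"
    using length_finite_permutations_of_set[OF that] by simp
  have bij: "bij_betw (\<lambda>(\<pi>, ds). zip \<pi> ds) (permutations_of_set {1..m} \<times> {ds. length ds = m}) (labelings m)"
  proof (rule bij_betw_byWitness[where f' = "\<lambda>L. (map fst L, map snd L)"])
    show "\<forall>a\<in>permutations_of_set {1..m} \<times> {ds. length ds = m}. (\<lambda>L. (map fst L, map snd L)) ((\<lambda>(\<pi>, ds). zip \<pi> ds) a) = a"
      using len by auto
    show "\<forall>L\<in>labelings m. (\<lambda>(\<pi>, ds). zip \<pi> ds) (map fst L, map snd L) = L"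
      by (simp add: zip_map_fst_snd)
    show "(\<lambda>(\<pi>, ds). zip \<pi> ds) ` (permutations_of_set {1..m} \<times> {ds. length ds = m}) \<subseteq> labelings m"
      using len by (auto simp: labelings_def permutations_of_set_def simp del: set_map)
    show "(\<lambda>L. (map fst L, map snd L)) ` labelings m \<subseteq> permutations_of_set {1..m} \<times> {ds. length ds = m}"
      using length_labelings by (auto simp: labelings_def permutations_of_set_def)
  qed
  have "(\<Sum>\<pi>\<in>permutations_of_set {1..m}. \<Sum>ds | length ds = m. of_bool (Q (zip \<pi> ds)) * ennreal (weight p ds)) =
    (\<Sum>x\<in>permutations_of_set {1..m} \<times> {ds. length ds = m}. case x of (\<pi>, ds) \<Rightarrow> of_bool (Q (zip \<pi> ds)) * ennreal (weight p (map snd (zip \<pi> ds))))"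
    unfolding sum.cartesian_product by (intro sum.cong refl) (use len in auto)
  also have "\<dots> = (\<Sum>L\<in>labelings m. of_bool (Q L) * ennreal (weight p (map snd L)))"
    by (subst sum.reindex_bij_betw[OF bij, symmetric]) (auto intro!: sum.cong)
  also have "\<dots> = (\<Sum>L\<in>labelings m. if Q L then ennreal (weight p (map snd L)) else 0)"
    by (intro sum.cong) auto
  also have "\<dots> = (\<Sum>L | L \<in> labelings m \<and> Q L. ennreal (weight p (map snd L)))"
    by (subst sum.inter_filter[symmetric]) (auto simp: finite_labelings)
  also have "\<dots> = ennreal (\<Sum>L | L \<in> labelings m \<and> Q L. weight p (map snd L))"
    using p by (intro sum_ennreal weight_nonneg)
  finally show ?thesis .
qed

section \<open>Sampling from the recursive cographon\<close>

text \<open>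
  The sampled graph of a graphon with values in \<open>{0, 1}\<close>, for which no randomness remains once the points are
  chosen.
\<close>

definition point_graph :: "nat \<Rightarrow> (real \<Rightarrow> real \<Rightarrow> real) \<Rightarrow> (nat \<Rightarrow> real) \<Rightarrow> nat graph" where
  "point_graph n W x = Graph {1..n} {{i, j} | i j. (i, j) \<in> index_pairs n \<and> W (x i) (x j) = 1}"

lemma graph_of_points_01:
  assumes W: "\<And>a b. W a b = 0 \<or> W a b = 1"
  shows "graph_of_points n W x = return_pmf (point_graph n W x)"
proof -
  have "bernoulli_pmf (W a b) = return_pmf (W a b = 1)" for a b
    by (rule pmf_eqI) (use W[of a b] in \<open>auto simp: pmf_return split: split_indicator\<close>)
  then have "(\<lambda>(i, j). bernoulli_pmf (W (x i) (x j))) = (\<lambda>z. return_pmf (W (x (fst z)) (x (snd z)) = 1))"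
    by (simp add: fun_eq_iff)
  then have "graph_of_points n W x = return_pmf (Graph {1..n} {{i, j} | i j. (i, j) \<in> index_pairs n \<and>
      (if (i, j) \<in> index_pairs n then W (x i) (x j) = 1 else False)})"
    by (simp add: graph_of_points_def finite_index_pairs)
  also have "\<dots> = return_pmf (point_graph n W x)"
    unfolding point_graph_def by (simp cong: conj_cong)
  finally show ?thesis .
qed

lemma ennreal_dens_01:
  assumes W: "\<And>a b. W a b = 0 \<or> W a b = 1" "graphon W"
  shows "ennreal (dens H W) = (\<integral>\<^sup>+ x. of_bool (graph_iso (point_graph (card (verts H)) W x) H) \<partial>unit_cube (card (verts H)))"
proof -
  let ?n = "card (verts H)"
  interpret prob_space "W_random_graph ?n W" by (rule prob_space_W_random_graph[OF W(2)])
  have "ennreal (dens H W) = emeasure (W_random_graph ?n W) {G. graph_iso G H}"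
    by (simp add: dens_def emeasure_eq_measure)
  also have "\<dots> = (\<integral>\<^sup>+ x. emeasure (measure_pmf (graph_of_points ?n W x)) {G. graph_iso G H} \<partial>unit_cube ?n)"
    unfolding W_random_graph_def
    by (rule emeasure_bind[OF prob_space.not_empty[OF prob_space_PiM_unit] measurable_graph_of_points[OF W(2)]]) simp
  also have "\<dots> = (\<integral>\<^sup>+ x. of_bool (graph_iso (point_graph ?n W x) H) \<partial>unit_cube ?n)"
    by (intro nn_integral_cong) (simp add: graph_of_points_01[OF W(1)] indicator_def)
  finally show ?thesis .
qed

lemma rec_cographon_01: "rec_cographon U S a b = 0 \<or> rec_cographon U S a b = 1"
  by (simp add: rec_cographon_def)

lemma rec_cographon_commute: "rec_cographon U S a b = rec_cographon U S b a"
  by (auto simp: rec_cographon_def)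

lemma rec_cographon_eq_1_iff:
  "a < b \<Longrightarrow> rec_cographon U S a b = 1 \<longleftrightarrow> (\<exists>j. minimal_index U a b j \<and> S j = Ominus)"
  by (auto simp: rec_cographon_def rec_prec_def)

text \<open>
  The interval between two sample points is the union of the gaps between them, so it is first hit when the first
  of these gaps is hit.
\<close>

lemma minimal_index_between_iff:
  fixes u :: "nat \<Rightarrow> real"
  assumes y: "points_inc m y" and hit: "\<forall>k<m. \<exists>j. u j \<in> {y k<..y (Suc k)}" and ij: "i < j" "j \<le> m"
  defines "t \<equiv> \<lambda>k. LEAST J. u J \<in> {y k<..y (Suc k)}"
  shows "minimal_index u (y i) (y j) J \<longleftrightarrow> (\<exists>k\<in>{i..<j}. J = t k \<and> (\<forall>l\<in>{i..<j}. t k \<le> t l))"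
proof -
  have gaps: "v \<in> {y i<..y j} \<longleftrightarrow> (\<exists>k\<in>{i..<j}. v \<in> {y k<..y (Suc k)})" for v
    using ij
  proof (induction j)
    case (Suc j)
    show ?case
    proof (cases "i = j")
      case True
      then show ?thesis by simp
    next
      case False
      have "y i < y j" "y j < y (Suc j)" using Suc.prems False points_inc_strict[OF y, of i j] points_inc_strict[OF y, of j "Suc j"] by auto
      then have "v \<in> {y i<..y (Suc j)} \<longleftrightarrow> v \<in> {y i<..y j} \<or> v \<in> {y j<..y (Suc j)}" by auto
      moreover have "{i..<Suc j} = insert j {i..<j}" using Suc.prems by auto
      moreover have "v \<in> {y i<..y j} \<longleftrightarrow> (\<exists>k\<in>{i..<j}. v \<in> {y k<..y (Suc k)})" by (rule Suc.IH) (use Suc.prems False in auto)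
      ultimately show ?thesis by auto
    qed
  qed simp
  have t: "u (t k) \<in> {y k<..y (Suc k)}" if "k < m" for k
    unfolding t_def using LeastI_ex[of "\<lambda>j. u j \<in> {y k<..y (Suc k)}"] hit that by blast
  have t_le: "t k \<le> J" if "u J \<in> {y k<..y (Suc k)}" for k J
    unfolding t_def using that by (rule Least_le)
  have t_in: "u (t k) \<in> {y i<..y j}" if "k \<in> {i..<j}" for k
    unfolding gaps using that t[of k] ij by (intro bexI[of _ k]) auto
  show ?thesis
  proof
    assume J: "minimal_index u (y i) (y j) J"
    then obtain k where k: "k \<in> {i..<j}" "u J \<in> {y k<..y (Suc k)}"
      unfolding minimal_index_def gaps by blast
    have min: "J \<le> t l" if "l \<in> {i..<j}" for l
      using J t_in[OF that] unfolding minimal_index_def by (meson not_le)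
    have "J = t k" using min[OF k(1)] t_le[OF k(2)] by simp
    then show "\<exists>k\<in>{i..<j}. J = t k \<and> (\<forall>l\<in>{i..<j}. t k \<le> t l)" using k(1) min by blast
  next
    assume "\<exists>k\<in>{i..<j}. J = t k \<and> (\<forall>l\<in>{i..<j}. t k \<le> t l)"
    then obtain k where k: "k \<in> {i..<j}" "J = t k" "\<And>l. l \<in> {i..<j} \<Longrightarrow> t k \<le> t l" by blast
    have "u I \<notin> {y i<..y j}" if "I < J" for I
    proof
      assume "u I \<in> {y i<..y j}"
      then obtain l where "l \<in> {i..<j}" "u I \<in> {y l<..y (Suc l)}" unfolding gaps by blast
      then show False using k(2) k(3)[of l] t_le[of I l] that by linarith
    qed
    then show "minimal_index u (y i) (y j) J"
      unfolding minimal_index_def using t_in[OF k(1)] k(2) by blast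
  qed
qed

text \<open>
  Position \<open>k\<close> of the list corresponds to the \<open>k\<close>-th smallest sample point, which has index \<open>\<rho> ! k\<close>.
\<close>

lemma point_graph_iso:
  fixes u :: "nat \<Rightarrow> real"
  assumes \<rho>: "\<rho> \<in> permutations_of_set {1..Suc m}" and y: "points_inc m (\<lambda>k. x (\<rho> ! k))"
    and hit: "\<forall>k<m. \<exists>j. u j \<in> {x (\<rho> ! k)<..x (\<rho> ! Suc k)}"
  defines "t \<equiv> \<lambda>k. LEAST J. u J \<in> {x (\<rho> ! k)<..x (\<rho> ! Suc k)}"
  shows "graph_iso (list_graph (zip (map t [0..<m]) (map (\<lambda>k. s (t k) = Ominus) [0..<m])))
    (point_graph (Suc m) (rec_cographon u s) x)"
proof (rule graph_iso_list_graphI)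
  let ?L = "zip (map t [0..<m]) (map (\<lambda>k. s (t k) = Ominus) [0..<m])"
  let ?G = "point_graph (Suc m) (rec_cographon u s) x"
  have len: "length \<rho> = Suc m" and set\<rho>: "set \<rho> = {1..Suc m}" and dist: "distinct \<rho>"
    using length_finite_permutations_of_set[OF \<rho>] \<rho> by (auto simp: permutations_of_set_def)
  show "bij_betw ((!) \<rho>) {..length ?L} (verts ?G)"
    using bij_betw_nth[OF dist _ refl, of "{..<Suc m}"] len set\<rho>
    by (simp add: point_graph_def lessThan_Suc_atMost)
  show "{v} \<notin> edges ?G" for v
    by (auto simp: point_graph_def index_pairs_def)
  fix i j assume ij: "i < j" "j \<le> length ?L"
  then have "j \<le> m" by simp
  have edge: "{a, b} \<in> edges ?G \<longleftrightarrow> rec_cographon u s (x a) (x b) = 1"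
    if ab: "a \<in> {1..Suc m}" "b \<in> {1..Suc m}" "a \<noteq> b" for a b
  proof -
    have lt: "{a, b} \<in> edges ?G \<longleftrightarrow> rec_cographon u s (x a) (x b) = 1"
      if "1 \<le> a" "a < b" "b \<le> Suc m" for a b
    proof
      assume "{a, b} \<in> edges ?G"
      then show "rec_cographon u s (x a) (x b) = 1"
        using that by (auto simp: point_graph_def index_pairs_def doubleton_eq_iff)
    next
      assume "rec_cographon u s (x a) (x b) = 1"
      then show "{a, b} \<in> edges ?G"
        unfolding point_graph_def graph.sel using that
        by (intro CollectI exI[of _ a] exI[of _ b]) (simp add: index_pairs_def)
    qed
    consider "a < b" | "b < a" using ab(3) by linarith
    then show ?thesis
    proof cases
      case 1
      then show ?thesis using ab by (intro lt) auto
    next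
      case 2
      then show ?thesis using ab lt[of b a] rec_cographon_commute[of u s "x a" "x b"] by (simp add: insert_commute)
    qed
  qed
  have nth: "\<rho> ! k \<in> {1..Suc m}" if "k \<le> m" for k using nth_mem[of k \<rho>] that len set\<rho> by simp
  have "{\<rho> ! i, \<rho> ! j} \<in> edges ?G \<longleftrightarrow> rec_cographon u s (x (\<rho> ! i)) (x (\<rho> ! j)) = 1"
    using nth[of i] nth[of j] ij \<open>j \<le> m\<close> len dist by (intro edge) (auto simp: nth_eq_iff_index_eq)
  also have "\<dots> \<longleftrightarrow> (\<exists>J. minimal_index u (x (\<rho> ! i)) (x (\<rho> ! j)) J \<and> s J = Ominus)"
    using points_inc_strict[OF y ij(1) \<open>j \<le> m\<close>] by (rule rec_cographon_eq_1_iff)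
  also have "\<dots> \<longleftrightarrow> (\<exists>k\<in>{i..<j}. s (t k) = Ominus \<and> (\<forall>l\<in>{i..<j}. t k \<le> t l))"
    unfolding minimal_index_between_iff[OF y hit ij(1) \<open>j \<le> m\<close>] t_def by blast
  also have "\<dots> \<longleftrightarrow> dec_between ?L i j"
    unfolding dec_between_def using \<open>j \<le> m\<close> by (intro bex_cong conj_cong ball_cong refl) auto
  finally show "dec_between ?L i j \<longleftrightarrow> {\<rho> ! i, \<rho> ! j} \<in> edges ?G" by simp
qed

text \<open>
  For fixed points and a fixed sequence \<open>u\<close>, the probability over the signs depends on the order of the hits
  only.
\<close>

lemma integral_signs_point_graph:
  assumes p: "0 \<le> p" "p \<le> 1" and \<rho>: "\<rho> \<in> permutations_of_set {1..Suc m}"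
    and \<pi>: "\<pi> \<in> permutations_of_set {1..m}"
    and y: "points_inc m (\<lambda>k. x (\<rho> ! k))" and ord: "hit_order m \<pi> (\<lambda>k. x (\<rho> ! k)) u"
  shows "(\<integral>\<^sup>+ s. of_bool (graph_iso (point_graph (Suc m) (rec_cographon u s) x) H) \<partial>sign_seq p) =
    (\<Sum>ds | length ds = m. of_bool (graph_iso (list_graph (zip \<pi> ds)) H) * ennreal (weight p ds))"
proof -
  \<comment> \<open>The time at which gap \<open>k\<close> is first hit.\<close>
  let ?t = "\<lambda>k. LEAST J. u J \<in> {x (\<rho> ! k)<..x (\<rho> ! Suc k)}"
  have hit: "\<forall>k<m. \<exists>j. u j \<in> {x (\<rho> ! k)<..x (\<rho> ! Suc k)}"
    and less: "\<And>a b. a < m \<Longrightarrow> b < m \<Longrightarrow> ?t a < ?t b \<longleftrightarrow> \<pi> ! a < \<pi> ! b"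
    using ord unfolding hit_order_def appear_in_order_def by blast+
  have len: "length \<pi> = m" using length_finite_permutations_of_set[OF \<pi>] by simp
  have graph: "list_graph (zip (map ?t [0..<m]) ds) = list_graph (zip \<pi> ds)" if "length ds = m" for ds
    using that len less by (intro list_graph_cong_order) auto
  have "graph_iso (point_graph (Suc m) (rec_cographon u s) x) H \<longleftrightarrow>
      graph_iso (list_graph (zip \<pi> (map (\<lambda>k. s (?t k) = Ominus) [0..<m]))) H" for s
    using graph_iso_cong[OF point_graph_iso[OF \<rho> y hit, of s], of H] graph[of "map (\<lambda>k. s (?t k) = Ominus) [0..<m]"] by simp
  then show ?thesis
    using nn_integral_signs[OF p hits_inj[OF y hit], of "\<lambda>ds. graph_iso (list_graph (zip \<pi> ds)) H"] by simp
qed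

lemma integral_point_graph:
  assumes p: "0 \<le> p" "p \<le> 1"
  shows "(\<integral>\<^sup>+ x. (\<integral>\<^sup>+ u. (\<integral>\<^sup>+ s. of_bool (graph_iso (point_graph (Suc m) (rec_cographon u s) x) H) \<partial>sign_seq p) \<partial>unif_seq) \<partial>unit_cube (Suc m))
    = ennreal ((\<Sum>L | L \<in> labelings m \<and> graph_iso (list_graph L) H. weight p (map snd L)) / fact m)"
proof -
  have "(\<integral>\<^sup>+ x. (\<integral>\<^sup>+ u. (\<integral>\<^sup>+ s. of_bool (graph_iso (point_graph (Suc m) (rec_cographon u s) x) H) \<partial>sign_seq p) \<partial>unif_seq) \<partial>unit_cube (Suc m))
    = (\<Sum>\<pi>\<in>permutations_of_set {1..m}. \<Sum>ds | length ds = m. of_bool (graph_iso (list_graph (zip \<pi> ds)) H) * ennreal (weight p ds)) / ennreal (fact m)"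
    by (rule average_over_orders) (rule integral_signs_point_graph[OF p])
  also have "\<dots> = ennreal (\<Sum>L | L \<in> labelings m \<and> graph_iso (list_graph L) H. weight p (map snd L)) / ennreal (fact m)"
    unfolding sum_labelings_zip[OF p, where Q = "\<lambda>L. graph_iso (list_graph L) H"] ..
  also have "\<dots> = ennreal ((\<Sum>L | L \<in> labelings m \<and> graph_iso (list_graph L) H. weight p (map snd L)) / fact m)"
    by (rule divide_ennreal) (auto intro!: sum_nonneg weight_nonneg p)
  finally show ?thesis .
qed

text \<open>
  The graph is determined by finitely many adjacencies, each of which is a countable combination of
  conditions on single terms of the sequences.
\<close>

lemma measurable_point_graph:
  assumes u: "\<And>j. (\<lambda>z. u z j) \<in> borel_measurable N"
    and s: "\<And>j. (\<lambda>z. s z j) \<in> measurable N (count_space UNIV)"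
    and x: "\<And>i. i \<in> {1..n} \<Longrightarrow> (\<lambda>z. x z i) \<in> borel_measurable N"
  shows "Measurable.pred N (\<lambda>z. graph_iso (point_graph n (rec_cographon (u z) (s z)) (x z)) H)"
proof -
  have minus: "Measurable.pred N (\<lambda>z. \<exists>j. minimal_index (u z) (f z) (g z) j \<and> s z j = Ominus)"
    if [measurable]: "f \<in> borel_measurable N" "g \<in> borel_measurable N" for f g :: "_ \<Rightarrow> real"
  proof -
    have hit: "Measurable.pred N (\<lambda>z. u z j \<in> {f z<..g z})" for j
      unfolding greaterThanAtMost_iff using u[of j] by measurable
    have sgn: "Measurable.pred N (\<lambda>z. s z j = Ominus)" for j
      using s[of j] by measurable
    show ?thesis unfolding minimal_index_def
      by (intro pred_intros_countable pred_intros_logic(3) pred_intros_imp' pred_intros_logic(2) hit sgn)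
  qed
  have adj: "Measurable.pred N (\<lambda>z. rec_cographon (u z) (s z) (x z i) (x z j) = 1)" if ij: "i \<in> {1..n}" "j \<in> {1..n}" for i j
  proof -
    have "rec_cographon U S a b = 1 \<longleftrightarrow> (a < b \<and> (\<exists>j. minimal_index U a b j \<and> S j = Ominus)) \<or>
        (b < a \<and> (\<exists>j. minimal_index U b a j \<and> S j = Ominus))" for U S a b
      by (auto simp: rec_cographon_def rec_prec_def)
    moreover have "Measurable.pred N (\<lambda>z. (x z i < x z j \<and> (\<exists>k. minimal_index (u z) (x z i) (x z j) k \<and> s z k = Ominus)) \<or>
        (x z j < x z i \<and> (\<exists>k. minimal_index (u z) (x z j) (x z i) k \<and> s z k = Ominus)))"
      by (intro pred_intros_logic(3,5) minus borel_measurable_pred_less x ij)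
    ultimately show ?thesis by simp
  qed
  have range: "fst e \<in> {1..n}" "snd e \<in> {1..n}" if "e \<in> index_pairs n" for e
    using that by (auto simp: index_pairs_def)
  have "Measurable.pred N (\<lambda>z. \<exists>c\<in>Pow (index_pairs n). (\<forall>e\<in>index_pairs n. (rec_cographon (u z) (s z) (x z (fst e)) (x z (snd e)) = 1) = (e \<in> c)) \<and>
      graph_iso (Graph {1..n} {{i, j} | i j. (i, j) \<in> c}) H)"
    by (intro pred_intros_finite(3,4) pred_intros_conj2' pred_intros_logic(6) adj measurable_const)
      (use finite_index_pairs range in auto)
  moreover have "graph_iso (point_graph n W y) H \<longleftrightarrow> (\<exists>c\<in>Pow (index_pairs n). (\<forall>e\<in>index_pairs n. (W (y (fst e)) (y (snd e)) = 1) = (e \<in> c)) \<and>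
      graph_iso (Graph {1..n} {{i, j} | i j. (i, j) \<in> c}) H)" for W :: "real \<Rightarrow> real \<Rightarrow> real" and y
  proof -
    let ?c = "{e \<in> index_pairs n. W (y (fst e)) (y (snd e)) = 1}"
    have eq: "point_graph n W y = Graph {1..n} {{i, j} | i j. (i, j) \<in> ?c}" by (simp add: point_graph_def)
    show ?thesis
    proof
      assume "graph_iso (point_graph n W y) H"
      then show "\<exists>c\<in>Pow (index_pairs n). (\<forall>e\<in>index_pairs n. (W (y (fst e)) (y (snd e)) = 1) = (e \<in> c)) \<and>
          graph_iso (Graph {1..n} {{i, j} | i j. (i, j) \<in> c}) H"
        unfolding eq by (intro bexI[of _ ?c]) auto
    next
      assume "\<exists>c\<in>Pow (index_pairs n). (\<forall>e\<in>index_pairs n. (W (y (fst e)) (y (snd e)) = 1) = (e \<in> c)) \<and>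
          graph_iso (Graph {1..n} {{i, j} | i j. (i, j) \<in> c}) H"
      then obtain c where c: "c \<subseteq> index_pairs n" "\<forall>e\<in>index_pairs n. (W (y (fst e)) (y (snd e)) = 1) = (e \<in> c)"
        "graph_iso (Graph {1..n} {{i, j} | i j. (i, j) \<in> c}) H" by blast
      have "c = ?c" using c(1,2) by blast
      then show "graph_iso (point_graph n W y) H" unfolding eq using c(3) by (simp only:)
    qed
  qed
  ultimately show ?thesis by simp
qed

text \<open>
  By Fubini the sample points may be fixed first, then the sequence \<open>u\<close>, and the signs are averaged
  innermost.
\<close>

lemma expectation_dens:
  fixes M :: "'w measure" and U :: "nat \<Rightarrow> 'w \<Rightarrow> real" and S :: "nat \<Rightarrow> 'w \<Rightarrow> sign"
  assumes p: "0 \<le> p" "p \<le> 1" and H: "card (verts H) = Suc m"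
    and M: "prob_space M"
    and [measurable]: "(\<lambda>\<omega> j. U j \<omega>) \<in> measurable M (\<Pi>\<^sub>M j\<in>UNIV. borel)"
      "(\<lambda>\<omega> j. S j \<omega>) \<in> measurable M (\<Pi>\<^sub>M j\<in>UNIV. count_space UNIV)"
    and law: "distr M ((\<Pi>\<^sub>M j\<in>UNIV. borel) \<Otimes>\<^sub>M (\<Pi>\<^sub>M j\<in>UNIV. count_space UNIV)) (\<lambda>\<omega>. (\<lambda>j. U j \<omega>, \<lambda>j. S j \<omega>)) =
      unif_seq \<Otimes>\<^sub>M sign_seq p"
  shows "prob_space.expectation M (\<lambda>\<omega>. dens H (rec_cographon (\<lambda>j. U j \<omega>) (\<lambda>j. S j \<omega>))) =
    (\<Sum>L | L \<in> labelings m \<and> graph_iso (list_graph L) H. weight p (map snd L)) / fact m"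
proof -
  let ?X = "unit_cube (Suc m)" and ?B = "(\<Pi>\<^sub>M j\<in>UNIV. borel) :: (nat \<Rightarrow> real) measure"
    and ?C = "(\<Pi>\<^sub>M j\<in>UNIV. count_space UNIV) :: (nat \<Rightarrow> sign) measure"
  let ?I = "\<lambda>u s x. of_bool (graph_iso (point_graph (Suc m) (rec_cographon u s) x) H) :: ennreal"
  let ?E = "(\<Sum>L | L \<in> labelings m \<and> graph_iso (list_graph L) H. weight p (map snd L)) / fact m"
  interpret M: prob_space M by fact
  interpret X: prob_space ?X by (rule prob_space_PiM_unit)
  interpret U: prob_space unif_seq by (rule prob_space_unif_seq)
  interpret S: prob_space "sign_seq p" by (rule prob_space_sign_seq)
  interpret US: pair_prob_space unif_seq "sign_seq p" ..
  interpret USX: pair_sigma_finite "unif_seq \<Otimes>\<^sub>M sign_seq p" ?X ..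
  have sets_US: "sets (unif_seq \<Otimes>\<^sub>M sign_seq p) = sets (?B \<Otimes>\<^sub>M ?C)"
    by (intro sets_pair_measure_cong sets_PiM_cong sets_sign_seq) auto
  have meas: "Measurable.pred ((?B \<Otimes>\<^sub>M ?C) \<Otimes>\<^sub>M ?X) (\<lambda>z. graph_iso (point_graph (Suc m) (rec_cographon (fst (fst z)) (snd (fst z))) (snd z)) H)"
  proof (rule measurable_point_graph)
    show "(\<lambda>z. fst (fst z) j) \<in> borel_measurable ((?B \<Otimes>\<^sub>M ?C) \<Otimes>\<^sub>M ?X)" for j by measurable
    show "(\<lambda>z. snd (fst z) j) \<in> measurable ((?B \<Otimes>\<^sub>M ?C) \<Otimes>\<^sub>M ?X) (count_space UNIV)" for j by measurable
    show "(\<lambda>z. snd z i) \<in> borel_measurable ((?B \<Otimes>\<^sub>M ?C) \<Otimes>\<^sub>M ?X)" if "i \<in> {1..Suc m}" for i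
      by (rule measurable_compose[OF measurable_snd measurable_unit_cube_component[OF that]])
  qed
  have ind: "(\<lambda>(us, x). ?I (fst us) (snd us) x) \<in> borel_measurable ((?B \<Otimes>\<^sub>M ?C) \<Otimes>\<^sub>M ?X)"
  proof -
    have "(\<lambda>z. if graph_iso (point_graph (Suc m) (rec_cographon (fst (fst z)) (snd (fst z))) (snd z)) H then 1 else 0 :: ennreal)
        \<in> borel_measurable ((?B \<Otimes>\<^sub>M ?C) \<Otimes>\<^sub>M ?X)"
      by (rule measurable_If[OF measurable_const measurable_const meas[unfolded pred_def]]) auto
    then show ?thesis by (simp add: split_beta of_bool_def)
  qed
  have ind': "(\<lambda>(us, x). ?I (fst us) (snd us) x) \<in> borel_measurable ((unif_seq \<Otimes>\<^sub>M sign_seq p) \<Otimes>\<^sub>M ?X)"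
    using ind measurable_cong_sets[OF sets_pair_measure_cong[OF sets_US refl] refl] by blast
  \<comment> \<open>The density of \<open>H\<close> as a function of the two sequences.\<close>
  define G where "G us = (\<integral>\<^sup>+ x. ?I (fst us) (snd us) x \<partial>?X)" for us
  have G: "G \<in> borel_measurable (?B \<Otimes>\<^sub>M ?C)"
    unfolding G_def using X.borel_measurable_nn_integral[OF ind] .
  have dens: "ennreal (dens H (rec_cographon u s)) = G (u, s)" for u s
    unfolding G_def fst_conv snd_conv
    using ennreal_dens_01[OF rec_cographon_01 graphon_rec_cographon, of H u s] unfolding H .
  have pair: "(\<lambda>\<omega>. (\<lambda>j. U j \<omega>, \<lambda>j. S j \<omega>)) \<in> measurable M (?B \<Otimes>\<^sub>M ?C)" by measurable
  have dens_real: "dens H (rec_cographon (\<lambda>j. U j \<omega>) (\<lambda>j. S j \<omega>)) = enn2real (G (\<lambda>j. U j \<omega>, \<lambda>j. S j \<omega>))" for \<omega>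
    unfolding dens[symmetric] by (simp add: dens_def)
  have dens_meas: "(\<lambda>\<omega>. dens H (rec_cographon (\<lambda>j. U j \<omega>) (\<lambda>j. S j \<omega>))) \<in> borel_measurable M"
    unfolding dens_real by (intro borel_measurable_enn2real measurable_compose[OF pair G])
  have "(\<integral>\<^sup>+ \<omega>. ennreal (dens H (rec_cographon (\<lambda>j. U j \<omega>) (\<lambda>j. S j \<omega>))) \<partial>M) = (\<integral>\<^sup>+ us. G us \<partial>(unif_seq \<Otimes>\<^sub>M sign_seq p))"
    unfolding dens law[symmetric] by (rule nn_integral_distr[OF pair, symmetric]) (use G in simp)
  also have "\<dots> = (\<integral>\<^sup>+ x. (\<integral>\<^sup>+ us. ?I (fst us) (snd us) x \<partial>(unif_seq \<Otimes>\<^sub>M sign_seq p)) \<partial>?X)"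
    unfolding G_def by (rule USX.Fubini'[OF ind', symmetric])
  also have "\<dots> = (\<integral>\<^sup>+ x. (\<integral>\<^sup>+ u. (\<integral>\<^sup>+ s. ?I u s x \<partial>sign_seq p) \<partial>unif_seq) \<partial>?X)"
  proof (rule nn_integral_cong)
    fix x assume x: "x \<in> space ?X"
    have "(\<lambda>us. ?I (fst us) (snd us) x) \<in> borel_measurable (unif_seq \<Otimes>\<^sub>M sign_seq p)"
      using measurable_compose[OF measurable_Pair2'[OF x] ind'] by simp
    from S.nn_integral_fst[OF this] show "(\<integral>\<^sup>+ us. ?I (fst us) (snd us) x \<partial>(unif_seq \<Otimes>\<^sub>M sign_seq p)) = (\<integral>\<^sup>+ u. (\<integral>\<^sup>+ s. ?I u s x \<partial>sign_seq p) \<partial>unif_seq)"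
      by simp
  qed
  also have "\<dots> = ennreal ?E" by (rule integral_point_graph[OF p])
  finally have "(\<integral>\<^sup>+ \<omega>. ennreal (dens H (rec_cographon (\<lambda>j. U j \<omega>) (\<lambda>j. S j \<omega>))) \<partial>M) = ennreal ?E" .
  moreover have "0 \<le> ?E" by (intro divide_nonneg_nonneg sum_nonneg weight_nonneg p) simp
  ultimately show ?thesis
    by (subst integral_eq_nn_integral[OF dens_meas]) (auto simp: dens_def)
qed

text \<open>
  The joint law of the two sequences is a product measure. It suffices to compare rectangles, on which this
  is the assumed independence of the two sequences.
\<close>

lemma law_of_sequences:
  fixes M :: "'w measure" and U :: "nat \<Rightarrow> 'w \<Rightarrow> real" and S :: "nat \<Rightarrow> 'w \<Rightarrow> sign"
  assumes p: "0 \<le> p" "p \<le> 1" and M: "prob_space M"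
    and U: "prob_space.indep_vars M (\<lambda>_. borel) U UNIV" "\<And>j. distr M borel (U j) = unif"
    and S: "prob_space.indep_vars M (\<lambda>_. count_space UNIV) S UNIV" "\<And>j. measure M {\<omega> \<in> space M. S j \<omega> = Oplus} = p"
    and US: "prob_space.indep_set M
           {(\<lambda>\<omega> j. U j \<omega>) -` A \<inter> space M | A. A \<in> sets (\<Pi>\<^sub>M j\<in>UNIV. borel)}
           {(\<lambda>\<omega> j. S j \<omega>) -` B \<inter> space M | B. B \<in> sets (\<Pi>\<^sub>M j\<in>UNIV. count_space UNIV)}"
  shows "(\<lambda>\<omega> j. U j \<omega>) \<in> measurable M (\<Pi>\<^sub>M j\<in>UNIV. borel)"
    and "(\<lambda>\<omega> j. S j \<omega>) \<in> measurable M (\<Pi>\<^sub>M j\<in>UNIV. count_space UNIV)"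
    and "distr M ((\<Pi>\<^sub>M j\<in>UNIV. borel) \<Otimes>\<^sub>M (\<Pi>\<^sub>M j\<in>UNIV. count_space UNIV)) (\<lambda>\<omega>. (\<lambda>j. U j \<omega>, \<lambda>j. S j \<omega>)) =
      unif_seq \<Otimes>\<^sub>M sign_seq p"
proof -
  interpret M: prob_space M by fact
  let ?B = "(\<Pi>\<^sub>M j\<in>UNIV. borel) :: (nat \<Rightarrow> real) measure"
    and ?C = "(\<Pi>\<^sub>M j\<in>UNIV. count_space UNIV) :: (nat \<Rightarrow> sign) measure"
    and ?\<nu> = "distr (measure_pmf (bernoulli_pmf (1 - p))) (count_space UNIV) (\<lambda>b. if b then Ominus else Oplus)"
  have Um: "U j \<in> borel_measurable M" and Sm: "S j \<in> measurable M (count_space UNIV)" for j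
    using U(1) S(1) unfolding M.indep_vars_def2 by auto
  show Bm: "(\<lambda>\<omega> j. U j \<omega>) \<in> measurable M ?B" by (intro measurable_PiM_single') (auto intro: Um)
  show Cm: "(\<lambda>\<omega> j. S j \<omega>) \<in> measurable M ?C" by (intro measurable_PiM_single') (auto intro: Sm)
  have "distr M ?B (\<lambda>\<omega>. \<lambda>j\<in>UNIV. U j \<omega>) = (\<Pi>\<^sub>M j\<in>UNIV. distr M borel (U j))"
    using U(1) by (subst (asm) M.indep_vars_iff_distr_eq_PiM) (auto intro: Um)
  then have lawU: "distr M ?B (\<lambda>\<omega> j. U j \<omega>) = unif_seq" unfolding U(2) by (simp add: restrict_def)
  have "distr M (count_space UNIV) (S j) = ?\<nu>" for j
  proof (rule measure_eqI_countable[where A = "UNIV :: sign set"])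
    have "(UNIV :: sign set) = {Oplus, Ominus}" by (auto intro: sign.exhaust)
    then have "finite (UNIV :: sign set)" by (metis finite.emptyI finite.insertI)
    then show "countable (UNIV :: sign set)" by (rule countable_finite)
    fix a :: sign
    have plus: "M.prob (S j -` {Oplus} \<inter> space M) = p"
      using S(2)[of j] by (simp add: vimage_def Int_def conj_commute)
    have "sg = Ominus \<longleftrightarrow> sg \<noteq> Oplus" for sg by (cases sg) auto
    then have "S j -` {Ominus} \<inter> space M = space M - (S j -` {Oplus} \<inter> space M)" by auto
    then have minus: "M.prob (S j -` {Ominus} \<inter> space M) = 1 - p"
      using M.prob_compl[OF measurable_sets[OF Sm[of j], of "{Oplus}"]] plus by simp
    have v: "(\<lambda>b. if b then Ominus else Oplus) -` {Oplus} = {False}" "(\<lambda>b. if b then Ominus else Oplus) -` {Ominus} = {True}"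
      by (auto split: if_splits)
    show "emeasure (distr M (count_space UNIV) (S j)) {a} = emeasure ?\<nu> {a}"
      using plus minus p by (cases a) (simp_all add: emeasure_distr[OF Sm] M.emeasure_eq_measure emeasure_distr v emeasure_pmf_single)
  qed auto
  moreover have "distr M ?C (\<lambda>\<omega>. \<lambda>j\<in>UNIV. S j \<omega>) = (\<Pi>\<^sub>M j\<in>UNIV. distr M (count_space UNIV) (S j))"
    using S(1) by (subst (asm) M.indep_vars_iff_distr_eq_PiM) (auto intro: Sm)
  ultimately have lawS: "distr M ?C (\<lambda>\<omega> j. S j \<omega>) = sign_seq p" by (simp add: sign_seq_def restrict_def)
  let ?J = "distr M (?B \<Otimes>\<^sub>M ?C) (\<lambda>\<omega>. (\<lambda>j. U j \<omega>, \<lambda>j. S j \<omega>))"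
  have pair: "(\<lambda>\<omega>. (\<lambda>j. U j \<omega>, \<lambda>j. S j \<omega>)) \<in> measurable M (?B \<Otimes>\<^sub>M ?C)"
    using Bm Cm by (rule measurable_Pair)
  have "distr M ?B (\<lambda>\<omega> j. U j \<omega>) \<Otimes>\<^sub>M distr M ?C (\<lambda>\<omega> j. S j \<omega>) = ?J"
  proof (rule pair_measure_eqI)
    show "sigma_finite_measure (distr M ?B (\<lambda>\<omega> j. U j \<omega>))"
      by (rule prob_space_imp_sigma_finite[OF M.prob_space_distr[OF Bm]])
    show "sigma_finite_measure (distr M ?C (\<lambda>\<omega> j. S j \<omega>))"
      by (rule prob_space_imp_sigma_finite[OF M.prob_space_distr[OF Cm]])
    show "sets (distr M ?B (\<lambda>\<omega> j. U j \<omega>) \<Otimes>\<^sub>M distr M ?C (\<lambda>\<omega> j. S j \<omega>)) = sets ?J"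
      by simp
    fix A B assume "A \<in> sets (distr M ?B (\<lambda>\<omega> j. U j \<omega>))" "B \<in> sets (distr M ?C (\<lambda>\<omega> j. S j \<omega>))"
    then have A: "A \<in> sets ?B" and B: "B \<in> sets ?C" by simp_all
    let ?a = "(\<lambda>\<omega> j. U j \<omega>) -` A \<inter> space M" and ?b = "(\<lambda>\<omega> j. S j \<omega>) -` B \<inter> space M"
    have "M.prob (?a \<inter> ?b) = M.prob ?a * M.prob ?b"
      using A B by (intro M.indep_setD[OF US]) blast+
    moreover have "(\<lambda>\<omega>. (\<lambda>j. U j \<omega>, \<lambda>j. S j \<omega>)) -` (A \<times> B) \<inter> space M = ?a \<inter> ?b" by auto
    ultimately show "emeasure (distr M ?B (\<lambda>\<omega> j. U j \<omega>)) A * emeasure (distr M ?C (\<lambda>\<omega> j. S j \<omega>)) B = emeasure ?J (A \<times> B)"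
      using A B by (simp add: emeasure_distr[OF Bm] emeasure_distr[OF Cm] emeasure_distr[OF pair] M.emeasure_eq_measure ennreal_mult)
  qed
  then show "?J = unif_seq \<Otimes>\<^sub>M sign_seq p"
    unfolding lawU lawS by simp
qed

theorem proposition1p14:
  fixes p :: real and n :: nat and H :: "'a graph"
    and M :: "'w measure" and U :: "nat \<Rightarrow> 'w \<Rightarrow> real" and S :: "nat \<Rightarrow> 'w \<Rightarrow> sign"
  assumes "0 < p" "p < 1"
    and "n \<ge> 1"
    and "simple_graph H" "card (verts H) = n"
    and "prob_space M"
    and "prob_space.indep_vars M (\<lambda>_. borel) U UNIV"
    and "\<And>j. distr M borel (U j) = uniform_measure lborel {0..1}"
    and "prob_space.indep_vars M (\<lambda>_. count_space UNIV) S UNIV"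
    and "\<And>j. measure M {\<omega> \<in> space M. S j \<omega> = Oplus} = p"
    and "prob_space.indep_set M
           {(\<lambda>\<omega> j. U j \<omega>) -` A \<inter> space M | A. A \<in> sets (\<Pi>\<^sub>M j\<in>UNIV. borel)}
           {(\<lambda>\<omega> j. S j \<omega>) -` B \<inter> space M | B. B \<in> sets (\<Pi>\<^sub>M j\<in>UNIV. count_space UNIV)}"
  shows "prob_space.expectation M
           (\<lambda>\<omega>. dens H (rec_cographon (\<lambda>j. U j \<omega>) (\<lambda>j. S j \<omega>)))
         = measure_pmf.prob (rec_cograph p n) {G. graph_iso G H}
       \<and> measure_pmf.prob (rec_cograph p n) {G. graph_iso G H}
         = real (N_inc H) / fact (n - 1) * p ^ Z H * (1 - p) ^ (n - 1 - Z H)"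
proof -
  obtain m where n: "n = Suc m" using \<open>n \<ge> 1\<close> by (cases n) auto
  have H: "card (verts H) = Suc m" using assms(5) n by simp
  have p: "0 \<le> p" "p \<le> 1" using assms(1,2) by auto
  let ?S = "\<Sum>L | L \<in> labelings m \<and> graph_iso (list_graph L) H. weight p (map snd L)"
  note law = law_of_sequences[OF p assms(6-11)]
  have "prob_space.expectation M (\<lambda>\<omega>. dens H (rec_cographon (\<lambda>j. U j \<omega>) (\<lambda>j. S j \<omega>))) = ?S / fact m"
    by (rule expectation_dens[OF p H assms(6) law])
  moreover have "measure_pmf.prob (rec_cograph p n) {G. graph_iso G H} = ?S / fact m"
    unfolding n by (rule prob_rec_cograph[OF assms(1,2)])
  moreover have "?S / fact m = real (N_inc H) / fact (n - 1) * p ^ Z H * (1 - p) ^ (n - 1 - Z H)"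
    unfolding sum_weight_labelings[OF H] n by simp
  ultimately show ?thesis by simp
qed

end
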